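(* Let $A,B$ be positive bounded operators on a Hilbert space $\mathcal{H}$. For any homogeneous $f\in C([0,\infty)^2)$, \[ f(A,B)=\lim_{(\varepsilon_1,\varepsilon_2)\searrow(0,0)} f(A_{\varepsilon_1},B_{\varepsilon_2}) \] in the strong operator topology, where $A_{\varepsilon_1}:=A+\varepsilon_1 I_{\mathcal{H}}$, $B_{\varepsilon_2}:=B+\varepsilon_2 I_{\mathcal{H}}$, and $f(\cdot,\cdot)$ denotes Pusz--Woronowicz's functional calculus (defined in the context).
   Context: Conventions. $C([0,\infty)^2)$ is the set of continuous (complex-valued) functions on $[0,\infty)^2$. A function $f$ on $[0,\infty)^2$ is homogeneous if $f(\lambda r,\lambda s)=\lambda f(r,s)$ for all $\lambda,r,s\ge 0$. The limit $(\varepsilon_1,\varepsilon_2)\searrow(0,0)$ is over $\varepsilon_1,\varepsilon_2\ge 0$ and means $\varepsilon_1+\varepsilon_2\searrow 0$. Functional calculus of commuting selfadjoint operators. For commuting bounded selfadjoint operators $S,T$ and a bounded Borel function $g$ on $\sigma(S)\times\sigma(T)$, $g(S,T):=\hat g(N)$, where $N=S+iT$ (normal), $\hat g(z)=g(\mathrm{Re}\,z,\mathrm{Im}\,z)$, and $\hat g(N)$ is the Borel functional calculus of $N$. Pusz--Woronowicz's functional calculus. Let $A,B$ be positive bounded operators on $\mathcal{H}$. Put $\mathcal{H}_0:=\mathrm{Ker}(A+B)$, $\mathcal{H}_1:=\mathcal{H}_0^\perp$. Then $A=0\oplus A_1$, $B=0\oplus B_1$ along $\mathcal{H}=\mathcal{H}_0\oplus\mathcal{H}_1$,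 with $\mathrm{Ker}(A_1+B_1)=\{0\}$. Let $X,Y$ be the unique contractions on $\mathcal{H}_1$ with $X(A_1+B_1)^{1/2}=A_1^{1/2}$ and $Y(A_1+B_1)^{1/2}=B_1^{1/2}$, and set $R:=X^*X$, $S:=Y^*Y$. One has $R+S=I_{\mathcal{H}_1}$, so $R,S$ are commuting positive contractions. For a homogeneous Borel function $f$ on $[0,\infty)^2$ that is bounded on compact subsets, define \[ f(A,B):=0\oplus (A_1+B_1)^{1/2}f(R,S)(A_1+B_1)^{1/2}\quad\text{along } \mathcal{H}=\mathcal{H}_0\oplus\mathcal{H}_1 . \] *)

theory Defs
  imports "HOL-Analysis.Analysis"
begin

section \<open>Complex Hilbert spaces\<close>

text \<open>The underlying real inner product space of a complex one carries the real part of the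
  complex inner product, so the norm \<open>sqrt (x \<bullet> x)\<close> inherited from \<^class>\<open>real_inner\<close> is the Hilbert
  space norm. The inner product is linear in its first argument.\<close>

class complex_inner = real_inner +
  fixes scaleC :: "complex \<Rightarrow> 'a \<Rightarrow> 'a" (infixr "*\<^sub>C" 75)
    and cinner :: "'a \<Rightarrow> 'a \<Rightarrow> complex"
  assumes scaleC_add_right: "c *\<^sub>C (x + y) = c *\<^sub>C x + c *\<^sub>C y"
    and scaleC_add_left: "(c + d) *\<^sub>C x = c *\<^sub>C x + d *\<^sub>C x"
    and scaleC_scaleC: "c *\<^sub>C d *\<^sub>C x = (c * d) *\<^sub>C x"
    and scaleC_of_real: "complex_of_real r *\<^sub>C x = r *\<^sub>R x"
    and cinner_commute: "cinner x y = cnj (cinner y x)"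
    and cinner_add_left: "cinner (x + y) z = cinner x z + cinner y z"
    and cinner_scaleC_left: "cinner (c *\<^sub>C x) y = c * cinner x y"
    and inner_eq_Re_cinner: "inner x y = Re (cinner x y)"

class chilbert_space = complex_inner + complete_space

section \<open>Bounded operators on a closed subspace\<close>

text \<open>Throughout, \<open>M\<close> is a closed complex subspace. A bounded operator \<open>T\<close> on \<open>M\<close> is represented by
  the operator on the whole space which is \<open>T\<close> on \<open>M\<close> and \<open>0\<close> on the orthogonal complement of \<open>M\<close>,
  that is, by the direct sum of \<open>0\<close> and \<open>T\<close>. For \<open>M = UNIV\<close> these are the bounded operators on the
  whole space.\<close>

definition orth_compl :: "'a::complex_inner set \<Rightarrow> 'a set" where
  "orth_compl M = {x. \<forall>y\<in>M. cinner x y = 0}"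

definition proj :: "'a::complex_inner set \<Rightarrow> 'a \<Rightarrow> 'a" where
  "proj M x = (THE p. p \<in> M \<and> x - p \<in> orth_compl M)"

definition operator_on :: "'a::complex_inner set \<Rightarrow> ('a \<Rightarrow> 'a) \<Rightarrow> bool" where
  "operator_on M T \<longleftrightarrow> bounded_linear T \<and> (\<forall>c x. T (c *\<^sub>C x) = c *\<^sub>C T x) \<and>
     range T \<subseteq> M \<and> (\<forall>x\<in>orth_compl M. T x = 0)"

definition positive_on :: "'a::complex_inner set \<Rightarrow> ('a \<Rightarrow> 'a) \<Rightarrow> bool" where
  "positive_on M T \<longleftrightarrow> operator_on M T \<and>
     (\<forall>x\<in>M. cinner (T x) x \<in> \<real> \<and> 0 \<le> Re (cinner (T x) x))"

definition contraction_on :: "'a::complex_inner set \<Rightarrow> ('a \<Rightarrow> 'a) \<Rightarrow> bool" where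
  "contraction_on M T \<longleftrightarrow> operator_on M T \<and> (\<forall>x\<in>M. norm (T x) \<le> norm x)"

text \<open>The component on \<open>M\<close> of an operator that is reduced by \<open>M\<close>.\<close>

definition part_on :: "'a::complex_inner set \<Rightarrow> ('a \<Rightarrow> 'a) \<Rightarrow> 'a \<Rightarrow> 'a" where
  "part_on M T = (\<lambda>x. T (proj M x))"

definition adjoint_on :: "'a::complex_inner set \<Rightarrow> ('a \<Rightarrow> 'a) \<Rightarrow> 'a \<Rightarrow> 'a" where
  "adjoint_on M T = (THE T'. operator_on M T' \<and> (\<forall>x\<in>M. \<forall>y\<in>M. cinner (T x) y = cinner x (T' y)))"

definition sqrt_on :: "'a::complex_inner set \<Rightarrow> ('a \<Rightarrow> 'a) \<Rightarrow> 'a \<Rightarrow> 'a" where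
  "sqrt_on M T = (THE Q. positive_on M Q \<and> Q \<circ> Q = T)"

definition spectrum_on :: "'a::complex_inner set \<Rightarrow> ('a \<Rightarrow> 'a) \<Rightarrow> complex set" where
  "spectrum_on M T =
     {z. \<not> (\<exists>Q. operator_on M Q \<and> (\<forall>x\<in>M. Q (T x - z *\<^sub>C x) = x \<and> T (Q x) - z *\<^sub>C Q x = x))}"

section \<open>Borel functional calculus\<close>

text \<open>Projection-valued measures on the Borel sets of the complex plane, acting on \<open>M\<close>. The values
  of \<open>E\<close> on sets that are not Borel are irrelevant.\<close>

definition projection_valued_measure_on ::
    "'a::complex_inner set \<Rightarrow> (complex set \<Rightarrow> 'a \<Rightarrow> 'a) \<Rightarrow> bool" where
  "projection_valued_measure_on M E \<longleftrightarrow>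
     (\<forall>U\<in>sets borel. operator_on M (E U) \<and> E U \<circ> E U = E U \<and>
        (\<forall>x y. cinner (E U x) y = cinner x (E U y))) \<and>
     (\<forall>U\<in>sets borel. \<forall>V\<in>sets borel. E (U \<inter> V) = E U \<circ> E V) \<and>
     E UNIV = proj M \<and>
     (\<forall>F :: nat \<Rightarrow> complex set. range F \<subseteq> sets borel \<longrightarrow> disjoint_family F \<longrightarrow>
        (\<forall>x. (\<lambda>n. E (F n) x) sums E (\<Union>n. F n) x))"

definition scalar_measure :: "(complex set \<Rightarrow> 'a::complex_inner \<Rightarrow> 'a) \<Rightarrow> 'a \<Rightarrow> complex measure" where
  "scalar_measure E x = measure_of UNIV (sets borel) (\<lambda>U. ennreal (Re (cinner (E U x) x)))"

text \<open>The integral of \<open>g\<close> over \<open>K\<close> with respect to \<open>E\<close>, in the weak sense. By polarization an operator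
  on a complex space is determined by its quadratic form. Values of \<open>g\<close> off \<open>K\<close> play no role.\<close>

definition spectral_integral_on :: "'a::complex_inner set \<Rightarrow> (complex set \<Rightarrow> 'a \<Rightarrow> 'a) \<Rightarrow>
    complex set \<Rightarrow> (complex \<Rightarrow> complex) \<Rightarrow> 'a \<Rightarrow> 'a" where
  "spectral_integral_on M E K g =
     (THE T. operator_on M T \<and> (\<forall>x\<in>M. cinner (T x) x = (LINT z:K|scalar_measure E x. g z)))"

text \<open>For normal \<open>N\<close>, the spectral theorem makes the following unique on Borel sets.\<close>

definition is_spectral_measure_on ::
    "'a::complex_inner set \<Rightarrow> ('a \<Rightarrow> 'a) \<Rightarrow> (complex set \<Rightarrow> 'a \<Rightarrow> 'a) \<Rightarrow> bool" where
  "is_spectral_measure_on M N E \<longleftrightarrow> projection_valued_measure_on M E \<and>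
     E (spectrum_on M N) = proj M \<and> N = spectral_integral_on M E (spectrum_on M N) (\<lambda>z. z)"

definition spectral_measure_on :: "'a::complex_inner set \<Rightarrow> ('a \<Rightarrow> 'a) \<Rightarrow> complex set \<Rightarrow> 'a \<Rightarrow> 'a" where
  "spectral_measure_on M N = (SOME E. is_spectral_measure_on M N E)"

definition borel_calculus_on ::
    "'a::complex_inner set \<Rightarrow> (complex \<Rightarrow> complex) \<Rightarrow> ('a \<Rightarrow> 'a) \<Rightarrow> 'a \<Rightarrow> 'a" where
  "borel_calculus_on M g N = spectral_integral_on M (spectral_measure_on M N) (spectrum_on M N) g"

definition joint_calculus_on :: "'a::complex_inner set \<Rightarrow> (real \<times> real \<Rightarrow> complex) \<Rightarrow>
    ('a \<Rightarrow> 'a) \<Rightarrow> ('a \<Rightarrow> 'a) \<Rightarrow> 'a \<Rightarrow> 'a" where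
  "joint_calculus_on M g S T =
     borel_calculus_on M (\<lambda>z. g (Re z, Im z)) (\<lambda>x. S x + \<i> *\<^sub>C T x)"

section \<open>The functional calculus of Pusz and Woronowicz\<close>

definition homogeneous :: "(real \<times> real \<Rightarrow> complex) \<Rightarrow> bool" where
  "homogeneous f \<longleftrightarrow>
     (\<forall>l r s. 0 \<le> l \<longrightarrow> 0 \<le> r \<longrightarrow> 0 \<le> s \<longrightarrow> f (l * r, l * s) = complex_of_real l * f (r, s))"

text \<open>By the representation of operators on \<open>H1\<close> chosen above, the result is already extended by
  \<open>0\<close> to \<open>H0\<close>.\<close>

definition pw_calculus :: "(real \<times> real \<Rightarrow> complex) \<Rightarrow>
    ('a::complex_inner \<Rightarrow> 'a) \<Rightarrow> ('a \<Rightarrow> 'a) \<Rightarrow> 'a \<Rightarrow> 'a" where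
  "pw_calculus f A B =
    (let H0 = {x. A x + B x = 0};
         H1 = orth_compl H0;
         A1 = part_on H1 A;
         B1 = part_on H1 B;
         Q = sqrt_on H1 (\<lambda>x. A1 x + B1 x);
         X = (THE X. contraction_on H1 X \<and> X \<circ> Q = sqrt_on H1 A1);
         Y = (THE Y. contraction_on H1 Y \<and> Y \<circ> Q = sqrt_on H1 B1);
         R = adjoint_on H1 X \<circ> X;
         S = adjoint_on H1 Y \<circ> Y
     in Q \<circ> joint_calculus_on H1 f R S \<circ> Q)"

end

theory Submission
  imports Defs "HOL-Computational_Algebra.Polynomial" "HOL-Probability.Helly_Selection"
begin

text \<open>The operator \<open>f(A, B)\<close> depends only on the function \<open>h t = f (t, 1 - t)\<close> on the unit interval. Put
  \<open>T = A + B\<close>, and let \<open>R\<close> be the positive contraction on the complement of the kernel of \<open>T\<close> with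
  \<open>sqrt T * R * sqrt T = A\<close>. Then \<open>f(A, B) = sqrt T * h(R) * sqrt T\<close> (\<open>exists_pw_ratio\<close>). For the pair
  \<open>A + e1\<close>, \<open>B + e2\<close>, with \<open>e = e1 + e2\<close>, the same formula holds with \<open>T + e\<close> and another contraction
  \<open>R'\<close>.

  The square roots converge in norm, because \<open>sqrt (T + e)\<close> is a function of \<open>T\<close>
  (\<open>norm_op_sqrt_shift_le\<close>). The heart of the matter is that \<open>R'\<close> converges strongly to \<open>R\<close> on the
  complement of the kernel (\<open>pw_ratio_shift_tendsto\<close>). The range of \<open>sqrt T\<close> is dense there, so one
  compares \<open>R'\<close> and \<open>R\<close> at vectors of the form \<open>sqrt T v\<close>, and the inequalities \<open>T \<le> T + e\<close> and
  \<open>e \<le> T + e\<close> provide estimates that are uniform in \<open>e\<close> (\<open>norm_pw_ratio_shift_diff_le\<close>). Strong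
  convergence of contractions passes to polynomials, and by uniform approximation to \<open>h\<close>
  (\<open>cont_calculus_tendsto\<close>).

  What remains is to identify the operator \<open>h(R)\<close> that the definition provides, namely an integral
  against some spectral measure of the normal operator \<open>R + \<i> (1 - R)\<close>. This amounts to the spectral
  theorem for \<open>R\<close>. A polynomial that is nonnegative on the unit interval takes a positive value at \<open>R\<close>,
  because its coordinates in Bernstein bases of growing degree are almost nonnegative
  (\<open>poly_op_nonneg\<close>); this gives the continuous calculus. The Bernstein weights at a vector have a weak
  limit point, the distribution of \<open>R\<close> in that vector (\<open>exists_spectral_dist_unit\<close>). Spectral projections
  are strong limits of continuous functions for closed sets (\<open>closed_spectral_proj\<close>), and come from
  Dynkin's induction and inner regularity for Borel sets. Their image on the segment from \<open>\<i>\<close> to \<open>1\<close> is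
  a spectral measure of the normal operator, since the resolvent set is the union of the balls of
  measure zero (\<open>is_spectral_measure_segment_measure\<close>). Conversely, every spectral measure of the normal
  operator integrates \<open>h\<close> of the real part to \<open>h(R)\<close> (\<open>joint_calculus_eq_complex_calculus\<close>).

  The projection onto the complement of the kernel, the factors of the square roots and their adjoints
  are all obtained as strong limits of operators built from continuous functions of \<open>T\<close> that approximate
  \<open>1 / sqrt t\<close> (\<open>support_decomposition\<close>, \<open>contraction_factor\<close>).\<close>

section \<open>Polynomials of a positive contraction\<close>

text \<open>The value \<open>p(R) x\<close> by the Horner scheme. Written as a fold over the coefficients, like the
  evaluation of polynomials at numbers, it obeys the same algebraic laws by induction on \<open>p\<close>.\<close>

definition poly_op :: "('a::real_vector \<Rightarrow> 'a) \<Rightarrow> real poly \<Rightarrow> 'a \<Rightarrow> 'a" where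
  "poly_op R p x = fold_coeffs (\<lambda>a y. a *\<^sub>R x + R y) p 0"

lemma poly_op_0 [simp]: "poly_op R 0 x = 0"
  by (simp add: poly_op_def)

lemma poly_op_pCons:
  assumes "linear R"
  shows "poly_op R (pCons a p) x = a *\<^sub>R x + R (poly_op R p x)"
proof (cases "a = 0 \<and> p = 0")
  case True
  then show ?thesis using linear_0[OF assms] by simp
next
  case False
  then show ?thesis by (auto simp: poly_op_def)
qed

context
  fixes R :: "'a::real_vector \<Rightarrow> 'a"
  assumes lin: "linear R"
begin

lemma poly_op_const: "poly_op R [:a:] x = a *\<^sub>R x"
  by (simp add: poly_op_pCons[OF lin] linear_0[OF lin])

lemma poly_op_X: "poly_op R [:0, 1:] x = R x"
  by (simp add: poly_op_pCons[OF lin] linear_0[OF lin])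

lemma poly_op_add: "poly_op R (p + q) x = poly_op R p x + poly_op R q x"
proof (induction p q rule: poly_induct2)
  case (pCons a p b q)
  then show ?case
    by (simp add: poly_op_pCons[OF lin] linear_add[OF lin] algebra_simps)
qed simp

lemma poly_op_smult: "poly_op R (smult c p) x = c *\<^sub>R poly_op R p x"
  by (induction p) (simp_all add: poly_op_pCons[OF lin] linear_scale[OF lin] algebra_simps)

lemma poly_op_diff: "poly_op R (p - q) x = poly_op R p x - poly_op R q x"
  using poly_op_add[of p "smult (-1) q" x] poly_op_smult[of "-1" q x] by simp

lemma poly_op_sum: "poly_op R (\<Sum>i\<in>I. p i) x = (\<Sum>i\<in>I. poly_op R (p i) x)"
  by (induction I rule: infinite_finite_induct) (simp_all add: poly_op_add)

lemma poly_op_linear: "linear (poly_op R p)"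
proof (induction p)
  case 0
  then show ?case by (simp add: linear_iff)
next
  case (pCons a p)
  then show ?case
    by (simp add: poly_op_pCons[OF lin] linear_iff linear_add[OF lin] linear_scale[OF lin] algebra_simps)
qed

lemma poly_op_mult: "poly_op R (p * q) x = poly_op R p (poly_op R q x)"
  by (induction p)
     (simp_all add: poly_op_add poly_op_smult poly_op_pCons[OF lin])

lemma poly_op_commute:
  assumes "linear C" and "\<And>x. C (R x) = R (C x)"
  shows "C (poly_op R p x) = poly_op R p (C x)"
  by (induction p)
     (simp_all add: poly_op_pCons[OF lin] linear_0[OF assms(1)] linear_add[OF assms(1)]
        linear_scale[OF assms(1)] assms(2))

end

lemma bounded_linear_poly_op:
  assumes "bounded_linear R"
  shows "bounded_linear (poly_op R p)"
proof (induction p)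
  case 0
  then show ?case by (simp add: bounded_linear_zero)
next
  case (pCons a p)
  have "bounded_linear (\<lambda>x. a *\<^sub>R x + R (poly_op R p x))"
    by (intro bounded_linear_add bounded_linear_scaleR_right
        bounded_linear_compose[OF assms] pCons)
  then show ?case
    using poly_op_pCons[OF bounded_linear.linear[OF assms]] by presburger
qed

text \<open>Everything up to the spectral projections takes place in a real Hilbert space. This covers
  complex spaces too: there the real inner product is the real part of the complex one, and a
  real-linear operator is complex-linear when it commutes with multiplication by \<open>\<i>\<close>.\<close>

locale pos_contraction =
  fixes R :: "'a::{real_inner, complete_space} \<Rightarrow> 'a"
  assumes bounded_linear: "bounded_linear R"
    and symmetric: "inner (R x) y = inner x (R y)"
    and nonneg: "0 \<le> inner (R x) x"
    and le_id: "inner (R x) x \<le> inner x x"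
begin

lemma linear: "linear R"
  by (rule bounded_linear.linear[OF bounded_linear])

lemmas op_simps = poly_op_const[OF linear] poly_op_X[OF linear] poly_op_add[OF linear]
  poly_op_diff[OF linear] poly_op_smult[OF linear] poly_op_mult[OF linear] poly_op_pCons[OF linear]

lemma poly_op_symmetric: "inner (poly_op R p x) y = inner x (poly_op R p y)"
proof (induction p arbitrary: y)
  case (pCons a p)
  have "R (poly_op R p y) = poly_op R p (R y)"
    by (rule poly_op_commute[OF linear linear refl])
  then show ?case
    by (simp add: op_simps symmetric pCons inner_add_left inner_add_right)
qed simp

text \<open>Squares can be pulled out, since \<open>\<langle>r(R) q(R) x, q(R) x\<rangle>\<close> has the sign of \<open>r(R)\<close>. This leaves
  \<open>1\<close>, \<open>t\<close> and \<open>1 - t\<close>, unless both exponents are odd; then the factor \<open>1 = t + (1 - t)\<close> makes one of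
  them even in each summand.\<close>

lemma poly_op_monomial_nonneg:
  "0 \<le> inner (poly_op R ([:0, 1:] ^ k * [:1, -1:] ^ m) x) x"
proof -
  have square: "0 \<le> inner (poly_op R (r * (q * q)) x) x"
    if "\<And>y. 0 \<le> inner (poly_op R r y) y" for r q :: "real poly" and x
  proof -
    have "inner (poly_op R (r * (q * q)) x) x = inner (poly_op R (q * (r * q)) x) x"
      by (simp add: mult.left_commute)
    also have "\<dots> = inner (poly_op R r (poly_op R q x)) (poly_op R q x)"
      by (simp add: op_simps poly_op_symmetric[of q])
    finally show ?thesis using that by simp
  qed
  have one: "0 \<le> inner (poly_op R 1 y) y" for y
    using poly_op_const[OF linear, of 1 y] by (simp add: one_pCons)
  have X: "0 \<le> inner (poly_op R [:0, 1:] y) y" for y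
    using nonneg poly_op_X[OF linear] by simp
  have Y: "0 \<le> inner (poly_op R [:1, -1:] y) y" for y
    using le_id[of y] by (simp add: op_simps linear_0[OF linear] inner_diff_left linear_neg[OF linear])
  have ee: "0 \<le> inner (poly_op R (r * ([:0, 1:] ^ (2 * i) * [:1, -1:] ^ (2 * j))) y) y"
    if "\<And>y. 0 \<le> inner (poly_op R r y) y" for i j r y
    using square[of r "[:0, 1:] ^ i * [:1, -1:] ^ j" y] that
    unfolding power_even_eq power2_eq_square by (simp only: mult_ac)
  consider (a) i j where "k = 2 * i" "m = 2 * j" | (b) i j where "k = Suc (2 * i)" "m = 2 * j"
    | (c) i j where "k = 2 * i" "m = Suc (2 * j)" | (d) i j where "k = Suc (2 * i)" "m = Suc (2 * j)"
    by (metis evenE oddE Suc_eq_plus1)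
  then show ?thesis
  proof cases
    case a
    then show ?thesis using ee[OF one, of i j x] by simp
  next
    case b
    then show ?thesis using ee[OF X, of i j x] by (simp only: power_Suc mult_ac)
  next
    case c
    then show ?thesis using ee[OF Y, of i j x] by (simp only: power_Suc mult_ac)
  next
    case d
    have split: "u * p * (v * q) = u * (p * (v * v * q)) + v * (u * u * p * q)"
      if "u + v = 1" for u v p q :: "real poly"
    proof -
      have "u * p * (v * q) = (u * p * (v * q)) * (u + v)"
        using that by simp
      then show ?thesis by (simp only: algebra_simps)
    qed
    have "[:0, 1:] + [:1, -1:] = (1 :: real poly)"
      by (simp add: one_pCons)
    from split[OF this] have "[:0, 1:] ^ k * [:1, -1:] ^ m =
        [:0, 1:] * ([:0, 1:] ^ (2 * i) * [:1, -1:] ^ (2 * Suc j)) +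
        [:1, -1:] * ([:0, 1:] ^ (2 * Suc i) * [:1, -1:] ^ (2 * j) :: real poly)"
      unfolding d by (simp only: power_Suc mult_Suc_right power_add power2_eq_square)
    then show ?thesis
      using ee[OF X, of i "Suc j" x] ee[OF Y, of "Suc i" j x]
      by (simp only: op_simps(3) inner_add_left add_nonneg_nonneg)
  qed
qed

end

definition bernstein_basis :: "nat \<Rightarrow> nat \<Rightarrow> real poly" where
  "bernstein_basis n k = smult (real (n choose k)) ([:0, 1:] ^ k * [:1, -1:] ^ (n - k))"

definition bernstein_poly :: "nat \<Rightarrow> (real \<Rightarrow> real) \<Rightarrow> real poly" where
  "bernstein_poly n g = (\<Sum>k\<le>n. smult (g (real k / real n)) (bernstein_basis n k))"

lemma poly_bernstein_basis: "poly (bernstein_basis n k) t = Bernstein n k t"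
  by (simp add: bernstein_basis_def Bernstein_def)

lemma poly_bernstein_poly:
  "poly (bernstein_poly n g) t = (\<Sum>k\<le>n. g (real k / real n) * Bernstein n k t)"
  by (simp add: bernstein_poly_def poly_sum poly_bernstein_basis)

lemma sum_bernstein_basis: "(\<Sum>k\<le>n. bernstein_basis n k) = 1"
proof -
  have "poly (\<Sum>k\<le>n. bernstein_basis n k) t = poly 1 t" for t
    by (simp add: poly_sum poly_bernstein_basis)
  then show ?thesis
    by (simp add: fun_eq_iff flip: poly_eq_poly_eq_iff)
qed

text \<open>Degree elevation: the coordinates of a monomial in the Bernstein basis of degree \<open>n\<close> come
  from multiplying it by \<open>(t + (1 - t)) ^ (n - m)\<close>.\<close>

lemma power_eq_sum_Bernstein:
  assumes "m \<le> n"
  shows "t ^ m = (\<Sum>k\<le>n. real (k choose m) / real (n choose m) * Bernstein n k t)"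
proof -
  have "(\<Sum>k\<le>n. real (k choose m) / real (n choose m) * Bernstein n k t)
      = (\<Sum>k\<in>{0 + m..(n - m) + m}. real (k choose m) / real (n choose m) * Bernstein n k t)"
    using assms by (intro sum.mono_neutral_right) auto
  also have "\<dots> = (\<Sum>j\<in>{0..n - m}. real ((j + m) choose m) / real (n choose m) * Bernstein n (j + m) t)"
    by (rule sum.shift_bounds_cl_nat_ivl)
  also have "\<dots> = (\<Sum>j\<le>n - m. t ^ m * (real ((n - m) choose j) * t ^ j * (1 - t) ^ (n - m - j)))"
  proof (rule sum.cong)
    fix j assume "j \<in> {..n - m}"
    then have "j + m \<le> n" using assms by auto
    then have "(n choose (j + m)) * ((j + m) choose m) = (n choose m) * ((n - m) choose j)"
      using choose_mult[of m "j + m" n] by simp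
    then have "real (n choose (j + m)) * real ((j + m) choose m) = real (n choose m) * real ((n - m) choose j)"
      by (metis of_nat_mult)
    moreover have "real (n choose m) \<noteq> 0" using assms by simp
    ultimately have "real ((j + m) choose m) / real (n choose m) * real (n choose (j + m)) = real ((n - m) choose j)"
      by (simp add: field_simps)
    moreover have "n - (j + m) = n - m - j" by simp
    ultimately show "real ((j + m) choose m) / real (n choose m) * Bernstein n (j + m) t =
        t ^ m * (real ((n - m) choose j) * t ^ j * (1 - t) ^ (n - m - j))"
      unfolding Bernstein_def by (simp add: power_add mult.assoc[symmetric])
  qed auto
  also have "\<dots> = t ^ m * (t + (1 - t)) ^ (n - m)"
    by (subst binomial_ring) (simp add: sum_distrib_left)
  finally show ?thesis by simp
qed

lemma binomial_ratio_eq_prod: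
  assumes "m \<le> n"
  shows "real (k choose m) / real (n choose m) = (\<Prod>i<m. real (k - i) / real (n - i))"
  using assms
proof (induction m)
  case (Suc m)
  have step: "real (Suc m) * real (l choose Suc m) = real (l - m) * real (l choose m)" for l
  proof -
    have "Suc m * (l choose Suc m) = (l - m) * (l choose m)"
      by (simp only: binomial_absorb_comp binomial_absorption)
    then show ?thesis by (simp only: of_nat_mult[symmetric])
  qed
  have "real (k choose Suc m) / real (n choose Suc m) =
      (real (Suc m) * real (k choose Suc m)) / (real (Suc m) * real (n choose Suc m))"
    by (rule mult_divide_mult_cancel_left[symmetric]) simp
  also have "\<dots> = (real (k choose m) / real (n choose m)) * (real (k - m) / real (n - m))"
    unfolding step by (simp add: mult.commute)
  finally show ?case using Suc by simp
qed simp

text \<open>Both sides are products of \<open>m\<close> numbers in \<open>[0, 1]\<close>, and the factors \<open>(k - i) / (n - i)\<close> and \<open>k / n\<close>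
  differ by at most \<open>i / n\<close>. For \<open>k < m\<close> the truncated difference makes the first product vanish, as
  it should.\<close>

lemma binomial_ratio_approx_power:
  assumes "m \<le> n" "k \<le> n" "0 < n"
  shows "\<bar>real (k choose m) / real (n choose m) - (real k / real n) ^ m\<bar> \<le> real (m * m) / real n"
proof -
  have factor: "norm (real (k - i) / real (n - i) - real k / real n) \<le> real m / real n" if "i < m" for i
  proof (cases "i \<le> k")
    case True
    have ni: "0 < real n - real i" using that assms by simp
    have "real k / real n - real (k - i) / real (n - i) = real i * (real n - real k) / (real n * (real n - real i))"
      using True that assms ni by (simp add: of_nat_diff field_simps)
    also have "\<dots> = (real i / real n) * ((real n - real k) / (real n - real i))" by simp
    finally have eq: "real k / real n - real (k - i) / real (n - i) = \<dots>" .
    have "(real n - real k) / (real n - real i) \<le> 1" "0 \<le> (real n - real k) / (real n - real i)"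
      using True ni assms by (auto simp: field_simps)
    then have "0 \<le> (real i / real n) * ((real n - real k) / (real n - real i))"
      "(real i / real n) * ((real n - real k) / (real n - real i)) \<le> real i / real n"
      using mult_left_le[of "(real n - real k) / (real n - real i)" "real i / real n"]
      by (simp_all only: mult_nonneg_nonneg divide_nonneg_nonneg of_nat_0_le_iff)
    moreover have "real i / real n \<le> real m / real n" using that by (simp add: divide_right_mono)
    moreover have "norm (b - a) \<le> w" if "0 \<le> u" "u \<le> v" "v \<le> w" "a - b = u" for a b u v w :: real
      using that by simp
    ultimately show ?thesis using eq by blast
  next
    case False
    then show ?thesis using that by (simp add: divide_right_mono)
  qed
  have "norm ((\<Prod>i<m. real (k - i) / real (n - i)) - (\<Prod>i<m. real k / real n))
      \<le> (\<Sum>i<m. norm (real (k - i) / real (n - i) - real k / real n))"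
    using assms by (intro norm_prod_diff) (auto simp: divide_le_eq_1)
  also have "\<dots> \<le> (\<Sum>i<m. real m / real n)"
    by (intro sum_mono factor) simp
  finally show ?thesis
    using assms by (simp add: binomial_ratio_eq_prod)
qed

context pos_contraction
begin

lemma bernstein_basis_nonneg: "0 \<le> inner (poly_op R (bernstein_basis n k) x) x"
  by (simp add: bernstein_basis_def poly_op_smult[OF linear] poly_op_monomial_nonneg)

lemma sum_bernstein_basis_form: "(\<Sum>k\<le>n. inner (poly_op R (bernstein_basis n k) x) x) = inner x x"
proof -
  have "(\<Sum>k\<le>n. inner (poly_op R (bernstein_basis n k) x) x) = inner (poly_op R 1 x) x"
    by (simp add: poly_op_sum[OF linear] inner_sum_left flip: sum_bernstein_basis[of n])
  then show ?thesis
    using poly_op_const[OF linear, of 1 x] by (simp add: one_pCons)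
qed

text \<open>In the Bernstein basis of degree \<open>n\<close> the coordinates of \<open>p\<close> differ from the values
  \<open>p (k / n)\<close> by \<open>O(1 / n)\<close>, and the basis consists of positive operators with sum \<open>1\<close>. Hence
  \<open>p(R)\<close> is bounded below by a number of order \<open>- 1 / n\<close>, for every \<open>n\<close>.\<close>

lemma poly_op_nonneg:
  assumes p: "\<And>t. 0 \<le> t \<Longrightarrow> t \<le> 1 \<Longrightarrow> 0 \<le> poly p t"
  shows "0 \<le> inner (poly_op R p x) x"
proof -
  define D where "D = (\<Sum>m\<le>degree p. \<bar>coeff p m\<bar> * real (m * m))"
  have bound: "- (D * inner x x) / real n \<le> inner (poly_op R p x) x" if n: "n \<ge> Suc (degree p)" for n
  proof -
    define c where "c k = (\<Sum>m\<le>degree p. coeff p m * (real (k choose m) / real (n choose m)))" for k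
    have "poly p t = (\<Sum>k\<le>n. c k * Bernstein n k t)" for t
    proof -
      have "poly p t = (\<Sum>m\<le>degree p. coeff p m * (\<Sum>k\<le>n. real (k choose m) / real (n choose m) * Bernstein n k t))"
        unfolding poly_altdef using n by (intro sum.cong refl) (subst power_eq_sum_Bernstein[of _ n], auto)
      also have "\<dots> = (\<Sum>k\<le>n. c k * Bernstein n k t)"
        unfolding c_def sum_distrib_left sum_distrib_right
        by (subst sum.swap) (simp add: mult.assoc)
      finally show ?thesis .
    qed
    then have "p = (\<Sum>k\<le>n. smult (c k) (bernstein_basis n k))"
      by (simp add: fun_eq_iff poly_sum poly_bernstein_basis flip: poly_eq_poly_eq_iff)
    then have form: "inner (poly_op R p x) x = (\<Sum>k\<le>n. c k * inner (poly_op R (bernstein_basis n k) x) x)"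
      using poly_op_sum[OF linear, of "\<lambda>k. smult (c k) (bernstein_basis n k)" "{..n}" x]
      by (simp add: poly_op_smult[OF linear] inner_sum_left)
    have coord: "- D / real n \<le> c k" if k: "k \<le> n" for k
    proof -
      have "\<bar>c k - poly p (real k / real n)\<bar>
          = \<bar>\<Sum>m\<le>degree p. coeff p m * (real (k choose m) / real (n choose m) - (real k / real n) ^ m)\<bar>"
        unfolding c_def poly_altdef by (simp add: sum_subtractf right_diff_distrib)
      also have "\<dots> \<le> (\<Sum>m\<le>degree p. \<bar>coeff p m\<bar> * (real (m * m) / real n))"
        using n k
        by (intro order_trans[OF sum_abs] sum_mono)
           (simp only: abs_mult, intro mult_left_mono binomial_ratio_approx_power, auto)
      also have "\<dots> = D / real n"
        unfolding D_def sum_divide_distrib by simp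
      finally have "\<bar>c k - poly p (real k / real n)\<bar> \<le> D / real n" .
      moreover have "0 \<le> poly p (real k / real n)" using k n by (intro p) auto
      ultimately show ?thesis by simp
    qed
    have "(\<Sum>k\<le>n. - D / real n * inner (poly_op R (bernstein_basis n k) x) x) \<le> inner (poly_op R p x) x"
      unfolding form using coord by (intro sum_mono mult_right_mono bernstein_basis_nonneg) simp
    moreover have "(\<Sum>k\<le>n. - D / real n * inner (poly_op R (bernstein_basis n k) x) x) = - (D * inner x x) / real n"
      by (simp only: sum_distrib_left[symmetric] sum_bernstein_basis_form) simp
    ultimately show ?thesis by simp
  qed
  have "(\<lambda>n. - (D * inner x x) / real n) \<longlonglongrightarrow> 0"
    by (rule lim_const_over_n)
  then show ?thesis
    by (rule LIMSEQ_le_const2) (use bound in blast)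
qed

text \<open>Positivity of \<open>c\<^sup>2 - p\<^sup>2\<close> is a norm bound, because \<open>p(R)\<close> is symmetric.\<close>

lemma norm_poly_op_le:
  assumes p: "\<And>t. 0 \<le> t \<Longrightarrow> t \<le> 1 \<Longrightarrow> \<bar>poly p t\<bar> \<le> c"
  shows "norm (poly_op R p x) \<le> c * norm x"
proof -
  have c: "0 \<le> c" using p[of 0] by simp
  have "0 \<le> inner (poly_op R ([:c\<^sup>2:] - p * p) x) x"
  proof (rule poly_op_nonneg)
    fix t :: real assume "0 \<le> t" "t \<le> 1"
    from power_mono[OF p[OF this], of 2] show "0 \<le> poly ([:c\<^sup>2:] - p * p) t"
      by (simp add: power2_eq_square)
  qed
  then have "(norm (poly_op R p x))\<^sup>2 \<le> (c * norm x)\<^sup>2"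
    by (simp add: op_simps(1,3-6) poly_op_symmetric inner_diff_left power_mult_distrib power2_norm_eq_inner)
  then show ?thesis
    using c by (auto intro: power2_le_imp_le)
qed

end

section \<open>Continuous functions of a positive contraction\<close>

text \<open>Approximating by Bernstein polynomials makes the definition explicit: the approximants are
  additive in \<open>g\<close> and in \<open>x\<close>, and use only values of \<open>g\<close> on the unit interval.\<close>

definition cont_calculus :: "('a::real_inner \<Rightarrow> 'a) \<Rightarrow> (real \<Rightarrow> real) \<Rightarrow> 'a \<Rightarrow> 'a" where
  "cont_calculus R g x = lim (\<lambda>n. poly_op R (bernstein_poly n g) x)"

lemma bernstein_poly_uniform:
  assumes "continuous_on {0..1} g" "0 < e"
  obtains N where "\<And>n t. N \<le> n \<Longrightarrow> 0 \<le> t \<Longrightarrow> t \<le> 1 \<Longrightarrow> \<bar>g t - poly (bernstein_poly n g) t\<bar> < e"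
  using Bernstein_Weierstrass[OF assms] unfolding poly_bernstein_poly
  by (metis atLeastAtMost_iff)

lemma bernstein_poly_nonneg:
  assumes "\<And>t. 0 \<le> t \<Longrightarrow> t \<le> 1 \<Longrightarrow> 0 \<le> g t" "0 \<le> t" "t \<le> 1"
  shows "0 \<le> poly (bernstein_poly n g) t"
proof -
  have "0 \<le> g (real k / real n)" if "k \<le> n" for k
    using that by (intro assms(1)) (auto simp: divide_le_eq_1)
  then show ?thesis
    unfolding poly_bernstein_poly using assms(2,3)
    by (auto intro!: sum_nonneg mult_nonneg_nonneg Bernstein_nonneg)
qed

lemma smult_sum_right: "smult c (\<Sum>i\<in>I. p i) = (\<Sum>i\<in>I. smult c (p i))"
  by (induction I rule: infinite_finite_induct) (simp_all add: smult_add_right)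

lemma bounded_on_unit_interval:
  fixes g :: "real \<Rightarrow> real"
  assumes "continuous_on {0..1} g"
  obtains c where "0 < c" "\<And>t. t \<in> {0..1} \<Longrightarrow> \<bar>g t\<bar> \<le> c"
proof -
  have "bounded (g ` {0..1})"
    using assms by (intro compact_imp_bounded compact_continuous_image) auto
  then show ?thesis
    unfolding bounded_pos using that by (metis imageI real_norm_def)
qed

lemma small_multiple:
  fixes e K :: real
  assumes "0 \<le> K" "0 < e"
  obtains d where "0 < d" "d * K < e"
  using assms that[of "e / (K + 1)"] by (auto simp: pos_divide_less_eq algebra_simps)

lemma LIMSEQ_if_norm_le_mult:
  fixes y :: "nat \<Rightarrow> 'a::real_normed_vector"
  assumes "\<And>d. 0 < d \<Longrightarrow> \<exists>N. \<forall>n\<ge>N. norm (y n - l) \<le> d * K" and "0 \<le> K"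
  shows "y \<longlonglongrightarrow> l"
proof (rule LIMSEQ_I)
  fix r :: real assume "0 < r"
  then obtain d where "0 < d" "d * K < r"
    using small_multiple[OF assms(2)] by blast
  with assms(1) show "\<exists>N. \<forall>n\<ge>N. norm (y n - l) < r"
    by (meson le_less_trans)
qed

lemma cont_calculus_cong:
  assumes "\<And>t. 0 \<le> t \<Longrightarrow> t \<le> 1 \<Longrightarrow> g t = h t"
  shows "cont_calculus R g = cont_calculus R h"
proof -
  have "bernstein_poly n g = bernstein_poly n h" for n
    unfolding bernstein_poly_def
    by (intro sum.cong refl arg_cong2[of _ _ _ _ smult] assms) (auto simp: divide_le_eq_1)
  then show ?thesis
    by (simp add: cont_calculus_def fun_eq_iff)
qed

context pos_contraction
begin

lemma tendsto_cont_calculus: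
  assumes g: "continuous_on {0..1} g"
  shows "(\<lambda>n. poly_op R (bernstein_poly n g) x) \<longlonglongrightarrow> cont_calculus R g x"
proof -
  have "Cauchy (\<lambda>n. poly_op R (bernstein_poly n g) x)"
  proof (rule metric_CauchyI)
    fix e :: real assume "0 < e"
    then obtain d where d: "0 < d" and "d * (2 * norm x) < e"
      using small_multiple[of "2 * norm x" e] by auto
    then have de: "(d + d) * norm x < e" by (simp add: algebra_simps)
    obtain N where N: "\<And>n t. N \<le> n \<Longrightarrow> 0 \<le> t \<Longrightarrow> t \<le> 1 \<Longrightarrow> \<bar>g t - poly (bernstein_poly n g) t\<bar> < d"
      using bernstein_poly_uniform[OF g d] by blast
    show "\<exists>M. \<forall>m\<ge>M. \<forall>n\<ge>M. dist (poly_op R (bernstein_poly m g) x) (poly_op R (bernstein_poly n g) x) < e"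
    proof (intro exI allI impI)
      fix m n assume mn: "N \<le> m" "N \<le> n"
      have "norm (poly_op R (bernstein_poly m g - bernstein_poly n g) x) \<le> (d + d) * norm x"
      proof (rule norm_poly_op_le)
        fix t :: real assume t: "0 \<le> t" "t \<le> 1"
        show "\<bar>poly (bernstein_poly m g - bernstein_poly n g) t\<bar> \<le> d + d"
          unfolding poly_diff using N[OF mn(1) t] N[OF mn(2) t] by linarith
      qed
      with de show "dist (poly_op R (bernstein_poly m g) x) (poly_op R (bernstein_poly n g) x) < e"
        by (simp add: dist_norm op_simps)
    qed
  qed
  then show ?thesis
    unfolding cont_calculus_def by (simp add: Cauchy_convergent_iff convergent_LIMSEQ_iff)
qed

text \<open>The estimate by which properties pass from polynomials to continuous functions.\<close>

lemma norm_cont_calculus_diff_poly_le: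
  assumes g: "continuous_on {0..1} g"
    and p: "\<And>t. 0 \<le> t \<Longrightarrow> t \<le> 1 \<Longrightarrow> \<bar>g t - poly p t\<bar> \<le> e"
  shows "norm (cont_calculus R g x - poly_op R p x) \<le> e * norm x"
proof (rule field_le_epsilon)
  fix d :: real assume "0 < d"
  then obtain d' where d': "0 < d'" and d'd: "d' * norm x < d"
    using small_multiple[of "norm x" d] by auto
  obtain N where N: "\<And>n t. N \<le> n \<Longrightarrow> 0 \<le> t \<Longrightarrow> t \<le> 1 \<Longrightarrow> \<bar>g t - poly (bernstein_poly n g) t\<bar> < d'"
    using bernstein_poly_uniform[OF g d'] by blast
  have "norm (poly_op R (bernstein_poly n g) x - poly_op R p x) \<le> e * norm x + d" if n: "N \<le> n" for n
  proof -
    have "norm (poly_op R (bernstein_poly n g - p) x) \<le> (e + d') * norm x"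
    proof (rule norm_poly_op_le)
      fix t :: real assume t: "0 \<le> t" "t \<le> 1"
      show "\<bar>poly (bernstein_poly n g - p) t\<bar> \<le> e + d'"
        unfolding poly_diff using N[OF n t] p[OF t] by linarith
    qed
    then show ?thesis
      using d'd by (simp add: op_simps distrib_right)
  qed
  moreover have "(\<lambda>n. norm (poly_op R (bernstein_poly n g) x - poly_op R p x))
      \<longlonglongrightarrow> norm (cont_calculus R g x - poly_op R p x)"
    by (intro tendsto_intros tendsto_cont_calculus g)
  ultimately show "norm (cont_calculus R g x - poly_op R p x) \<le> e * norm x + d"
    by (meson LIMSEQ_le_const2)
qed

lemma norm_cont_calculus_le:
  assumes "continuous_on {0..1} g" "\<And>t. 0 \<le> t \<Longrightarrow> t \<le> 1 \<Longrightarrow> \<bar>g t\<bar> \<le> c"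
  shows "norm (cont_calculus R g x) \<le> c * norm x"
  using norm_cont_calculus_diff_poly_le[OF assms(1), of 0 c x] assms(2) by simp

lemma cont_calculus_poly: "cont_calculus R (poly p) x = poly_op R p x"
  using norm_cont_calculus_diff_poly_le[of "poly p" p 0 x] by (simp add: continuous_intros)

lemma cont_calculus_const: "cont_calculus R (\<lambda>t. c) x = c *\<^sub>R x"
  using cont_calculus_poly[of "[:c:]" x] cont_calculus_cong[of "\<lambda>t. c" "poly [:c:]" R]
  by (simp add: op_simps linear_0[OF linear])

lemma cont_calculus_id: "cont_calculus R (\<lambda>t. t) x = R x"
proof -
  have "cont_calculus R (\<lambda>t. t) = cont_calculus R (poly [:0, 1:])"
    by (rule cont_calculus_cong) simp
  then show ?thesis
    using cont_calculus_poly[of "[:0, 1:]" x] poly_op_X[OF linear] by simp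
qed

lemma cont_calculus_add:
  assumes "continuous_on {0..1} g" "continuous_on {0..1} h"
  shows "cont_calculus R (\<lambda>t. g t + h t) x = cont_calculus R g x + cont_calculus R h x"
proof -
  have "bernstein_poly n (\<lambda>t. g t + h t) = bernstein_poly n g + bernstein_poly n h" for n
    by (simp add: bernstein_poly_def smult_add_left sum.distrib)
  then have "(\<lambda>n. poly_op R (bernstein_poly n (\<lambda>t. g t + h t)) x)
      \<longlonglongrightarrow> cont_calculus R g x + cont_calculus R h x"
    using tendsto_add[OF tendsto_cont_calculus tendsto_cont_calculus, OF assms]
    by (simp add: poly_op_add[OF linear])
  moreover have "continuous_on {0..1} (\<lambda>t. g t + h t)"
    by (intro continuous_intros assms)
  ultimately show ?thesis
    using tendsto_cont_calculus LIMSEQ_unique by blast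
qed

lemma cont_calculus_scale:
  assumes "continuous_on {0..1} g"
  shows "cont_calculus R (\<lambda>t. c * g t) x = c *\<^sub>R cont_calculus R g x"
proof -
  have "bernstein_poly n (\<lambda>t. c * g t) = smult c (bernstein_poly n g)" for n
    by (simp add: bernstein_poly_def smult_sum_right mult.assoc)
  then have "(\<lambda>n. poly_op R (bernstein_poly n (\<lambda>t. c * g t)) x) \<longlonglongrightarrow> c *\<^sub>R cont_calculus R g x"
    using tendsto_scaleR[OF tendsto_const tendsto_cont_calculus, OF assms]
    by (simp add: poly_op_smult[OF linear])
  moreover have "continuous_on {0..1} (\<lambda>t. c * g t)"
    by (intro continuous_intros assms)
  ultimately show ?thesis
    using tendsto_cont_calculus LIMSEQ_unique by blast
qed

lemma cont_calculus_diff: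
  assumes "continuous_on {0..1} g" "continuous_on {0..1} h"
  shows "cont_calculus R (\<lambda>t. g t - h t) x = cont_calculus R g x - cont_calculus R h x"
proof -
  have "continuous_on {0..1} (\<lambda>t. (-1) * h t)"
    by (intro continuous_intros assms)
  from cont_calculus_add[OF assms(1) this] show ?thesis
    unfolding cont_calculus_scale[OF assms(2)] by simp
qed

lemma bounded_linear_cont_calculus:
  assumes g: "continuous_on {0..1} g"
  shows "bounded_linear (cont_calculus R g)"
proof -
  obtain c where c: "\<And>t. t \<in> {0..1} \<Longrightarrow> \<bar>g t\<bar> \<le> c"
    using bounded_on_unit_interval[OF g] by blast
  show ?thesis
  proof (rule bounded_linear_intro[where K = c])
    fix x y :: 'a and a :: real
    have "(\<lambda>n. poly_op R (bernstein_poly n g) (x + y)) \<longlonglongrightarrow> cont_calculus R g x + cont_calculus R g y"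
      using tendsto_add[OF tendsto_cont_calculus tendsto_cont_calculus, OF g g]
      by (simp add: linear_add[OF poly_op_linear[OF linear]])
    then show "cont_calculus R g (x + y) = cont_calculus R g x + cont_calculus R g y"
      using tendsto_cont_calculus[OF g] LIMSEQ_unique by blast
    have "(\<lambda>n. poly_op R (bernstein_poly n g) (a *\<^sub>R x)) \<longlonglongrightarrow> a *\<^sub>R cont_calculus R g x"
      using tendsto_scaleR[OF tendsto_const tendsto_cont_calculus, OF g]
      by (simp add: linear_scale[OF poly_op_linear[OF linear]])
    then show "cont_calculus R g (a *\<^sub>R x) = a *\<^sub>R cont_calculus R g x"
      using tendsto_cont_calculus[OF g] LIMSEQ_unique by blast
    show "norm (cont_calculus R g x) \<le> norm x * c"
      using norm_cont_calculus_le[OF g, of c x] c by (simp add: mult.commute)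
  qed
qed

lemmas linear_cont_calculus = bounded_linear.linear[OF bounded_linear_cont_calculus]

lemma cont_calculus_symmetric:
  assumes "continuous_on {0..1} g"
  shows "inner (cont_calculus R g x) y = inner x (cont_calculus R g y)"
proof -
  have "(\<lambda>n. inner (poly_op R (bernstein_poly n g) x) y) \<longlonglongrightarrow> inner (cont_calculus R g x) y"
    by (intro tendsto_intros tendsto_cont_calculus assms)
  moreover have "(\<lambda>n. inner x (poly_op R (bernstein_poly n g) y)) \<longlonglongrightarrow> inner x (cont_calculus R g y)"
    by (intro tendsto_intros tendsto_cont_calculus assms)
  ultimately show ?thesis
    using LIMSEQ_unique by (simp add: poly_op_symmetric)
qed

lemma cont_calculus_nonneg:
  assumes "continuous_on {0..1} g" "\<And>t. 0 \<le> t \<Longrightarrow> t \<le> 1 \<Longrightarrow> 0 \<le> g t"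
  shows "0 \<le> inner (cont_calculus R g x) x"
proof -
  have "(\<lambda>n. inner (poly_op R (bernstein_poly n g) x) x) \<longlonglongrightarrow> inner (cont_calculus R g x) x"
    by (intro tendsto_intros tendsto_cont_calculus assms)
  then show ?thesis
    by (rule LIMSEQ_le_const) (use poly_op_nonneg bernstein_poly_nonneg assms(2) in blast)
qed

lemma cont_calculus_commute:
  assumes "continuous_on {0..1} g" "bounded_linear C" "\<And>x. C (R x) = R (C x)"
  shows "C (cont_calculus R g x) = cont_calculus R g (C x)"
proof -
  have "(\<lambda>n. C (poly_op R (bernstein_poly n g) x)) \<longlonglongrightarrow> C (cont_calculus R g x)"
    by (intro bounded_linear.tendsto[OF assms(2)] tendsto_cont_calculus assms)
  then have "(\<lambda>n. poly_op R (bernstein_poly n g) (C x)) \<longlonglongrightarrow> C (cont_calculus R g x)"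
    using poly_op_commute[OF linear bounded_linear.linear[OF assms(2)] assms(3)] by simp
  then show ?thesis
    using tendsto_cont_calculus[OF assms(1)] LIMSEQ_unique by blast
qed

lemma cont_calculus_mult_poly:
  assumes h: "continuous_on {0..1} h"
  shows "cont_calculus R (\<lambda>t. poly p t * h t) x = poly_op R p (cont_calculus R h x)"
proof -
  have ph: "continuous_on {0..1} (\<lambda>t. poly p t * h t)"
    by (intro continuous_intros h)
  obtain c where c: "0 < c" "\<And>t. t \<in> {0..1} \<Longrightarrow> \<bar>poly p t\<bar> \<le> c"
    by (rule bounded_on_unit_interval[of "poly p"]) (auto intro: continuous_intros)
  have "(\<lambda>n. poly_op R (p * bernstein_poly n h) x) \<longlonglongrightarrow> cont_calculus R (\<lambda>t. poly p t * h t) x"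
  proof (rule LIMSEQ_if_norm_le_mult[where K = "c * norm x"])
    fix d :: real assume "0 < d"
    from bernstein_poly_uniform[OF h this] obtain N where N: "\<And>n t. N \<le> n \<Longrightarrow> 0 \<le> t \<Longrightarrow> t \<le> 1 \<Longrightarrow>
      \<bar>h t - poly (bernstein_poly n h) t\<bar> < d" by blast
    have "norm (poly_op R (p * bernstein_poly n h) x - cont_calculus R (\<lambda>t. poly p t * h t) x) \<le> d * (c * norm x)"
      if n: "N \<le> n" for n
    proof -
      have "norm (cont_calculus R (\<lambda>t. poly p t * h t) x - poly_op R (p * bernstein_poly n h) x)
          \<le> (c * d) * norm x"
      proof (rule norm_cont_calculus_diff_poly_le[OF ph])
        fix t :: real assume t: "0 \<le> t" "t \<le> 1"
        have "\<bar>poly p t * h t - poly (p * bernstein_poly n h) t\<bar> = \<bar>poly p t\<bar> * \<bar>h t - poly (bernstein_poly n h) t\<bar>"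
          by (simp add: right_diff_distrib flip: abs_mult)
        also have "\<dots> \<le> c * d"
          using c t N[OF n t] by (intro mult_mono) auto
        finally show "\<bar>poly p t * h t - poly (p * bernstein_poly n h) t\<bar> \<le> c * d" .
      qed
      then show ?thesis by (simp add: norm_minus_commute mult_ac)
    qed
    then show "\<exists>N. \<forall>n\<ge>N. norm (poly_op R (p * bernstein_poly n h) x
        - cont_calculus R (\<lambda>t. poly p t * h t) x) \<le> d * (c * norm x)" by blast
  qed (use c in simp)
  moreover have "(\<lambda>n. poly_op R (p * bernstein_poly n h) x) \<longlonglongrightarrow> poly_op R p (cont_calculus R h x)"
    unfolding poly_op_mult[OF linear]
    by (intro bounded_linear.tendsto[OF bounded_linear_poly_op[OF bounded_linear]] tendsto_cont_calculus h)
  ultimately show ?thesis using LIMSEQ_unique by blast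
qed

text \<open>Multiplicativity is extended in one factor at a time, the other one being a polynomial first.\<close>

lemma cont_calculus_mult:
  assumes g: "continuous_on {0..1} g" and h: "continuous_on {0..1} h"
  shows "cont_calculus R (\<lambda>t. g t * h t) x = cont_calculus R g (cont_calculus R h x)"
proof -
  obtain c where c: "0 < c" "\<And>t. t \<in> {0..1} \<Longrightarrow> \<bar>h t\<bar> \<le> c"
    using bounded_on_unit_interval[OF h] by blast
  have "(\<lambda>n. cont_calculus R (\<lambda>t. poly (bernstein_poly n g) t * h t) x) \<longlonglongrightarrow> cont_calculus R (\<lambda>t. g t * h t) x"
  proof (rule LIMSEQ_if_norm_le_mult[where K = "c * norm x"])
    fix d :: real assume "0 < d"
    from bernstein_poly_uniform[OF g this] obtain N where N: "\<And>n t. N \<le> n \<Longrightarrow> 0 \<le> t \<Longrightarrow> t \<le> 1 \<Longrightarrow>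
      \<bar>g t - poly (bernstein_poly n g) t\<bar> < d" by blast
    have "norm (cont_calculus R (\<lambda>t. poly (bernstein_poly n g) t * h t) x
        - cont_calculus R (\<lambda>t. g t * h t) x) \<le> d * (c * norm x)" if n: "N \<le> n" for n
    proof -
      let ?d = "\<lambda>t. poly (bernstein_poly n g) t * h t - g t * h t"
      have "norm (cont_calculus R ?d x) \<le> (d * c) * norm x"
      proof (rule norm_cont_calculus_le)
        show "continuous_on {0..1} ?d" by (intro continuous_intros g h)
        fix t :: real assume t: "0 \<le> t" "t \<le> 1"
        have "\<bar>?d t\<bar> = \<bar>g t - poly (bernstein_poly n g) t\<bar> * \<bar>h t\<bar>"
          by (simp add: abs_mult abs_minus_commute flip: left_diff_distrib)
        also have "\<dots> \<le> d * c"
          using c t N[OF n t] \<open>0 < d\<close> by (intro mult_mono) auto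
        finally show "\<bar>?d t\<bar> \<le> d * c" .
      qed
      moreover have "cont_calculus R ?d x = cont_calculus R (\<lambda>t. poly (bernstein_poly n g) t * h t) x
          - cont_calculus R (\<lambda>t. g t * h t) x"
        by (intro cont_calculus_diff continuous_intros g h)
      ultimately show ?thesis by (simp add: mult.assoc)
    qed
    then show "\<exists>N. \<forall>n\<ge>N. norm (cont_calculus R (\<lambda>t. poly (bernstein_poly n g) t * h t) x
        - cont_calculus R (\<lambda>t. g t * h t) x) \<le> d * (c * norm x)" by blast
  qed (use c in simp)
  then have "(\<lambda>n. poly_op R (bernstein_poly n g) (cont_calculus R h x)) \<longlonglongrightarrow> cont_calculus R (\<lambda>t. g t * h t) x"
    by (simp add: cont_calculus_mult_poly[OF h])
  with tendsto_cont_calculus[OF g] show ?thesis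
    using LIMSEQ_unique by blast
qed

lemma norm_cont_calculus_square:
  assumes "continuous_on {0..1} g"
  shows "(norm (cont_calculus R g x))\<^sup>2 = inner (cont_calculus R (\<lambda>t. (g t)\<^sup>2) x) x"
  by (simp only: power2_norm_eq_inner power2_eq_square[of "g _"] cont_calculus_mult[OF assms assms]
      cont_calculus_symmetric[OF assms])

end

section \<open>The distribution of a positive contraction in a vector\<close>

text \<open>The measure on the line with \<open>\<integral> g = \<langle>g(R) x, x\<rangle>\<close>. Test functions on the whole line avoid a
  measure on a subtype; that the measure lives on the unit interval is a consequence.\<close>

definition is_spectral_dist :: "('a::real_inner \<Rightarrow> 'a) \<Rightarrow> 'a \<Rightarrow> real measure \<Rightarrow> bool" where
  "is_spectral_dist R x \<mu> \<longleftrightarrow> finite_measure \<mu> \<and> sets \<mu> = sets borel \<and>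
     (\<forall>g. continuous_on UNIV g \<longrightarrow> bounded (range g) \<longrightarrow>
        integral\<^sup>L \<mu> g = inner (cont_calculus R g x) x)"

definition spectral_dist :: "('a::real_inner \<Rightarrow> 'a) \<Rightarrow> 'a \<Rightarrow> real measure" where
  "spectral_dist R x = (SOME \<mu>. is_spectral_dist R x \<mu>)"

context pos_contraction
begin

text \<open>The numbers \<open>\<langle>b(R) x, x\<rangle>\<close>, for \<open>b\<close> in the Bernstein basis of degree \<open>n\<close>, are probability weights. Put
  at the nodes \<open>k / n\<close>, they integrate \<open>g\<close> to the value of the Bernstein polynomial of \<open>g\<close>, so any weak
  limit point of these measures has the required integrals, and Helly's theorem provides one.\<close>

lemma exists_spectral_dist_unit:
  assumes x: "norm x = 1"
  shows "\<exists>M. is_spectral_dist R x M"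
proof -
  define w where "w n k = inner (poly_op R (bernstein_basis n k) x) x" for n k
  have w_nonneg: "0 \<le> w n k" for n k
    unfolding w_def by (rule bernstein_basis_nonneg)
  have w_sum: "(\<Sum>k\<le>n. w n k) = 1" for n
    unfolding w_def sum_bernstein_basis_form using x by (simp add: dot_square_norm)
  define \<nu> where "\<nu> n = point_measure {..n} (\<lambda>k. ennreal (w n k))" for n
  have prob_\<nu>: "prob_space (\<nu> n)" for n
    unfolding \<nu>_def
    by (rule prob_space_point_measure) (use w_nonneg w_sum in \<open>auto simp: sum_ennreal\<close>)
  define \<mu> where "\<mu> n = distr (\<nu> n) borel (\<lambda>k. real k / real n)" for n
  have meas: "(\<lambda>k. real k / real n) \<in> measurable (\<nu> n) borel" for n
    by (simp add: \<nu>_def)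
  have distr_\<mu>: "real_distribution (\<mu> n)" for n
    unfolding \<mu>_def by (intro real_distribution.intro prob_space.prob_space_distr prob_\<nu> meas
        real_distribution_axioms.intro) simp
  have int_\<mu>: "integral\<^sup>L (\<mu> n) g = inner (poly_op R (bernstein_poly n g) x) x"
    if "continuous_on UNIV g" for g :: "real \<Rightarrow> real" and n
  proof -
    have "integral\<^sup>L (\<mu> n) g = integral\<^sup>L (\<nu> n) (\<lambda>k. g (real k / real n))"
      unfolding \<mu>_def using that by (intro integral_distr meas borel_measurable_continuous_onI)
    also have "\<dots> = (\<Sum>k\<le>n. w n k * g (real k / real n))"
      unfolding \<nu>_def by (subst lebesgue_integral_point_measure_finite) (use w_nonneg in auto)
    also have "\<dots> = inner (poly_op R (bernstein_poly n g) x) x"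
      by (simp add: w_def bernstein_poly_def poly_op_sum[OF linear] poly_op_smult[OF linear]
          inner_sum_left mult.commute)
    finally show ?thesis .
  qed
  have "tight \<mu>"
    unfolding tight_def
  proof (intro conjI allI impI distr_\<mu>)
    fix e :: real assume e: "0 < e"
    have "measure (\<mu> n) {-1<..1} > 1 - e" for n
    proof -
      have "measure (\<mu> n) {-1<..1} = measure (\<nu> n) ((\<lambda>k. real k / real n) -` {-1<..1} \<inter> space (\<nu> n))"
        unfolding \<mu>_def by (intro measure_distr meas) simp
      also have "(\<lambda>k. real k / real n) -` {-1<..1} \<inter> space (\<nu> n) = space (\<nu> n)"
      proof -
        have "-1 < real k / real n" for k
          by (rule less_le_trans[of _ 0]) auto
        then show ?thesis
          by (auto simp: \<nu>_def space_point_measure divide_le_eq_1)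
      qed
      also have "measure (\<nu> n) (space (\<nu> n)) = 1"
        by (rule prob_space.prob_space[OF prob_\<nu>])
      finally show ?thesis using e by simp
    qed
    then show "\<exists>a b. a < b \<and> (\<forall>n. 1 - e < measure (\<mu> n) {a<..b})"
      by (intro exI[of _ "-1"] exI[of _ 1]) auto
  qed
  from tight_imp_convergent_subsubsequence[OF this strict_mono_id]
  obtain r M where r: "strict_mono r" and M: "real_distribution M"
    and conv: "weak_conv_m (\<mu> \<circ> r) M" by auto
  interpret M: real_distribution M by (rule M)
  have "integral\<^sup>L M g = inner (cont_calculus R g x) x"
    if g: "continuous_on UNIV g" "bounded (range g)" for g
  proof -
    obtain B where B: "\<And>t. norm (g t) \<le> B"
      using g(2) by (auto simp: bounded_iff)
    have "(\<lambda>n. integral\<^sup>L ((\<mu> \<circ> r) n) g) \<longlonglongrightarrow> integral\<^sup>L M g"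
    proof (rule weak_conv_imp_integral_bdd_continuous_conv[of "\<mu> \<circ> r"])
      show "real_distribution ((\<mu> \<circ> r) n)" for n by (simp add: distr_\<mu>)
      show "isCont g t" for t using g(1) by (simp add: continuous_on_eq_continuous_at)
    qed (fact M conv B)+
    moreover have "continuous_on {0..1} g" using g(1) continuous_on_subset by blast
    then have "(\<lambda>n. inner (poly_op R (bernstein_poly (r n) g) x) x) \<longlonglongrightarrow> inner (cont_calculus R g x) x"
      by (intro tendsto_intros
          LIMSEQ_subseq_LIMSEQ[OF tendsto_cont_calculus r, unfolded o_def])
    ultimately show ?thesis
      using LIMSEQ_unique by (simp add: int_\<mu>[OF g(1)])
  qed
  then show ?thesis
    unfolding is_spectral_dist_def using M.finite_measure_axioms M.events_eq_borel by blast
qed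

lemma exists_spectral_dist: "\<exists>M. is_spectral_dist R x M"
proof (cases "x = 0")
  case True
  have "finite_measure (null_measure borel :: real measure)"
    by (rule finite_measureI) simp
  then have "is_spectral_dist R x (null_measure borel)"
    unfolding is_spectral_dist_def True by simp
  then show ?thesis ..
next
  case False
  define u where "u = x /\<^sub>R norm x"
  have "norm u = 1" using False by (simp add: u_def)
  then obtain M where M: "finite_measure M" "sets M = sets borel"
    and int: "\<And>g. continuous_on UNIV g \<Longrightarrow> bounded (range g) \<Longrightarrow>
        integral\<^sup>L M g = inner (cont_calculus R g u) u"
    using exists_spectral_dist_unit unfolding is_spectral_dist_def by blast
  interpret M: finite_measure M by fact
  have x: "x = norm x *\<^sub>R u" using False by (simp add: u_def)
  have "finite_measure (density M (\<lambda>_. ennreal ((norm x)\<^sup>2)))"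
    by (rule finite_measureI) (simp add: emeasure_density ennreal_mult_eq_top_iff M.emeasure_finite
        nn_integral_cmult_indicator)
  moreover have "integral\<^sup>L (density M (\<lambda>_. ennreal ((norm x)\<^sup>2))) g = inner (cont_calculus R g x) x"
    if g: "continuous_on UNIV g" "bounded (range g)" for g
  proof -
    have "g \<in> borel_measurable M"
      using borel_measurable_continuous_onI[OF g(1)] M(2) by (simp cong: measurable_cong_sets)
    then have "integral\<^sup>L (density M (\<lambda>_. ennreal ((norm x)\<^sup>2))) g = (norm x)\<^sup>2 * integral\<^sup>L M g"
      by (subst integral_density) auto
    also have "\<dots> = inner (cont_calculus R g (norm x *\<^sub>R u)) (norm x *\<^sub>R u)"
    proof -
      have "continuous_on {0..1} g" using g(1) continuous_on_subset by blast
      then show ?thesis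
        by (simp add: int[OF g] linear_scale[OF linear_cont_calculus] power2_eq_square)
    qed
    finally show ?thesis using x by simp
  qed
  ultimately have "is_spectral_dist R x (density M (\<lambda>_. ennreal ((norm x)\<^sup>2)))"
    unfolding is_spectral_dist_def using M(2) by simp
  then show ?thesis ..
qed

lemma is_spectral_dist_spectral_dist: "is_spectral_dist R x (spectral_dist R x)"
  unfolding spectral_dist_def by (rule someI_ex[OF exists_spectral_dist])

lemma finite_measure_spectral_dist: "finite_measure (spectral_dist R x)"
  and sets_spectral_dist [simp, measurable_cong]: "sets (spectral_dist R x) = sets borel"
  using is_spectral_dist_spectral_dist unfolding is_spectral_dist_def by blast+

lemma measurable_spectral_dist [simp]:
  "measurable (spectral_dist R x) N = measurable borel N"
  by (rule measurable_cong_sets) simp_all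

lemma space_spectral_dist [simp]: "space (spectral_dist R x) = UNIV"
  using sets_eq_imp_space_eq[OF sets_spectral_dist] by simp

lemma integral_spectral_dist:
  assumes "continuous_on UNIV g" "bounded (range g)"
  shows "integral\<^sup>L (spectral_dist R x) g = inner (cont_calculus R g x) x"
  using is_spectral_dist_spectral_dist assms unfolding is_spectral_dist_def by blast

lemma measure_spectral_dist_UNIV: "measure (spectral_dist R x) UNIV = inner x x"
proof -
  have "integral\<^sup>L (spectral_dist R x) (\<lambda>_. 1) = inner (cont_calculus R (\<lambda>_. 1) x) x"
    by (rule integral_spectral_dist) (auto simp: bounded_iff)
  then show ?thesis
    by (simp add: cont_calculus_const)
qed

text \<open>The distance to the unit interval, cut off at \<open>1\<close>, is a test function that vanishes there.\<close>

lemma AE_spectral_dist: "AE t in spectral_dist R x. t \<in> {0..1}"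
proof -
  interpret finite_measure "spectral_dist R x" by (rule finite_measure_spectral_dist)
  define g :: "real \<Rightarrow> real" where "g t = min 1 (infdist t {0..1})" for t
  have g: "continuous_on UNIV g" "bounded (range g)" "\<And>t. 0 \<le> g t"
    unfolding g_def by (auto intro!: continuous_intros simp: infdist_nonneg bounded_iff intro!: exI[of _ 1])
  have "cont_calculus R g = cont_calculus R (\<lambda>t. 0)"
    by (rule cont_calculus_cong) (simp add: g_def)
  then have "integral\<^sup>L (spectral_dist R x) g = 0"
    by (simp add: integral_spectral_dist[OF g(1,2)] cont_calculus_const)
  moreover have "integrable (spectral_dist R x) g"
    by (rule integrable_const_bound[of _ 1])
       (use borel_measurable_continuous_onI[OF g(1)] in \<open>auto simp: g_def infdist_nonneg\<close>)
  ultimately have "AE t in spectral_dist R x. g t = 0"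
    using integral_nonneg_eq_0_iff_AE[of "spectral_dist R x" g] g(3) by simp
  then show ?thesis
  proof eventually_elim
    case (elim t)
    then have "infdist t {0..1} = 0" by (simp add: g_def min_def split: if_splits)
    then show ?case
      using in_closed_iff_infdist_zero[of "{0..1::real}" t] by simp
  qed
qed

lemma norm_cont_calculus_eq_integral:
  assumes "continuous_on UNIV g" "bounded (range g)"
  shows "(norm (cont_calculus R g x))\<^sup>2 = integral\<^sup>L (spectral_dist R x) (\<lambda>t. (g t)\<^sup>2)"
proof -
  obtain B where "\<And>t. \<bar>g t\<bar> \<le> B" using assms(2) by (auto simp: bounded_iff)
  then have "\<bar>(g t)\<^sup>2\<bar> \<le> B\<^sup>2" for t by (metis abs_power2 power2_abs power_mono abs_ge_zero)
  then have "bounded (range (\<lambda>t. (g t)\<^sup>2))" by (auto simp: bounded_iff)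
  moreover have "continuous_on UNIV (\<lambda>t. (g t)\<^sup>2)" by (intro continuous_intros assms)
  ultimately show ?thesis
    using norm_cont_calculus_square[OF continuous_on_subset[OF assms(1) subset_UNIV]]
    by (simp add: integral_spectral_dist)
qed

text \<open>This is \<open>t\<^sup>2 \<le> t\<close>. Applied to differences of a monotone sequence of operators, it reduces strong
  convergence to the convergence of quadratic forms.\<close>

lemma norm_square_le_form: "(norm (R x))\<^sup>2 \<le> inner (R x) x"
proof -
  have "0 \<le> inner (poly_op R ([:0, 1:] - [:0, 1:] * [:0, 1:]) x) x"
  proof (rule poly_op_nonneg)
    fix t :: real assume "0 \<le> t" "t \<le> 1"
    then show "0 \<le> poly ([:0, 1:] - [:0, 1:] * [:0, 1:]) t" by simp
  qed
  then show ?thesis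
    by (simp only: op_simps(2,4,6) inner_diff_left power2_norm_eq_inner diff_ge_0_iff_ge
        symmetric[of "R x" x])
qed

lemma norm_le: "norm (R x) \<le> norm x"
proof -
  have "(norm (R x))\<^sup>2 \<le> (norm x)\<^sup>2"
    using order_trans[OF norm_square_le_form le_id] by (simp only: power2_norm_eq_inner)
  then show ?thesis by (rule power2_le_imp_le) simp
qed

end

section \<open>Spectral projections of a positive contraction\<close>

lemma Cauchy_if_square_dist_le:
  fixes X :: "nat \<Rightarrow> 'a::real_normed_vector" and a :: "nat \<Rightarrow> real"
  assumes a: "Cauchy a" and le: "\<And>m n. n \<le> m \<Longrightarrow> (norm (X n - X m))\<^sup>2 \<le> a n - a m"
  shows "Cauchy X"
proof (rule metric_CauchyI)
  fix e :: real assume "0 < e"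
  then have "0 < e\<^sup>2" by simp
  from metric_CauchyD[OF a this] obtain N where
    N: "\<forall>m\<ge>N. \<forall>n\<ge>N. dist (a m) (a n) < e\<^sup>2" by blast
  have *: "norm (X n - X m) < e" if nm: "N \<le> n" "n \<le> m" for n m
  proof (rule power2_less_imp_less)
    have "a n - a m < e\<^sup>2"
      using N[rule_format, of n m] nm by (simp add: dist_real_def abs_less_iff)
    with le[OF nm(2)] show "(norm (X n - X m))\<^sup>2 < e\<^sup>2"
      by linarith
  qed (use \<open>0 < e\<close> in simp)
  have "dist (X m) (X n) < e" if "N \<le> m" "N \<le> n" for m n
  proof (cases "n \<le> m")
    case True
    then show ?thesis using *[of n m] that by (simp add: dist_norm norm_minus_commute)
  next
    case False
    then show ?thesis using *[of m n] that by (simp add: dist_norm)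
  qed
  then show "\<exists>M. \<forall>m\<ge>M. \<forall>n\<ge>M. dist (X m) (X n) < e" by blast
qed

text \<open>Over the reals a quadratic form determines a symmetric operator: evaluate it at \<open>x + T x\<close>.\<close>

lemma symmetric_form_zero:
  fixes T :: "'a::real_inner \<Rightarrow> 'a"
  assumes "linear T" and sym: "\<And>x y. inner (T x) y = inner x (T y)" and form: "\<And>x. inner (T x) x = 0"
  shows "T x = 0"
proof -
  have "inner (T (x + T x)) (x + T x) = 2 * inner (T x) (T x)"
    using form[of x] form[of "T x"] sym[of "T x" x]
    by (simp add: linear_add[OF assms(1)] inner_add_left inner_add_right)
  then show ?thesis using form[of "x + T x"] by simp
qed

lemma bounded_linear_strong_limit:
  fixes T :: "nat \<Rightarrow> 'a::real_normed_vector \<Rightarrow> 'a"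
  assumes lin: "\<And>n. linear (T n)" and le: "\<And>n x. norm (T n x) \<le> norm x"
    and lim: "\<And>x. (\<lambda>n. T n x) \<longlonglongrightarrow> L x"
  shows "bounded_linear L" "norm (L x) \<le> norm x"
proof -
  show norm: "norm (L x) \<le> norm x" for x
    by (rule LIMSEQ_le_const2[OF tendsto_norm[OF lim[of x]]]) (simp add: le)
  show "bounded_linear L"
  proof (rule bounded_linear_intro[where K = 1])
    fix x y :: 'a and c :: real
    have "(\<lambda>n. T n (x + y)) \<longlonglongrightarrow> L x + L y"
      using tendsto_add[OF lim[of x] lim[of y]] by (simp add: linear_add[OF lin])
    then show "L (x + y) = L x + L y"
      using LIMSEQ_unique[OF lim[of "x + y"]] by blast
    have "(\<lambda>n. T n (c *\<^sub>R x)) \<longlonglongrightarrow> c *\<^sub>R L x"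
      using tendsto_scaleR[OF tendsto_const lim[of x]] by (simp add: linear_scale[OF lin])
    then show "L (c *\<^sub>R x) = c *\<^sub>R L x"
      using LIMSEQ_unique[OF lim[of "c *\<^sub>R x"]] by blast
    show "norm (L x) \<le> norm x * 1" using norm by simp
  qed
qed

lemma pos_contraction_strong_limit:
  fixes T :: "nat \<Rightarrow> 'a::{real_inner, complete_space} \<Rightarrow> 'a"
  assumes T: "\<And>n. pos_contraction (T n)" and lim: "\<And>x. (\<lambda>n. T n x) \<longlonglongrightarrow> L x"
  shows "pos_contraction L"
proof -
  interpret T: pos_contraction "T n" for n by (rule T)
  have lim_inner: "(\<lambda>n. inner (T n x) y) \<longlonglongrightarrow> inner (L x) y" for x y
    by (intro tendsto_intros lim)
  have "(\<lambda>n. inner (T n x) y) \<longlonglongrightarrow> inner x (L y)" for x y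
    unfolding T.symmetric by (intro tendsto_intros lim)
  then have sym: "inner (L x) y = inner x (L y)" for x y
    by (rule LIMSEQ_unique[OF lim_inner])
  have nonneg: "0 \<le> inner (L x) x" for x
    by (rule LIMSEQ_le_const[OF lim_inner]) (simp add: T.nonneg)
  have le: "inner (L x) x \<le> inner x x" for x
    by (rule LIMSEQ_le_const2[OF lim_inner]) (simp add: T.le_id)
  show ?thesis
    by (rule pos_contraction.intro[OF bounded_linear_strong_limit(1)[OF T.linear T.norm_le lim] sym nonneg le])
qed

text \<open>Spectral projections are constructed together with this property. Taking for \<open>C\<close> the
  multiplication by \<open>\<i>\<close> or a projection shows later that they are complex-linear and reduced by the
  subspaces that reduce \<open>R\<close>.\<close>

definition double_commutant :: "('a::real_inner \<Rightarrow> 'a) \<Rightarrow> ('a \<Rightarrow> 'a) \<Rightarrow> bool" where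
  "double_commutant R T \<longleftrightarrow>
     (\<forall>C. bounded_linear C \<longrightarrow> (\<forall>x. C (R x) = R (C x)) \<longrightarrow> (\<forall>x. C (T x) = T (C x)))"

lemma double_commutant_strong_limit:
  assumes "\<And>n. double_commutant R (T n)" "\<And>x. (\<lambda>n. T n x) \<longlonglongrightarrow> L x"
  shows "double_commutant R L"
  unfolding double_commutant_def
proof (intro allI impI)
  fix C x assume C: "bounded_linear C" "\<forall>x. C (R x) = R (C x)"
  have "(\<lambda>n. C (T n x)) \<longlonglongrightarrow> C (L x)"
    by (rule bounded_linear.tendsto[OF C(1) assms(2)])
  moreover have "C (T n x) = T n (C x)" for n
    using assms(1) C unfolding double_commutant_def by blast
  ultimately have "(\<lambda>n. T n (C x)) \<longlonglongrightarrow> C (L x)" by simp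
  then show "C (L x) = L (C x)"
    by (rule LIMSEQ_unique[OF _ assms(2)])
qed

definition is_spectral_proj :: "('a::{real_inner, complete_space} \<Rightarrow> 'a) \<Rightarrow> real set \<Rightarrow> ('a \<Rightarrow> 'a) \<Rightarrow> bool" where
  "is_spectral_proj R U T \<longleftrightarrow> pos_contraction T \<and> double_commutant R T \<and>
     (\<forall>x. inner (T x) x = measure (spectral_dist R x) U)"

context pos_contraction
begin

text \<open>The functions \<open>h n\<close> decrease to the indicator of \<open>F\<close>, so the operators \<open>h n (R)\<close> decrease and
  converge strongly. Their squares have the same limit, since the indicator is its own square.\<close>

lemma closed_spectral_proj:
  assumes F: "closed F"
  shows "\<exists>T. is_spectral_proj R F T \<and> (\<forall>x. T (T x) = T x)"
proof (cases "F = {}")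
  case True
  have "is_spectral_proj R F (\<lambda>x. 0)"
    unfolding is_spectral_proj_def True double_commutant_def
    by (auto simp: linear_0 bounded_linear.linear intro!: pos_contraction.intro)
  then show ?thesis by blast
next
  case False
  interpret D: finite_measure "spectral_dist R x" for x by (rule finite_measure_spectral_dist)
  define h :: "nat \<Rightarrow> real \<Rightarrow> real" where "h n t = max 0 (1 - real n * infdist t F)" for n t
  have h01: "0 \<le> h n t" "h n t \<le> 1" for n t
    by (auto simp: h_def infdist_nonneg)
  have hcont: "continuous_on UNIV (h n)" "bounded (range (h n))" for n
  proof -
    show "continuous_on UNIV (h n)" unfolding h_def by (intro continuous_intros)
    show "bounded (range (h n))" using h01 by (auto simp: bounded_iff intro!: exI[of _ 1])
  qed
  have hcont': "continuous_on {0..1} (h n)" for n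
    using hcont(1) continuous_on_subset by blast
  have hmeas [measurable]: "h n \<in> borel_measurable borel" for n
    by (rule borel_measurable_continuous_onI[OF hcont(1)])
  have hlim: "(\<lambda>n. h n t) \<longlonglongrightarrow> indicator F t" for t
  proof (cases "t \<in> F")
    case True
    then show ?thesis by (simp add: h_def)
  next
    case False
    then have "0 < infdist t F"
      using in_closed_iff_infdist_zero[OF F \<open>F \<noteq> {}\<close>, of t] infdist_nonneg[of t F] by linarith
    then obtain N where N: "1 < real N * infdist t F"
      using reals_Archimedean3 by blast
    have "h n t = 0" if "N \<le> n" for n
    proof -
      have "real N * infdist t F \<le> real n * infdist t F"
        using that by (intro mult_right_mono infdist_nonneg) simp
      with N show ?thesis by (simp add: h_def)
    qed
    then have "\<forall>\<^sub>F n in sequentially. h n t = indicator F t"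
      using False by (auto simp: eventually_sequentially)
    then show ?thesis by (rule tendsto_eventually)
  qed
  have hmono: "h m t \<le> h n t" if "n \<le> m" for n m t
  proof -
    have "real n * infdist t F \<le> real m * infdist t F"
      using that by (intro mult_right_mono infdist_nonneg) simp
    then show ?thesis unfolding h_def by (intro max.mono) simp_all
  qed
  define a where "a x n = integral\<^sup>L (spectral_dist R x) (h n)" for x n
  have form: "inner (cont_calculus R (h n) x) x = a x n" for n x
    unfolding a_def by (rule integral_spectral_dist[symmetric, OF hcont])
  have alim: "a x \<longlonglongrightarrow> measure (spectral_dist R x) F" for x
  proof -
    have "(\<lambda>n. integral\<^sup>L (spectral_dist R x) (h n)) \<longlonglongrightarrow> integral\<^sup>L (spectral_dist R x) (indicator F)"
      by (rule integral_dominated_convergence[where w = "\<lambda>_. 1"])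
         (use F h01 hlim in auto)
    then show ?thesis using F by (simp add: a_def[abs_def])
  qed
  have alim2: "(\<lambda>n. (norm (cont_calculus R (h n) x))\<^sup>2) \<longlonglongrightarrow> measure (spectral_dist R x) F" for x
  proof -
    have "(\<lambda>n. integral\<^sup>L (spectral_dist R x) (\<lambda>t. (h n t)\<^sup>2)) \<longlonglongrightarrow> integral\<^sup>L (spectral_dist R x) (indicator F)"
    proof (rule integral_dominated_convergence[where w = "\<lambda>_. 1"])
      show "AE t in spectral_dist R x. (\<lambda>n. (h n t)\<^sup>2) \<longlonglongrightarrow> indicator F t"
      proof (rule AE_I2)
        fix t
        have "(indicator F t :: real)\<^sup>2 = indicator F t" by (simp add: indicator_def)
        then show "(\<lambda>n. (h n t)\<^sup>2) \<longlonglongrightarrow> indicator F t"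
          using tendsto_power[OF hlim[of t], of 2] by simp
      qed
    qed (use F h01 in \<open>auto simp: power_le_one\<close>)
    then show ?thesis
      using F by (simp add: norm_cont_calculus_eq_integral[OF hcont])
  qed
  have pc: "pos_contraction (cont_calculus R (h n))" for n
  proof (rule pos_contraction.intro)
    show "bounded_linear (cont_calculus R (h n))" by (rule bounded_linear_cont_calculus[OF hcont'])
    fix x y
    show "inner (cont_calculus R (h n) x) y = inner x (cont_calculus R (h n) y)"
      by (rule cont_calculus_symmetric[OF hcont'])
    show "0 \<le> inner (cont_calculus R (h n) x) x"
      by (rule cont_calculus_nonneg[OF hcont' h01(1)])
    have "inner (cont_calculus R (h n) x) x \<le> norm (cont_calculus R (h n) x) * norm x"
      by (rule norm_cauchy_schwarz)
    also have "\<dots> \<le> (1 * norm x) * norm x"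
      by (intro mult_right_mono norm_cont_calculus_le[OF hcont']) (simp_all add: h01)
    finally show "inner (cont_calculus R (h n) x) x \<le> inner x x"
      by (simp add: dot_square_norm power2_eq_square)
  qed
  have dist_le: "(norm (cont_calculus R (h n) x - cont_calculus R (h m) x))\<^sup>2 \<le> a x n - a x m"
    if "n \<le> m" for n m x
  proof -
    let ?d = "\<lambda>t. h n t - h m t"
    have d: "0 \<le> ?d t" "?d t \<le> 1" for t
      using hmono[OF that, of t] h01(1)[of m t] h01(2)[of n t] by linarith+
    have dcont: "continuous_on UNIV ?d"
      by (intro continuous_intros hcont)
    have dbdd: "bounded (range ?d)"
      unfolding bounded_iff by (rule exI[of _ 1]) (use d in auto)
    have "cont_calculus R (h n) x - cont_calculus R (h m) x = cont_calculus R ?d x"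
      by (rule cont_calculus_diff[symmetric, OF hcont' hcont'])
    also have "(norm (cont_calculus R ?d x))\<^sup>2 = integral\<^sup>L (spectral_dist R x) (\<lambda>t. (?d t)\<^sup>2)"
      by (rule norm_cont_calculus_eq_integral[OF dcont dbdd])
    also have "\<dots> \<le> integral\<^sup>L (spectral_dist R x) ?d"
    proof (rule integral_mono)
      show "integrable (spectral_dist R x) (\<lambda>t. (?d t)\<^sup>2)"
        by (rule D.integrable_const_bound[of _ 1]) (use d in \<open>auto simp: power_le_one\<close>)
      show "integrable (spectral_dist R x) ?d"
        by (rule D.integrable_const_bound[of _ 1]) (use d in auto)
      show "(?d t)\<^sup>2 \<le> ?d t" for t
        using d[of t] by (simp add: power2_eq_square mult_left_le)
    qed
    also have "\<dots> = a x n - a x m"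
      unfolding a_def
      by (intro Bochner_Integration.integral_diff D.integrable_const_bound[of _ 1]) (use h01 in auto)
    finally show ?thesis .
  qed
  have conv: "convergent (\<lambda>n. cont_calculus R (h n) x)" for x
  proof -
    have "Cauchy (\<lambda>n. cont_calculus R (h n) x)"
      by (rule Cauchy_if_square_dist_le[OF LIMSEQ_imp_Cauchy[OF alim[of x]]]) (rule dist_le)
    then show ?thesis by (simp add: Cauchy_convergent_iff)
  qed
  define T where "T x = lim (\<lambda>n. cont_calculus R (h n) x)" for x
  have Tlim: "(\<lambda>n. cont_calculus R (h n) x) \<longlonglongrightarrow> T x" for x
    using conv unfolding T_def by (simp add: convergent_LIMSEQ_iff)
  interpret T: pos_contraction T
    by (rule pos_contraction_strong_limit[OF pc Tlim])
  have comm: "double_commutant R T"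
  proof (rule double_commutant_strong_limit[OF _ Tlim])
    show "double_commutant R (cont_calculus R (h n))" for n
      unfolding double_commutant_def using cont_calculus_commute[OF hcont'] by blast
  qed
  have Tform: "inner (T x) x = measure (spectral_dist R x) F" for x
  proof (rule LIMSEQ_unique)
    show "(\<lambda>n. inner (cont_calculus R (h n) x) x) \<longlonglongrightarrow> inner (T x) x"
      by (intro tendsto_intros Tlim)
    show "(\<lambda>n. inner (cont_calculus R (h n) x) x) \<longlonglongrightarrow> measure (spectral_dist R x) F"
      unfolding form by (rule alim)
  qed
  have "T (T x) - T x = 0" for x
  proof (rule symmetric_form_zero[where T = "\<lambda>x. T (T x) - T x"])
    show "linear (\<lambda>x. T (T x) - T x)"
      by (intro bounded_linear.linear bounded_linear_sub bounded_linear_compose[OF T.bounded_linear]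
          T.bounded_linear)
    show "inner (T (T x) - T x) y = inner x (T (T y) - T y)" for x y
      by (simp add: inner_diff_left inner_diff_right T.symmetric)
    fix x
    have "(norm (T x))\<^sup>2 = measure (spectral_dist R x) F"
      by (rule LIMSEQ_unique[OF tendsto_power[OF tendsto_norm[OF Tlim]] alim2])
    then show "inner (T (T x) - T x) x = 0"
      by (simp add: inner_diff_left T.symmetric[of "T x"] Tform power2_norm_eq_inner)
  qed
  then show ?thesis
    using comm Tform T.pos_contraction_axioms unfolding is_spectral_proj_def by auto
qed

end

lemma inner_regular_measure:
  fixes M :: "real measure"
  assumes M: "sets M = sets borel" "finite_measure M" and U: "U \<in> sets borel" and e: "0 < e"
  obtains K where "compact K" "K \<subseteq> U" "measure M U - e < measure M K"
proof (cases "measure M U - e < 0")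
  case True
  then show ?thesis using that[of "{}"] by simp
next
  case False
  interpret finite_measure M by (rule M(2))
  have sup: "emeasure M U = (SUP K\<in>{K. K \<subseteq> U \<and> compact K}. emeasure M K)"
    by (rule inner_regular) (use M U emeasure_finite in auto)
  have "ennreal (measure M U - e) < emeasure M U"
    using False e by (simp add: emeasure_eq_measure ennreal_less_iff)
  then have "ennreal (measure M U - e) < (SUP K\<in>{K. K \<subseteq> U \<and> compact K}. emeasure M K)"
    by (simp only: sup)
  then obtain K where "K \<subseteq> U" "compact K" "ennreal (measure M U - e) < emeasure M K"
    by (subst (asm) less_SUP_iff) blast
  moreover from this have "measure M U - e < measure M K"
    using False by (simp add: emeasure_eq_measure ennreal_less_iff)
  ultimately show ?thesis using that by blast
qed

context pos_contraction
begin

lemma complement_spectral_proj: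
  assumes "is_spectral_proj R U T" "U \<in> sets borel"
  shows "is_spectral_proj R (- U) (\<lambda>x. x - T x)"
proof -
  interpret T: pos_contraction T using assms(1) by (simp add: is_spectral_proj_def)
  interpret D: finite_measure "spectral_dist R y" for y by (rule finite_measure_spectral_dist)
  have "pos_contraction (\<lambda>x. x - T x)"
    by (rule pos_contraction.intro)
       (simp_all add: inner_diff_left inner_diff_right T.symmetric[symmetric] T.nonneg T.le_id
         bounded_linear_sub bounded_linear_ident T.bounded_linear)
  moreover have "double_commutant R (\<lambda>x. x - T x)"
    using assms(1)
    by (auto simp: is_spectral_proj_def double_commutant_def linear_diff bounded_linear.linear)
  moreover have "inner (x - T x) x = measure (spectral_dist R x) (- U)" for x
  proof -
    have "measure (spectral_dist R x) (space (spectral_dist R x) - U)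
        = measure (spectral_dist R x) (space (spectral_dist R x)) - measure (spectral_dist R x) U"
      by (rule D.finite_measure_compl) (use assms(2) in simp)
    then show ?thesis
      using assms(1) by (simp add: Compl_eq_Diff_UNIV inner_diff_left measure_spectral_dist_UNIV is_spectral_proj_def)
  qed
  ultimately show ?thesis by (simp add: is_spectral_proj_def)
qed

text \<open>The partial sums increase, and their blocks are bounded by \<open>1\<close> because their forms are measures of
  disjoint sets.\<close>

lemma disjoint_union_spectral_proj:
  fixes F :: "nat \<Rightarrow> real set"
  assumes T: "\<And>k. is_spectral_proj R (F k) (T k)" and F: "range F \<subseteq> sets borel" "disjoint_family F"
  shows "\<exists>L. is_spectral_proj R (\<Union>k. F k) L"
proof -
  interpret D: finite_measure "spectral_dist R y" for y by (rule finite_measure_spectral_dist)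
  interpret T: pos_contraction "T k" for k using T[of k] by (simp add: is_spectral_proj_def)
  define b where "b x n = (\<Sum>k<n. measure (spectral_dist R x) (F k))" for x n
  have sums: "(\<lambda>k. measure (spectral_dist R x) (F k)) sums measure (spectral_dist R x) (\<Union>k. F k)" for x
    using D.finite_measure_UNION[OF _ F(2), of x] F(1) by simp
  have blim: "b x \<longlonglongrightarrow> measure (spectral_dist R x) (\<Union>k. F k)" for x
    using sums[of x] unfolding sums_def b_def[abs_def] .
  have block: "pos_contraction (\<lambda>x. \<Sum>k\<in>{n..<m}. T k x)"
    and block_form: "inner (\<Sum>k\<in>{n..<m}. T k x) x = b x m - b x n" if "n \<le> m" for n m x
  proof -
    have form: "inner (\<Sum>k\<in>{n..<m}. T k x) x = b x m - b x n" for x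
    proof -
      have "inner (\<Sum>k\<in>{n..<m}. T k x) x = (\<Sum>k\<in>{n..<m}. measure (spectral_dist R x) (F k))"
        using T by (simp add: inner_sum_left is_spectral_proj_def)
      then show ?thesis
        using that unfolding b_def lessThan_atLeast0 by (simp add: sum_diff_nat_ivl)
    qed
    then show "inner (\<Sum>k\<in>{n..<m}. T k x) x = b x m - b x n" .
    show "pos_contraction (\<lambda>x. \<Sum>k\<in>{n..<m}. T k x)"
    proof (rule pos_contraction.intro)
      fix x y
      show "bounded_linear (\<lambda>x. \<Sum>k\<in>{n..<m}. T k x)"
        by (intro bounded_linear_sum T.bounded_linear)
      show "inner (\<Sum>k\<in>{n..<m}. T k x) y = inner x (\<Sum>k\<in>{n..<m}. T k y)"
        by (simp add: inner_sum_left inner_sum_right T.symmetric)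
      show "0 \<le> inner (\<Sum>k\<in>{n..<m}. T k x) x"
        unfolding inner_sum_left by (intro sum_nonneg T.nonneg)
      have "b x m \<le> measure (spectral_dist R x) (\<Union>k. F k)"
        unfolding b_def sums_unique[OF sums]
        by (intro sum_le_suminf sums_summable[OF sums]) auto
      also have "\<dots> \<le> measure (spectral_dist R x) UNIV"
        using D.bounded_measure[of x] by simp
      also have "\<dots> = inner x x" by (rule measure_spectral_dist_UNIV)
      finally have "b x m \<le> inner x x" .
      moreover have "0 \<le> b x n" unfolding b_def by (intro sum_nonneg) simp
      ultimately show "inner (\<Sum>k\<in>{n..<m}. T k x) x \<le> inner x x"
        unfolding form by simp
    qed
  qed
  have "Cauchy (\<lambda>n. \<Sum>k<n. T k x)" for x
  proof (rule Cauchy_if_square_dist_le[OF LIMSEQ_imp_Cauchy[OF tendsto_minus[OF blim[of x]]]])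
    fix m n :: nat assume nm: "n \<le> m"
    have "norm ((\<Sum>k<n. T k x) - (\<Sum>k<m. T k x)) = norm (\<Sum>k\<in>{n..<m}. T k x)"
      using nm by (subst norm_minus_commute) (simp add: lessThan_atLeast0 sum_diff_nat_ivl)
    then show "(norm ((\<Sum>k<n. T k x) - (\<Sum>k<m. T k x)))\<^sup>2 \<le> - b x n - - b x m"
      using pos_contraction.norm_square_le_form[OF block[OF nm], of x] block_form[OF nm, of x] by simp
  qed
  then have lim: "(\<lambda>n. \<Sum>k<n. T k x) \<longlonglongrightarrow> lim (\<lambda>n. \<Sum>k<n. T k x)" for x
    by (simp add: Cauchy_convergent_iff convergent_LIMSEQ_iff)
  define L where "L x = lim (\<lambda>n. \<Sum>k<n. T k x)" for x
  have L: "(\<lambda>n. \<Sum>k<n. T k x) \<longlonglongrightarrow> L x" for x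
    using lim unfolding L_def .
  have "pos_contraction (\<lambda>x. \<Sum>k<n. T k x)" for n
    using block[of 0 n] by (simp add: lessThan_atLeast0)
  then have "pos_contraction L"
    by (rule pos_contraction_strong_limit[OF _ L])
  moreover have "double_commutant R L"
  proof (rule double_commutant_strong_limit[OF _ L])
    fix n
    have "double_commutant R (T k)" for k using T by (simp add: is_spectral_proj_def)
    then show "double_commutant R (\<lambda>x. \<Sum>k<n. T k x)"
      unfolding double_commutant_def by (simp add: linear_sum bounded_linear.linear)
  qed
  moreover have "inner (L x) x = measure (spectral_dist R x) (\<Union>k. F k)" for x
  proof (rule LIMSEQ_unique)
    show "(\<lambda>n. inner (\<Sum>k<n. T k x) x) \<longlonglongrightarrow> inner (L x) x"
      by (intro tendsto_intros L)
    have "inner (\<Sum>k<n. T k x) x = b x n" for n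
      using block_form[of 0 n x] by (simp add: b_def lessThan_atLeast0)
    then show "(\<lambda>n. inner (\<Sum>k<n. T k x) x) \<longlonglongrightarrow> measure (spectral_dist R x) (\<Union>k. F k)"
      using blim[of x] by simp
  qed
  ultimately show ?thesis unfolding is_spectral_proj_def by blast
qed

text \<open>Closed sets are stable under intersection and generate the Borel sets, so Dynkin's induction
  needs only complements and disjoint unions.\<close>

lemma exists_spectral_proj:
  assumes "U \<in> sets borel"
  shows "\<exists>T. is_spectral_proj R U T"
proof -
  have "Int_stable (Collect closed :: real set set)"
    by (auto simp: Int_stable_def)
  moreover have "Collect closed \<subseteq> Pow (UNIV :: real set)" by simp
  moreover have "U \<in> sigma_sets UNIV (Collect closed)"
    using assms by (simp add: borel_eq_closed)
  ultimately show ?thesis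
  proof (induction rule: sigma_sets_induct_disjoint)
    case (basic A)
    then show ?case using closed_spectral_proj by auto
  next
    case empty
    show ?case using closed_spectral_proj[of "{}"] by auto
  next
    case (compl A)
    then show ?case
      using complement_spectral_proj[of A] by (auto simp: borel_eq_closed Compl_eq_Diff_UNIV)
  next
    case (union A)
    from union(3) obtain T where T: "\<And>k. is_spectral_proj R (A k) (T k)" by metis
    show ?case
      by (rule disjoint_union_spectral_proj[OF T _ union(1)]) (use union(2) in \<open>simp add: borel_eq_closed\<close>)
  qed
qed

end

definition spectral_proj :: "('a::{real_inner, complete_space} \<Rightarrow> 'a) \<Rightarrow> real set \<Rightarrow> 'a \<Rightarrow> 'a" where
  "spectral_proj R U = (SOME T. is_spectral_proj R U T)"

context pos_contraction
begin

lemma is_spectral_proj_spectral_proj: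
  "U \<in> sets borel \<Longrightarrow> is_spectral_proj R U (spectral_proj R U)"
  unfolding spectral_proj_def by (rule someI_ex[OF exists_spectral_proj])

lemma
  assumes "U \<in> sets borel"
  shows pos_contraction_spectral_proj: "pos_contraction (spectral_proj R U)"
    and double_commutant_spectral_proj: "double_commutant R (spectral_proj R U)"
    and spectral_proj_form: "inner (spectral_proj R U x) x = measure (spectral_dist R x) U"
  using is_spectral_proj_spectral_proj[OF assms] unfolding is_spectral_proj_def by blast+

lemma spectral_proj_unique:
  assumes "is_spectral_proj R U T" "U \<in> sets borel"
  shows "spectral_proj R U x = T x"
proof -
  interpret T: pos_contraction T using assms(1) by (simp add: is_spectral_proj_def)
  interpret E: pos_contraction "spectral_proj R U" by (rule pos_contraction_spectral_proj[OF assms(2)])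
  have "spectral_proj R U x - T x = 0"
  proof (rule symmetric_form_zero[where T = "\<lambda>x. spectral_proj R U x - T x"])
    show "linear (\<lambda>x. spectral_proj R U x - T x)"
      by (intro bounded_linear.linear bounded_linear_sub E.bounded_linear T.bounded_linear)
    show "inner (spectral_proj R U x - T x) y = inner x (spectral_proj R U y - T y)" for x y
      by (simp add: inner_diff_left inner_diff_right E.symmetric T.symmetric)
    show "inner (spectral_proj R U x - T x) x = 0" for x
      using assms(1) by (simp add: inner_diff_left spectral_proj_form[OF assms(2)] is_spectral_proj_def)
  qed
  then show ?thesis by simp
qed

lemma spectral_proj_UNIV: "spectral_proj R UNIV x = x"
proof -
  have "is_spectral_proj R UNIV (\<lambda>x. x)"
    unfolding is_spectral_proj_def double_commutant_def
    by (auto simp: measure_spectral_dist_UNIV bounded_linear_ident intro!: pos_contraction.intro)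
  then show ?thesis by (rule spectral_proj_unique) simp
qed

lemma spectral_proj_mono_form:
  assumes "K \<subseteq> U" "K \<in> sets borel" "U \<in> sets borel"
  shows "pos_contraction (\<lambda>x. spectral_proj R U x - spectral_proj R K x)"
proof -
  interpret D: finite_measure "spectral_dist R y" for y by (rule finite_measure_spectral_dist)
  interpret K: pos_contraction "spectral_proj R K" by (rule pos_contraction_spectral_proj[OF assms(2)])
  interpret U: pos_contraction "spectral_proj R U" by (rule pos_contraction_spectral_proj[OF assms(3)])
  show ?thesis
  proof (rule pos_contraction.intro)
    fix x y
    show "bounded_linear (\<lambda>x. spectral_proj R U x - spectral_proj R K x)"
      by (intro bounded_linear_sub U.bounded_linear K.bounded_linear)
    show "inner (spectral_proj R U x - spectral_proj R K x) y = inner x (spectral_proj R U y - spectral_proj R K y)"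
      by (simp add: inner_diff_left inner_diff_right U.symmetric K.symmetric)
    show "0 \<le> inner (spectral_proj R U x - spectral_proj R K x) x"
      using assms by (simp add: inner_diff_left spectral_proj_form D.finite_measure_mono)
    show "inner (spectral_proj R U x - spectral_proj R K x) x \<le> inner x x"
      using U.le_id[of x] K.nonneg[of x] by (simp add: inner_diff_left)
  qed
qed

text \<open>Idempotence passes from compact sets to Borel sets by inner regularity of the distributions:
  if \<open>K \<subseteq> U\<close>, the projection for \<open>U\<close> acts as the identity on the range of the one for \<open>K\<close>, and
  these ranges exhaust the range for \<open>U\<close> in the limit.\<close>

lemma spectral_proj_idem:
  assumes U: "U \<in> sets borel"
  shows "spectral_proj R U (spectral_proj R U x) = spectral_proj R U x"
proof -
  interpret D: finite_measure "spectral_dist R y" for y by (rule finite_measure_spectral_dist)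
  interpret U: pos_contraction "spectral_proj R U" by (rule pos_contraction_spectral_proj[OF U])
  let ?u = "spectral_proj R U x"
  have fix_range: "spectral_proj R U (spectral_proj R K x) = spectral_proj R K x"
    if K: "compact K" "K \<subseteq> U" for K
  proof -
    have Kb: "K \<in> sets borel" using K(1) by (simp add: borel_compact)
    let ?y = "spectral_proj R K x"
    obtain T where T: "is_spectral_proj R K T" "\<And>x. T (T x) = T x"
      using closed_spectral_proj[OF compact_imp_closed[OF K(1)]] by blast
    then have idem: "spectral_proj R K ?y = ?y"
      by (simp add: spectral_proj_unique[OF T(1) Kb])
    have "inner (spectral_proj R K ?y) ?y \<le> inner (spectral_proj R U ?y) ?y"
      using K Kb U by (simp add: spectral_proj_form D.finite_measure_mono)
    then have "inner (?y - spectral_proj R U ?y) ?y \<le> 0"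
      by (simp add: idem inner_diff_left)
    moreover have "pos_contraction (\<lambda>x. x - spectral_proj R U x)"
      using complement_spectral_proj[OF is_spectral_proj_spectral_proj[OF U] U]
      by (simp add: is_spectral_proj_def)
    from pos_contraction.norm_square_le_form[OF this]
    have "(norm (?y - spectral_proj R U ?y))\<^sup>2 \<le> inner (?y - spectral_proj R U ?y) ?y" .
    ultimately have "(norm (?y - spectral_proj R U ?y))\<^sup>2 \<le> 0" by linarith
    then show ?thesis by simp
  qed
  have small: "norm (spectral_proj R U ?u - ?u) \<le> e" if e: "0 < e" for e
  proof -
    obtain K where K: "compact K" "K \<subseteq> U"
      and close: "measure (spectral_dist R x) U - (e / 2)\<^sup>2 < measure (spectral_dist R x) K"
      by (rule inner_regular_measure[OF sets_spectral_dist D.finite_measure_axioms U, of "(e / 2)\<^sup>2" x])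
         (use e in simp)
    have Kb: "K \<in> sets borel" using K(1) by (simp add: borel_compact)
    let ?k = "spectral_proj R K x"
    have "(norm (?u - ?k))\<^sup>2 \<le> inner (?u - ?k) x"
      by (rule pos_contraction.norm_square_le_form[OF spectral_proj_mono_form[OF K(2) Kb U]])
    also have "\<dots> \<le> (e / 2)\<^sup>2"
      using close by (simp add: inner_diff_left spectral_proj_form U Kb)
    finally have uk: "norm (?u - ?k) \<le> e / 2"
      by (rule power2_le_imp_le) (use e in simp)
    have "spectral_proj R U ?u - ?u = spectral_proj R U (?u - ?k) - (?u - ?k)"
      by (simp add: linear_diff[OF U.linear] fix_range[OF K])
    then have "norm (spectral_proj R U ?u - ?u) \<le> norm (spectral_proj R U (?u - ?k)) + norm (?u - ?k)"
      by (simp only: norm_triangle_ineq4)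
    then show ?thesis using uk U.norm_le[of "?u - ?k"] by linarith
  qed
  have "norm (spectral_proj R U ?u - ?u) \<le> 0"
  proof (rule field_le_epsilon)
    fix e :: real assume "0 < e"
    from small[OF this] show "norm (spectral_proj R U ?u - ?u) \<le> 0 + e" by simp
  qed
  then show ?thesis by simp
qed

lemma norm_spectral_proj: "U \<in> sets borel \<Longrightarrow> (norm (spectral_proj R U x))\<^sup>2 = measure (spectral_dist R x) U"
proof -
  assume U: "U \<in> sets borel"
  interpret U: pos_contraction "spectral_proj R U" by (rule pos_contraction_spectral_proj[OF U])
  have "(norm (spectral_proj R U x))\<^sup>2 = inner (spectral_proj R U (spectral_proj R U x)) x"
    unfolding power2_norm_eq_inner by (rule U.symmetric[symmetric])
  then show ?thesis by (simp add: spectral_proj_idem[OF U] spectral_proj_form[OF U])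
qed

lemma spectral_proj_disjoint_union:
  assumes "U \<in> sets borel" "V \<in> sets borel" "U \<inter> V = {}"
  shows "spectral_proj R (U \<union> V) x = spectral_proj R U x + spectral_proj R V x"
proof -
  interpret D: finite_measure "spectral_dist R y" for y by (rule finite_measure_spectral_dist)
  interpret U: pos_contraction "spectral_proj R U" by (rule pos_contraction_spectral_proj[OF assms(1)])
  interpret V: pos_contraction "spectral_proj R V" by (rule pos_contraction_spectral_proj[OF assms(2)])
  have UV: "U \<union> V \<in> sets borel" using assms by simp
  interpret E: pos_contraction "spectral_proj R (U \<union> V)" by (rule pos_contraction_spectral_proj[OF UV])
  have "spectral_proj R (U \<union> V) x - (spectral_proj R U x + spectral_proj R V x) = 0"
  proof (rule symmetric_form_zero[where T = "\<lambda>x. spectral_proj R (U \<union> V) x - (spectral_proj R U x + spectral_proj R V x)"])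
    show "linear (\<lambda>x. spectral_proj R (U \<union> V) x - (spectral_proj R U x + spectral_proj R V x))"
      by (intro bounded_linear.linear bounded_linear_sub bounded_linear_add E.bounded_linear
          U.bounded_linear V.bounded_linear)
    show "inner (spectral_proj R (U \<union> V) x - (spectral_proj R U x + spectral_proj R V x)) y
        = inner x (spectral_proj R (U \<union> V) y - (spectral_proj R U y + spectral_proj R V y))" for x y
      by (simp add: inner_diff_left inner_diff_right inner_add_left inner_add_right
          U.symmetric V.symmetric E.symmetric)
    show "inner (spectral_proj R (U \<union> V) x - (spectral_proj R U x + spectral_proj R V x)) x = 0" for x
      using assms by (simp add: inner_diff_left inner_add_left spectral_proj_form D.finite_measure_Union)
  qed
  then show ?thesis by simp
qed

text \<open>For \<open>y\<close> in the range of the first projection the form of the union at \<open>y\<close> is \<open>\<parallel>y\<parallel>\<^sup>2\<close> plus the form of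
  the second one, and it is at most \<open>\<parallel>y\<parallel>\<^sup>2\<close>.\<close>

lemma spectral_proj_disjoint:
  assumes U: "U \<in> sets borel" and V: "V \<in> sets borel" and disj: "U \<inter> V = {}"
  shows "spectral_proj R V (spectral_proj R U x) = 0"
proof -
  interpret D: finite_measure "spectral_dist R y" for y by (rule finite_measure_spectral_dist)
  let ?y = "spectral_proj R U x"
  have "U \<union> V \<in> sets borel" using U V by simp
  then have "inner (spectral_proj R (U \<union> V) ?y) ?y \<le> inner ?y ?y"
    using pos_contraction.le_id[OF pos_contraction_spectral_proj] by blast
  moreover have "spectral_proj R (U \<union> V) ?y = ?y + spectral_proj R V ?y"
    by (simp add: spectral_proj_disjoint_union[OF U V disj] spectral_proj_idem[OF U])
  ultimately have "inner (spectral_proj R V ?y) ?y \<le> 0" by (simp add: inner_add_left)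
  then have "(norm (spectral_proj R V ?y))\<^sup>2 \<le> 0"
    by (simp only: norm_spectral_proj[OF V] spectral_proj_form[OF V])
  then show ?thesis by simp
qed

lemma spectral_proj_Int:
  assumes U: "U \<in> sets borel" and V: "V \<in> sets borel"
  shows "spectral_proj R (U \<inter> V) x = spectral_proj R U (spectral_proj R V x)"
proof -
  have sets: "U \<inter> V \<in> sets borel" "U - V \<in> sets borel" "V - U \<in> sets borel" using U V by auto
  interpret UV: pos_contraction "spectral_proj R (U \<inter> V)"
    by (rule pos_contraction_spectral_proj[OF sets(1)])
  interpret DU: pos_contraction "spectral_proj R (U - V)"
    by (rule pos_contraction_spectral_proj[OF sets(2)])
  have "spectral_proj R U y = spectral_proj R (U \<inter> V) y + spectral_proj R (U - V) y" for y
    using spectral_proj_disjoint_union[OF sets(1,2), of y] by (simp add: Int_Diff_disjoint Int_Diff_Un)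
  moreover have "spectral_proj R V y = spectral_proj R (U \<inter> V) y + spectral_proj R (V - U) y" for y
  proof -
    have "(U \<inter> V) \<union> (V - U) = V" "(U \<inter> V) \<inter> (V - U) = {}" by auto
    then show ?thesis using spectral_proj_disjoint_union[OF sets(1,3), of y] by simp
  qed
  moreover have "spectral_proj R (U \<inter> V) (spectral_proj R (V - U) x) = 0"
    "spectral_proj R (U - V) (spectral_proj R (U \<inter> V) x) = 0"
    "spectral_proj R (U - V) (spectral_proj R (V - U) x) = 0"
    using sets by (auto intro!: spectral_proj_disjoint)
  ultimately show ?thesis
    by (simp add: linear_add[OF UV.linear] linear_add[OF DU.linear] spectral_proj_idem[OF sets(1)])
qed

lemma spectral_proj_sums:
  fixes F :: "nat \<Rightarrow> real set"
  assumes F: "range F \<subseteq> sets borel" "disjoint_family F"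
  shows "(\<lambda>n. spectral_proj R (F n) x) sums spectral_proj R (\<Union>n. F n) x"
proof -
  interpret D: finite_measure "spectral_dist R y" for y by (rule finite_measure_spectral_dist)
  have Fn: "F n \<in> sets borel" for n using F(1) by auto
  have UF: "(\<Union>n. F n) \<in> sets borel" using Fn by auto
  have finite_part: "spectral_proj R (\<Union>k<n. F k) x = (\<Sum>k<n. spectral_proj R (F k) x)" for n
  proof (induction n)
    case 0
    have "(norm (spectral_proj R {} x))\<^sup>2 = 0" by (simp add: norm_spectral_proj)
    then show ?case by simp
  next
    case (Suc n)
    have "F k \<inter> F n = {}" if "k < n" for k
      using disjoint_family_onD[OF F(2), of k n] that by simp
    then have disj: "(\<Union>k<n. F k) \<inter> F n = {}" by blast
    have "(\<Union>k<Suc n. F k) = (\<Union>k<n. F k) \<union> F n" by (auto simp: less_Suc_eq)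
    moreover have "(\<Union>k<n. F k) \<in> sets borel" using Fn by auto
    ultimately show ?case
      using spectral_proj_disjoint_union[OF _ Fn disj] Suc by simp
  qed
  have tail: "(norm ((\<Sum>k<n. spectral_proj R (F k) x) - spectral_proj R (\<Union>n. F n) x))\<^sup>2
      = measure (spectral_dist R x) (\<Union>n. F n) - (\<Sum>k<n. measure (spectral_dist R x) (F k))" for n
  proof -
    let ?P = "\<Union>k<n. F k" and ?T = "(\<Union>n. F n) - (\<Union>k<n. F k)"
    have P: "?P \<in> sets borel" using Fn by auto
    have T: "?T \<in> sets borel" using P UF by auto
    have "?P \<union> ?T = (\<Union>n. F n)" by auto
    then have "spectral_proj R (\<Union>n. F n) x = spectral_proj R ?P x + spectral_proj R ?T x"
      using spectral_proj_disjoint_union[OF P T, of x] by auto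
    then have "norm ((\<Sum>k<n. spectral_proj R (F k) x) - spectral_proj R (\<Union>n. F n) x) = norm (spectral_proj R ?T x)"
      by (simp add: finite_part)
    also have "\<dots>\<^sup>2 = measure (spectral_dist R x) ?T" by (rule norm_spectral_proj[OF T])
    also have "\<dots> = measure (spectral_dist R x) (\<Union>n. F n) - measure (spectral_dist R x) ?P"
      using P UF by (intro D.finite_measure_Diff) auto
    also have "measure (spectral_dist R x) ?P = (\<Sum>k<n. measure (spectral_dist R x) (F k))"
      using Fn disjoint_family_on_mono[OF subset_UNIV F(2)]
      by (intro D.finite_measure_finite_Union) auto
    finally show ?thesis .
  qed
  have "(\<lambda>k. measure (spectral_dist R x) (F k)) sums measure (spectral_dist R x) (\<Union>k. F k)"
    using D.finite_measure_UNION[OF _ F(2), of x] F(1) by simp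
  then have "(\<lambda>n. measure (spectral_dist R x) (\<Union>n. F n) - (\<Sum>k<n. measure (spectral_dist R x) (F k))) \<longlonglongrightarrow>
      measure (spectral_dist R x) (\<Union>n. F n) - measure (spectral_dist R x) (\<Union>n. F n)"
    unfolding sums_def by (intro tendsto_diff tendsto_const)
  then have "(\<lambda>n. (norm ((\<Sum>k<n. spectral_proj R (F k) x) - spectral_proj R (\<Union>n. F n) x))\<^sup>2) \<longlonglongrightarrow> 0"
    by (simp add: tail)
  then have "(\<lambda>n. sqrt ((norm ((\<Sum>k<n. spectral_proj R (F k) x) - spectral_proj R (\<Union>n. F n) x))\<^sup>2)) \<longlonglongrightarrow> sqrt 0"
    by (rule tendsto_real_sqrt)
  then show ?thesis
    unfolding sums_def by (subst Lim_null) (simp add: tendsto_norm_zero_iff)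
qed

end

section \<open>Complex inner products\<close>

lemma scaleC_zero_right [simp]: "c *\<^sub>C (0::'a::complex_inner) = 0"
  using scaleC_add_right[of c 0 "0::'a"] by simp

lemma scaleC_minus_right: "c *\<^sub>C (- x) = - (c *\<^sub>C (x::'a::complex_inner))"
  using scaleC_add_right[of c "- x" x] by (simp add: eq_neg_iff_add_eq_0)

lemma scaleC_diff_right: "c *\<^sub>C (x - y) = c *\<^sub>C x - c *\<^sub>C (y::'a::complex_inner)"
  using scaleC_add_right[of c x "- y"] by (simp add: scaleC_minus_right)

lemma scaleC_scaleR_commute: "c *\<^sub>C r *\<^sub>R x = r *\<^sub>R c *\<^sub>C (x::'a::complex_inner)"
  by (simp add: scaleC_scaleC mult.commute flip: scaleC_of_real)

lemma scaleC_eq: "c *\<^sub>C x = Re c *\<^sub>R x + Im c *\<^sub>R \<i> *\<^sub>C (x::'a::complex_inner)"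
proof -
  have "c = complex_of_real (Re c) + complex_of_real (Im c) * \<i>"
    by (simp add: complex_eq_iff)
  then have "c *\<^sub>C x = (complex_of_real (Re c) + complex_of_real (Im c) * \<i>) *\<^sub>C x" by simp
  then show ?thesis
    by (simp only: scaleC_add_left scaleC_of_real flip: scaleC_scaleC)
qed

lemma Re_cinner: "Re (cinner x y) = inner x (y::'a::complex_inner)"
  by (simp add: inner_eq_Re_cinner)

lemma Im_cinner: "Im (cinner x y) = - inner (\<i> *\<^sub>C x) (y::'a::complex_inner)"
  by (simp add: inner_eq_Re_cinner cinner_scaleC_left)

lemma cinner_zero_left [simp]: "cinner 0 (x::'a::complex_inner) = 0"
  using cinner_add_left[of 0 0 x] by simp

lemma cinner_zero_right [simp]: "cinner (x::'a::complex_inner) 0 = 0"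
  by (subst cinner_commute) simp

lemma cinner_minus_left: "cinner (- x) y = - cinner x (y::'a::complex_inner)"
  using cinner_add_left[of "- x" x y] by (simp add: eq_neg_iff_add_eq_0)

lemma cinner_diff_left: "cinner (x - y) z = cinner x z - cinner y (z::'a::complex_inner)"
  using cinner_add_left[of x "- y" z] by (simp add: cinner_minus_left)

lemma cinner_add_right: "cinner x (y + z) = cinner x y + cinner x (z::'a::complex_inner)"
  unfolding cinner_commute[of x] by (simp add: cinner_add_left)

lemma cinner_diff_right: "cinner x (y - z) = cinner x y - cinner x (z::'a::complex_inner)"
  unfolding cinner_commute[of x] by (simp add: cinner_diff_left)

lemma cinner_scaleC_right: "cinner x (c *\<^sub>C y) = cnj c * cinner x (y::'a::complex_inner)"
  unfolding cinner_commute[of x] by (simp add: cinner_scaleC_left)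

lemma cinner_self: "cinner x x = complex_of_real (inner x (x::'a::complex_inner))"
proof -
  have "Im (cinner x x) = Im (cnj (cinner x x))"
    using arg_cong[OF cinner_commute[of x x], of Im] .
  then show ?thesis by (simp add: complex_eq_iff Re_cinner)
qed

lemma inner_i_i: "inner (\<i> *\<^sub>C x) (\<i> *\<^sub>C y) = inner x (y::'a::complex_inner)"
  by (simp add: inner_eq_Re_cinner cinner_scaleC_left cinner_scaleC_right)

lemma inner_i_left: "inner (\<i> *\<^sub>C x) y = - inner x (\<i> *\<^sub>C (y::'a::complex_inner))"
  by (simp add: inner_eq_Re_cinner cinner_scaleC_left cinner_scaleC_right)

lemma bounded_linear_scaleC: "bounded_linear (\<lambda>x. c *\<^sub>C (x::'a::complex_inner))"
proof (rule bounded_linear_intro[where K = "cmod c"])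
  fix x :: 'a
  have "cinner (c *\<^sub>C x) (c *\<^sub>C x) = complex_of_real ((cmod c)\<^sup>2) * complex_of_real (inner x x)"
    unfolding cinner_scaleC_left cinner_scaleC_right complex_norm_square
    unfolding cinner_self by (simp only: mult_ac)
  then have "inner (c *\<^sub>C x) (c *\<^sub>C x) = (cmod c)\<^sup>2 * inner x x"
    unfolding inner_eq_Re_cinner[of "c *\<^sub>C x"] by simp
  then have "(norm (c *\<^sub>C x))\<^sup>2 = (norm x * cmod c)\<^sup>2"
    unfolding power2_norm_eq_inner power_mult_distrib by (simp only: mult.commute)
  then show "norm (c *\<^sub>C x) \<le> norm x * cmod c"
    by (simp only: power2_eq_iff_nonneg norm_ge_zero mult_nonneg_nonneg order_refl)
qed (simp_all add: scaleC_add_right scaleC_scaleR_commute)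

definition complex_linear :: "('a::complex_inner \<Rightarrow> 'a) \<Rightarrow> bool" where
  "complex_linear T \<longleftrightarrow> (\<forall>c x. T (c *\<^sub>C x) = c *\<^sub>C T x)"

lemma complex_linearI:
  assumes "linear T" "\<And>x. T (\<i> *\<^sub>C x) = \<i> *\<^sub>C T x"
  shows "complex_linear T"
  unfolding complex_linear_def
proof (intro allI)
  fix c x
  show "T (c *\<^sub>C x) = c *\<^sub>C T x"
    by (subst (1 2) scaleC_eq) (simp add: linear_add[OF assms(1)] linear_scale[OF assms(1)] assms(2))
qed

lemma cinner_symmetric:
  assumes "complex_linear T" "\<And>x y. inner (T x) y = inner x (T y)"
  shows "cinner (T x) y = cinner x (T y)"
proof -
  have "inner (\<i> *\<^sub>C T x) y = inner (\<i> *\<^sub>C x) (T y)"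
    using assms(1) assms(2)[of "\<i> *\<^sub>C x" y] by (simp add: complex_linear_def)
  then show ?thesis
    by (simp add: complex_eq_iff Re_cinner Im_cinner assms(2))
qed

lemma cinner_symmetric_form:
  assumes "complex_linear T" "\<And>x y. inner (T x) y = inner x (T y)"
  shows "cinner (T x) x = complex_of_real (inner (T x) x)"
proof -
  have "cinner (T x) x = cnj (cinner (T x) x)"
    using cinner_symmetric[OF assms, of x x] cinner_commute[of x "T x"] by simp
  then have "Im (cinner (T x) x) = 0" by (simp add: complex_eq_iff)
  then show ?thesis by (simp add: complex_eq_iff Re_cinner)
qed

section \<open>Closed subspaces and their projections\<close>

text \<open>The orthogonal decomposition is part of the interface. For the complement of the kernel of a
  positive operator it will come from a strong limit of functions of that operator.\<close>

locale proj_subspace =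
  fixes M :: "'a::complex_inner set"
  assumes add_mem: "x \<in> M \<Longrightarrow> y \<in> M \<Longrightarrow> x + y \<in> M"
    and scaleC_mem: "x \<in> M \<Longrightarrow> c *\<^sub>C x \<in> M"
    and decomposition: "\<exists>p\<in>M. x - p \<in> orth_compl M"
begin

lemma scaleR_mem: "x \<in> M \<Longrightarrow> r *\<^sub>R x \<in> M"
  using scaleC_mem[of x "complex_of_real r"] by (simp add: scaleC_of_real)

lemma zero_mem: "0 \<in> M"
proof -
  obtain p where "p \<in> M" using decomposition by blast
  then show ?thesis using scaleR_mem[of p 0] by simp
qed

lemma diff_mem: "x \<in> M \<Longrightarrow> y \<in> M \<Longrightarrow> x - y \<in> M"
  using add_mem[of x "(-1) *\<^sub>R y"] scaleR_mem[of y "-1"] by simp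

lemma orth: "x \<in> orth_compl M \<Longrightarrow> y \<in> M \<Longrightarrow> cinner x y = 0"
  by (simp add: orth_compl_def)

lemma orth': "x \<in> orth_compl M \<Longrightarrow> y \<in> M \<Longrightarrow> inner x y = 0"
  using orth[of x y] by (simp add: inner_eq_Re_cinner)

lemma proj_eqI:
  assumes "p \<in> M" "x - p \<in> orth_compl M"
  shows "proj M x = p"
  unfolding proj_def
proof (rule the_equality)
  fix q assume q: "q \<in> M \<and> x - q \<in> orth_compl M"
  have "inner ((x - q) - (x - p)) (p - q) = 0"
    using orth'[of "x - q" "p - q"] orth'[of "x - p" "p - q"] q assms diff_mem
    by (simp add: inner_diff_left)
  then show "q = p" by simp
qed (use assms in simp)

lemma proj_mem: "proj M x \<in> M" and diff_proj_orth: "x - proj M x \<in> orth_compl M"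
proof -
  obtain p where p: "p \<in> M" "x - p \<in> orth_compl M" using decomposition by blast
  then show "proj M x \<in> M" "x - proj M x \<in> orth_compl M" by (simp_all add: proj_eqI)
qed

lemma orth_compl_add: "x \<in> orth_compl M \<Longrightarrow> y \<in> orth_compl M \<Longrightarrow> x + y \<in> orth_compl M"
  by (simp add: orth_compl_def cinner_add_left)

lemma orth_compl_scaleC: "x \<in> orth_compl M \<Longrightarrow> c *\<^sub>C x \<in> orth_compl M"
  by (simp add: orth_compl_def cinner_scaleC_left)

lemma zero_orth: "0 \<in> orth_compl M"
  by (simp add: orth_compl_def)

lemma proj_id: "x \<in> M \<Longrightarrow> proj M x = x"
  by (rule proj_eqI) (simp_all add: zero_orth)

lemma proj_orth_compl: "x \<in> orth_compl M \<Longrightarrow> proj M x = 0"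
  by (rule proj_eqI) (simp_all add: zero_mem)

lemma proj_add: "proj M (x + y) = proj M x + proj M y"
proof (rule proj_eqI)
  show "x + y - (proj M x + proj M y) \<in> orth_compl M"
    using orth_compl_add[OF diff_proj_orth[of x] diff_proj_orth[of y]] by (simp add: algebra_simps)
qed (intro add_mem proj_mem)

lemma proj_scaleC: "proj M (c *\<^sub>C x) = c *\<^sub>C proj M x"
proof (rule proj_eqI)
  show "c *\<^sub>C x - c *\<^sub>C proj M x \<in> orth_compl M"
    using orth_compl_scaleC[OF diff_proj_orth[of x], of c] by (simp add: scaleC_diff_right)
qed (intro scaleC_mem proj_mem)

lemma proj_scaleR: "proj M (r *\<^sub>R x) = r *\<^sub>R proj M x"
  using proj_scaleC[of "complex_of_real r" x] by (simp add: scaleC_of_real)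

lemma cinner_proj_left: "y \<in> M \<Longrightarrow> cinner (proj M x) y = cinner x y"
  using orth[OF diff_proj_orth[of x], of y] by (simp add: cinner_diff_left)

lemma cinner_proj_right: "y \<in> M \<Longrightarrow> cinner y (proj M x) = cinner y x"
  unfolding cinner_commute[of y] by (simp add: cinner_proj_left)

lemma cinner_proj_symmetric: "cinner (proj M x) y = cinner x (proj M y)"
  using cinner_proj_left[OF proj_mem[of y], of x] cinner_proj_right[OF proj_mem[of x], of y] by simp

lemma inner_proj_symmetric: "inner (proj M x) y = inner x (proj M y)"
  by (simp only: inner_eq_Re_cinner cinner_proj_symmetric)

lemma proj_idem: "proj M (proj M x) = proj M x"
  by (rule proj_id[OF proj_mem])

lemma norm_proj_le: "norm (proj M x) \<le> norm x"
proof -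
  have "(norm (proj M x))\<^sup>2 = inner (proj M (proj M x)) x"
    by (simp only: power2_norm_eq_inner inner_proj_symmetric[of "proj M x"])
  also have "\<dots> \<le> norm (proj M x) * norm x"
    unfolding proj_idem by (rule norm_cauchy_schwarz)
  finally have "norm (proj M x) * norm (proj M x) \<le> norm (proj M x) * norm x"
    by (simp add: power2_eq_square)
  then show ?thesis
    by (cases "norm (proj M x) = 0") auto
qed

lemma bounded_linear_proj: "bounded_linear (proj M)"
  by (rule bounded_linear_intro[where K = 1]) (simp_all add: proj_add proj_scaleR norm_proj_le)

lemma mem_iff_proj: "x \<in> M \<longleftrightarrow> proj M x = x"
  using proj_mem[of x] proj_id by auto

lemma operator_on_proj: "operator_on M (proj M)"
  unfolding operator_on_def
  by (auto simp: bounded_linear_proj proj_scaleC proj_mem proj_orth_compl)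

lemma operator_on_apply_proj:
  assumes "operator_on M T"
  shows "T (proj M x) = T x"
proof -
  have "T (x - proj M x) = 0"
    using assms diff_proj_orth by (auto simp: operator_on_def)
  then show ?thesis
    using assms by (simp add: operator_on_def linear_diff bounded_linear.linear)
qed

lemma operator_on_mem: "operator_on M T \<Longrightarrow> T x \<in> M"
  by (auto simp: operator_on_def)

lemma operator_on_ext:
  assumes "operator_on M T" "operator_on M T'" "\<And>x. x \<in> M \<Longrightarrow> T x = T' x"
  shows "T = T'"
  using operator_on_apply_proj[OF assms(1)] operator_on_apply_proj[OF assms(2)] assms(3)[OF proj_mem]
  by (metis ext)

lemma operator_on_diff:
  assumes "operator_on M T" "operator_on M T'"
  shows "operator_on M (\<lambda>x. T x - T' x)"
  using assms unfolding operator_on_def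
  by (auto simp: bounded_linear_sub scaleC_diff_right intro!: diff_mem)

lemma operator_on_add:
  assumes "operator_on M T" "operator_on M T'"
  shows "operator_on M (\<lambda>x. T x + T' x)"
  using assms unfolding operator_on_def
  by (auto simp: bounded_linear_add scaleC_add_right intro!: add_mem)

lemma operator_on_scaleC:
  assumes "operator_on M T"
  shows "operator_on M (\<lambda>x. c *\<^sub>C T x)"
  using assms unfolding operator_on_def
  by (auto simp: scaleC_scaleC mult.commute intro!: scaleC_mem
      bounded_linear_compose[OF bounded_linear_scaleC])

text \<open>Polarization: on a complex space an operator is determined by its quadratic form.\<close>

lemma operator_on_eq_if_forms_eq:
  assumes T: "operator_on M T" "operator_on M T'"
    and form: "\<And>x. x \<in> M \<Longrightarrow> cinner (T x) x = cinner (T' x) x"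
  shows "T = T'"
proof (rule operator_on_ext[OF T])
  fix x assume x: "x \<in> M"
  define D where "D x = T x - T' x" for x
  have D: "operator_on M D"
    using operator_on_diff[OF T] by (simp add: D_def[abs_def])
  then have lin: "linear D" "\<And>c x. D (c *\<^sub>C x) = c *\<^sub>C D x"
    by (auto simp: operator_on_def bounded_linear.linear)
  have form0: "cinner (D u) u = 0" if "u \<in> M" for u
    using form[OF that] by (simp add: D_def cinner_diff_left)
  define y where "y = D x"
  have y: "y \<in> M" using operator_on_mem[OF D] by (simp add: y_def)
  have "cinner (D (x + y)) (x + y) = 0" "cinner (D (x + \<i> *\<^sub>C y)) (x + \<i> *\<^sub>C y) = 0"
    using x y by (auto intro!: form0 add_mem scaleC_mem)
  then have "cinner (D x) y + cinner (D y) x = 0" "- \<i> * cinner (D x) y + \<i> * cinner (D y) x = 0"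
    using form0[OF x] form0[OF y]
    by (simp_all add: linear_add[OF lin(1)] lin(2) cinner_add_left cinner_add_right
        cinner_scaleC_left cinner_scaleC_right)
  then have "cinner (D x) y = 0"
    by (simp add: complex_eq_iff)
  then have "inner y y = 0" using cinner_self[of y] by (simp add: y_def)
  then show "T x = T' x" by (simp add: y_def D_def)
qed

lemma spectral_integral_onI:
  assumes "operator_on M T" "\<And>x. x \<in> M \<Longrightarrow> cinner (T x) x = (LINT z:K|scalar_measure E x. g z)"
  shows "spectral_integral_on M E K g = T"
  unfolding spectral_integral_on_def
proof (rule the_equality)
  fix T' assume "operator_on M T' \<and> (\<forall>x\<in>M. cinner (T' x) x = (LINT z:K|scalar_measure E x. g z))"
  then show "T' = T"
    using assms by (intro operator_on_eq_if_forms_eq) auto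
qed (use assms in auto)

end

section \<open>Powers of an integral against a projection-valued measure\<close>

text \<open>The operator \<open>(1 + D / c) / 2\<close> is a positive contraction, and the polynomial \<open>2 t - 1\<close> recovers
  \<open>D / c\<close> from it.\<close>

lemma norm_le_if_form_le:
  fixes D :: "'a::{real_inner, complete_space} \<Rightarrow> 'a"
  assumes D: "bounded_linear D" "\<And>x y. inner (D x) y = inner x (D y)"
    and form: "\<And>x. \<bar>inner (D x) x\<bar> \<le> c * inner x x" and c: "0 < c"
  shows "norm (D x) \<le> c * norm x"
proof -
  define R where "R x = (1 / 2) *\<^sub>R (x + (1 / c) *\<^sub>R D x)" for x
  interpret R: pos_contraction R
  proof (rule pos_contraction.intro)
    show "bounded_linear R"
      unfolding R_def by (intro bounded_linear_scaleR_right bounded_linear_add bounded_linear_ident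
          bounded_linear_compose[OF bounded_linear_scaleR_right D(1)] bounded_linear_const_scaleR D(1))
    fix x y
    show "inner (R x) y = inner x (R y)"
      by (simp add: R_def inner_add_left inner_add_right D(2))
    have "inner (D x) x / c \<le> inner x x" "- (inner (D x) x / c) \<le> inner x x"
      using form[of x] c pos_divide_le_eq[OF c, of "inner (D x) x" "inner x x"]
        pos_divide_le_eq[OF c, of "- inner (D x) x" "inner x x"]
      by (simp_all add: mult.commute abs_le_iff)
    then show "0 \<le> inner (R x) x" "inner (R x) x \<le> inner x x"
      by (simp_all add: R_def inner_add_left)
  qed
  have "norm (poly_op R [:-1, 2:] x) \<le> 1 * norm x"
    by (rule R.norm_poly_op_le) auto
  moreover have "poly_op R [:-1, 2:] x = (1 / c) *\<^sub>R D x"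
    by (simp add: R.op_simps linear_0[OF R.linear] linear_scale[OF R.linear])
       (simp add: R_def scaleR_add_right)
  ultimately show ?thesis
    using c by (simp add: pos_divide_le_eq mult.commute)
qed

lemma abs_bernstein_poly_le:
  assumes "\<And>t. 0 \<le> t \<Longrightarrow> t \<le> 1 \<Longrightarrow> \<bar>g t\<bar> \<le> c" "0 \<le> t" "t \<le> 1"
  shows "\<bar>poly (bernstein_poly n g) t\<bar> \<le> c"
proof -
  have "\<bar>poly (bernstein_poly n g) t\<bar> \<le> (\<Sum>k\<le>n. \<bar>g (real k / real n) * Bernstein n k t\<bar>)"
    unfolding poly_bernstein_poly by (rule sum_abs)
  also have "\<dots> \<le> (\<Sum>k\<le>n. c * Bernstein n k t)"
  proof (rule sum_mono)
    fix k assume "k \<in> {..n}"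
    then have "\<bar>g (real k / real n)\<bar> \<le> c" by (intro assms(1)) (auto simp: divide_le_eq_1)
    then show "\<bar>g (real k / real n) * Bernstein n k t\<bar> \<le> c * Bernstein n k t"
      using Bernstein_nonneg[OF assms(2,3), of n k] by (simp add: abs_mult mult_right_mono)
  qed
  also have "\<dots> = c" by (simp add: flip: sum_distrib_left)
  finally show ?thesis .
qed

text \<open>The step function with values in multiples of \<open>1 / n\<close> below \<open>g\<close>, written as an average of
  indicators of superlevel sets.\<close>

definition layers :: "('b \<Rightarrow> real) \<Rightarrow> nat \<Rightarrow> 'b \<Rightarrow> real" where
  "layers g n z = (\<Sum>k\<in>{1..n}. indicator {z. real k \<le> real n * g z} z) / real n"

lemma layers_approx:
  assumes "0 \<le> g z" "g z \<le> 1" "0 < n"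
  shows "\<bar>g z - layers g n z\<bar> \<le> 1 / real n"
proof -
  have "{k\<in>{1..n}. real k \<le> real n * g z} = {1..nat \<lfloor>real n * g z\<rfloor>}"
  proof (intro set_eqI iffI)
    fix k assume "k \<in> {1..nat \<lfloor>real n * g z\<rfloor>}"
    then have k: "1 \<le> k" "real k \<le> real n * g z"
      using assms by (auto simp: le_nat_iff le_floor_iff)
    moreover have "real n * g z \<le> real n" using assms by (simp add: mult_left_le)
    ultimately show "k \<in> {k\<in>{1..n}. real k \<le> real n * g z}" by auto
  qed (auto simp: le_nat_floor)
  then have "(\<Sum>k\<in>{1..n}. indicator {z. real k \<le> real n * g z} z :: real) = real (nat \<lfloor>real n * g z\<rfloor>)"
    by (simp add: indicator_def sum.If_cases Int_def)
  then have "layers g n z = real (nat \<lfloor>real n * g z\<rfloor>) / real n" by (simp add: layers_def)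
  moreover have "real (nat \<lfloor>real n * g z\<rfloor>) = of_int \<lfloor>real n * g z\<rfloor>"
    using assms by simp
  then have "\<bar>real n * g z - real (nat \<lfloor>real n * g z\<rfloor>)\<bar> \<le> 1"
    by linarith
  moreover have "g z - layers g n z = (real n * g z - real n * layers g n z) / real n"
    using assms(3) by (simp add: field_simps)
  ultimately show ?thesis
    using assms(3) by (simp add: divide_right_mono)
qed

locale pvm = proj_subspace M for M :: "'a::chilbert_space set" +
  fixes E :: "complex set \<Rightarrow> 'a \<Rightarrow> 'a"
  assumes pvm: "projection_valued_measure_on M E"
begin

lemma E_op: "U \<in> sets borel \<Longrightarrow> operator_on M (E U)"
  and E_sym: "U \<in> sets borel \<Longrightarrow> cinner (E U x) y = cinner x (E U y)"
  and E_UNIV: "E UNIV = proj M"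
  using pvm unfolding projection_valued_measure_on_def by blast+

lemma E_idem: "U \<in> sets borel \<Longrightarrow> E U (E U x) = E U x"
  using pvm unfolding projection_valued_measure_on_def by (metis comp_apply)

lemma E_Int: "U \<in> sets borel \<Longrightarrow> V \<in> sets borel \<Longrightarrow> E (U \<inter> V) x = E U (E V x)"
  using pvm unfolding projection_valued_measure_on_def by (metis comp_apply)

lemma E_sums: "range F \<subseteq> sets borel \<Longrightarrow> disjoint_family F \<Longrightarrow> (\<lambda>n. E (F n) x) sums E (\<Union>n. F n) x"
  using pvm unfolding projection_valued_measure_on_def by blast

lemma E_sym_inner: "U \<in> sets borel \<Longrightarrow> inner (E U x) y = inner x (E U y)"
  by (simp only: inner_eq_Re_cinner E_sym)

lemma E_bounded_linear: "U \<in> sets borel \<Longrightarrow> bounded_linear (E U)"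
  using E_op by (simp add: operator_on_def)

lemma E_linear: "U \<in> sets borel \<Longrightarrow> linear (E U)"
  by (intro bounded_linear.linear E_bounded_linear)

lemma E_form_nonneg: "U \<in> sets borel \<Longrightarrow> 0 \<le> inner (E U x) x"
  using E_sym_inner[of U "E U x" x] E_idem[of U x] inner_ge_zero[of "E U x"] by simp

lemma sets_scalar_measure [simp, measurable_cong]: "sets (scalar_measure E x) = sets borel"
  unfolding scalar_measure_def
  using sets.sigma_sets_eq[of "borel :: complex measure"] by (simp add: sets_measure_of)

lemma space_scalar_measure [simp]: "space (scalar_measure E x) = UNIV"
  using sets_eq_imp_space_eq[OF sets_scalar_measure] by simp

lemma measurable_scalar_measure [simp]:
  "measurable (scalar_measure E x) N = measurable borel N"
  by (rule measurable_cong_sets) simp_all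

lemma emeasure_scalar_measure:
  assumes "U \<in> sets borel"
  shows "emeasure (scalar_measure E x) U = ennreal (inner (E U x) x)"
  unfolding inner_eq_Re_cinner
proof (rule emeasure_measure_of[OF scalar_measure_def])
  show "countably_additive (sets (scalar_measure E x)) (\<lambda>U. ennreal (Re (cinner (E U x) x)))"
  proof (rule countably_additiveI)
    fix F :: "nat \<Rightarrow> complex set"
    assume F: "range F \<subseteq> sets (scalar_measure E x)" "disjoint_family F"
    then have Fb: "F n \<in> sets borel" for n by auto
    have "(\<lambda>n. inner (E (F n) x) x) sums inner (E (\<Union>n. F n) x) x"
      by (rule bounded_linear.sums[OF bounded_linear_inner_left E_sums]) (use F in auto)
    then show "(\<Sum>n. ennreal (Re (cinner (E (F n) x) x))) = ennreal (Re (cinner (E (\<Union>n. F n) x) x))"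
      unfolding Re_cinner by (intro suminf_ennreal_eq) (use E_form_nonneg Fb in auto)
  qed
  have "(\<lambda>n::nat. E {} x) sums E (\<Union>n::nat. {}) x"
    by (rule E_sums) (auto simp: disjoint_family_on_def)
  then have "E {} x = 0"
    by (metis sums_summable summable_LIMSEQ_zero LIMSEQ_const_iff)
  then show "positive (sets (scalar_measure E x)) (\<lambda>U. ennreal (Re (cinner (E U x) x)))"
    by (simp add: positive_def)
qed (use assms in auto)

lemma measure_scalar_measure:
  "U \<in> sets borel \<Longrightarrow> measure (scalar_measure E x) U = inner (E U x) x"
  by (simp add: measure_def emeasure_scalar_measure E_form_nonneg)

lemma finite_scalar_measure: "finite_measure (scalar_measure E x)"
  by (rule finite_measureI) (simp add: emeasure_scalar_measure)

lemma measure_scalar_measure_UNIV: "measure (scalar_measure E x) UNIV = inner (proj M x) x"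
  by (simp add: measure_scalar_measure E_UNIV)

lemma measure_scalar_measure_UNIV_le: "measure (scalar_measure E x) UNIV \<le> inner x x"
proof -
  have "inner (proj M x) x \<le> norm (proj M x) * norm x" by (rule norm_cauchy_schwarz)
  also have "\<dots> \<le> norm x * norm x" by (intro mult_right_mono norm_proj_le) simp
  finally show ?thesis by (simp add: measure_scalar_measure_UNIV dot_square_norm power2_eq_square)
qed

definition layers_op :: "(complex \<Rightarrow> real) \<Rightarrow> nat \<Rightarrow> 'a \<Rightarrow> 'a" where
  "layers_op g n x = (1 / real n) *\<^sub>R (\<Sum>k\<in>{1..n}. E {z. real k \<le> real n * g z} x)"

text \<open>Applying the operator multiplies the density \<open>h\<close> of the form by the step function. The set \<open>U\<close> is
  carried along so that the statement can be iterated.\<close>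

lemma layers_op_form:
  assumes g [measurable]: "g \<in> borel_measurable borel"
    and h [measurable]: "h \<in> borel_measurable borel" "\<And>z. \<bar>h z\<bar> \<le> c"
    and Y: "\<And>U x. U \<in> sets borel \<Longrightarrow>
      inner (E U (Y x)) x = integral\<^sup>L (scalar_measure E x) (\<lambda>z. indicator U z * h z)"
    and U [measurable]: "U \<in> sets borel"
  shows "inner (E U (layers_op g n (Y x))) x =
    integral\<^sup>L (scalar_measure E x) (\<lambda>z. indicator U z * (layers g n z * h z))"
proof -
  interpret finite_measure "scalar_measure E x" by (rule finite_scalar_measure)
  have V [measurable]: "{z. real k \<le> real n * g z} \<in> sets borel" for k
    by measurable
  have int: "integrable (scalar_measure E x) (\<lambda>z. indicator (U \<inter> {z. real k \<le> real n * g z}) z * h z)" for k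
    by (rule integrable_const_bound[of _ c])
       (use h(2) abs_ge_zero[THEN order_trans, OF h(2)] in \<open>auto simp: indicator_def\<close>)
  have "inner (E U (layers_op g n (Y x))) x
      = (1 / real n) * (\<Sum>k\<in>{1..n}. inner (E (U \<inter> {z. real k \<le> real n * g z}) (Y x)) x)"
    by (simp add: layers_op_def linear_scale[OF E_linear[OF U]] linear_sum[OF E_linear[OF U]]
        inner_sum_left E_Int[OF U V])
  also have "\<dots> = (1 / real n) * (\<Sum>k\<in>{1..n}. integral\<^sup>L (scalar_measure E x)
      (\<lambda>z. indicator (U \<inter> {z. real k \<le> real n * g z}) z * h z))"
    using Y by simp
  also have "\<dots> = integral\<^sup>L (scalar_measure E x) (\<lambda>z. (1 / real n) *
      (\<Sum>k\<in>{1..n}. indicator (U \<inter> {z. real k \<le> real n * g z}) z * h z))"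
    by (simp only: integral_mult_right_zero Bochner_Integration.integral_sum[OF int])
  also have "\<dots> = integral\<^sup>L (scalar_measure E x) (\<lambda>z. indicator U z * (layers g n z * h z))"
    by (intro Bochner_Integration.integral_cong refl)
       (simp add: layers_def indicator_inter_arith sum_distrib_left sum_distrib_right sum_divide_distrib mult_ac)
  finally show ?thesis .
qed

lemma layers_bounds: "0 \<le> layers g n z" "layers g n z \<le> 1"
proof -
  show "0 \<le> layers g n z" unfolding layers_def by (intro divide_nonneg_nonneg sum_nonneg) auto
  have "(\<Sum>k\<in>{1..n}. indicator {z. real k \<le> real n * g z} z) \<le> (\<Sum>k\<in>{1..n}. 1 :: real)"
    by (intro sum_mono) (auto simp: indicator_def)
  then have "(\<Sum>k\<in>{1..n}. indicator {z. real k \<le> real n * g z} z) \<le> real n" by simp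
  then show "layers g n z \<le> 1" by (cases "n = 0") (simp_all add: layers_def divide_le_eq_1)
qed

lemma abs_layers_le: "\<bar>layers g n z\<bar> \<le> 1"
  using layers_bounds[of g n z] by simp

lemma operator_on_layers_op:
  assumes [measurable]: "g \<in> borel_measurable borel"
  shows "operator_on M (layers_op g n)"
proof -
  have zero: "operator_on M (\<lambda>x. 0)"
    by (auto simp: operator_on_def zero_mem)
  have "operator_on M (\<lambda>x. \<Sum>k\<in>K. E {z. real k \<le> real n * g z} x)" for K
  proof (induction K rule: infinite_finite_induct)
    case (insert k K)
    then show ?case by (simp add: operator_on_add E_op)
  qed (simp_all add: zero)
  then have "operator_on M (\<lambda>x. complex_of_real (1 / real n) *\<^sub>C (\<Sum>k\<in>{1..n}. E {z. real k \<le> real n * g z} x))"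
    by (rule operator_on_scaleC)
  then show ?thesis by (simp only: scaleC_of_real layers_op_def[abs_def])
qed

lemma operator_form_eq_E_UNIV:
  assumes "operator_on M T"
  shows "inner (E UNIV (T x)) x = inner (T x) x"
  using proj_id[OF operator_on_mem[OF assms]] by (simp add: E_UNIV)

lemma layers_op_quadratic_form:
  assumes g: "g \<in> borel_measurable borel"
  shows "inner (layers_op g n x) x = integral\<^sup>L (scalar_measure E x) (layers g n)"
proof -
  interpret finite_measure "scalar_measure E y" for y by (rule finite_scalar_measure)
  have "inner (E U y) y = integral\<^sup>L (scalar_measure E y) (\<lambda>z. indicator U z * 1)"
    if "U \<in> sets borel" for U y
    using that by (simp add: measure_scalar_measure)
  from layers_op_form[OF g, of "\<lambda>_. 1" 1 "\<lambda>x. x" UNIV n x, OF _ _ this]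
  show ?thesis
    by (simp add: operator_form_eq_E_UNIV[OF operator_on_layers_op[OF g]])
qed

lemma borel_measurable_layers:
  assumes [measurable]: "g \<in> borel_measurable borel"
  shows "layers g n \<in> borel_measurable borel"
  unfolding layers_def[abs_def] by measurable

lemma layers_op_symmetric:
  assumes [measurable]: "g \<in> borel_measurable borel"
  shows "inner (layers_op g n x) y = inner x (layers_op g n y)"
  by (simp add: layers_op_def inner_sum_left inner_sum_right E_sym_inner)

lemma pos_contraction_layers_op:
  assumes g: "g \<in> borel_measurable borel"
  shows "pos_contraction (layers_op g n)"
proof (rule pos_contraction.intro)
  fix x y
  interpret finite_measure "scalar_measure E x" by (rule finite_scalar_measure)
  show "bounded_linear (layers_op g n)"
    using operator_on_layers_op[OF g] by (simp add: operator_on_def)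
  show "inner (layers_op g n x) y = inner x (layers_op g n y)"
    by (rule layers_op_symmetric[OF g])
  show "0 \<le> inner (layers_op g n x) x"
    unfolding layers_op_quadratic_form[OF g] by (intro integral_nonneg_AE) (simp add: layers_bounds)
  have "integral\<^sup>L (scalar_measure E x) (layers g n) \<le> integral\<^sup>L (scalar_measure E x) (\<lambda>_. 1)"
    by (intro integral_mono integrable_const_bound[of _ 1])
       (use borel_measurable_layers[OF g] layers_bounds in \<open>simp_all add: abs_layers_le\<close>)
  then show "inner (layers_op g n x) x \<le> inner x x"
    using measure_scalar_measure_UNIV_le[of x] by (simp add: layers_op_quadratic_form[OF g])
qed

lemma layers_op_convergent:
  assumes g: "g \<in> borel_measurable borel" "\<And>z. 0 \<le> g z" "\<And>z. g z \<le> 1"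
  shows "convergent (\<lambda>n. layers_op g n x)"
proof -
  have close: "norm (layers_op g n x - layers_op g m x) \<le> (1 / real n + 1 / real m) * norm x"
    if nm: "0 < n" "0 < m" for n m
  proof (rule norm_le_if_form_le)
    let ?c = "1 / real n + 1 / real m"
    show "bounded_linear (\<lambda>x. layers_op g n x - layers_op g m x)"
      by (intro bounded_linear_sub pos_contraction.bounded_linear pos_contraction_layers_op g)
    fix x y
    interpret finite_measure "scalar_measure E x" by (rule finite_scalar_measure)
    show "inner (layers_op g n x - layers_op g m x) y = inner x (layers_op g n y - layers_op g m y)"
      by (simp add: inner_diff_left inner_diff_right layers_op_symmetric[OF g(1)])
    have int: "integrable (scalar_measure E x) (layers g k)" for k
      by (rule integrable_const_bound[of _ 1])
         (use borel_measurable_layers[OF g(1)] in \<open>simp_all add: abs_layers_le\<close>)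
    have "\<bar>inner (layers_op g n x - layers_op g m x) x\<bar>
        = \<bar>integral\<^sup>L (scalar_measure E x) (\<lambda>z. layers g n z - layers g m z)\<bar>"
      by (simp add: inner_diff_left layers_op_quadratic_form[OF g(1)] Bochner_Integration.integral_diff[OF int int])
    also have "\<dots> \<le> integral\<^sup>L (scalar_measure E x) (\<lambda>z. \<bar>layers g n z - layers g m z\<bar>)"
      by (rule integral_abs_bound)
    also have "\<dots> \<le> integral\<^sup>L (scalar_measure E x) (\<lambda>_. ?c)"
    proof (rule integral_mono)
      show "\<bar>layers g n z - layers g m z\<bar> \<le> ?c" for z
        using layers_approx[of g z n] layers_approx[of g z m] g(2,3)[of z] nm by linarith
      show "integrable (scalar_measure E x) (\<lambda>z. \<bar>layers g n z - layers g m z\<bar>)"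
        by (intro integrable_abs Bochner_Integration.integrable_diff int)
    qed simp
    also have "\<dots> = ?c * measure (scalar_measure E x) UNIV" by simp
    also have "\<dots> \<le> ?c * inner x x"
      by (intro mult_left_mono measure_scalar_measure_UNIV_le) simp
    finally show "\<bar>inner (layers_op g n x - layers_op g m x) x\<bar> \<le> ?c * inner x x" .
  next
    show "0 < 1 / real n + 1 / real m" using nm by (intro add_pos_pos) auto
  qed
  have "Cauchy (\<lambda>n. layers_op g n x)"
  proof (rule metric_CauchyI)
    fix e :: real assume "0 < e"
    then obtain d where d: "0 < d" "d * (2 * norm x) < e"
      using small_multiple[of "2 * norm x" e] by auto
    obtain N where N: "1 / real (Suc N) < d" using nat_approx_posE[OF d(1)] by blast
    have "dist (layers_op g m x) (layers_op g n x) < e" if "Suc N \<le> m" "Suc N \<le> n" for m n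
    proof -
      have "1 / real m \<le> 1 / real (Suc N)" "1 / real n \<le> 1 / real (Suc N)"
        using that by (intro divide_left_mono; simp)+
      then have "(1 / real m + 1 / real n) * norm x \<le> (d + d) * norm x"
        using N by (intro mult_right_mono) auto
      with close[of m n] that d(2) show ?thesis
        by (simp add: dist_norm algebra_simps)
    qed
    then show "\<exists>N. \<forall>m\<ge>N. \<forall>n\<ge>N. dist (layers_op g m x) (layers_op g n x) < e" by blast
  qed
  then show ?thesis by (simp add: Cauchy_convergent_iff)
qed

text \<open>The operators of the step functions below \<open>g\<close> converge in norm to an operator \<open>T\<close>. Since applying
  \<open>T\<close> multiplies densities by \<open>g\<close>, Horner's scheme identifies the forms of all polynomials in \<open>T\<close>, and
  uniform approximation those of all continuous functions. So integration against a
  projection-valued measure is compatible with the continuous calculus.\<close>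

theorem exists_integral_operator:
  assumes g: "g \<in> borel_measurable borel" "\<And>z. 0 \<le> g z" "\<And>z. g z \<le> 1"
  obtains T where "pos_contraction T" "operator_on M T"
    "\<And>F x. continuous_on {0..1} F \<Longrightarrow> x \<in> M \<Longrightarrow>
      inner (cont_calculus T F x) x = integral\<^sup>L (scalar_measure E x) (\<lambda>z. F (g z))"
proof -
  note [measurable] = g(1)
  interpret D: finite_measure "scalar_measure E y" for y by (rule finite_scalar_measure)
  define T where "T x = lim (\<lambda>n. layers_op g n x)" for x
  have T: "(\<lambda>n. layers_op g n x) \<longlonglongrightarrow> T x" for x
    using layers_op_convergent[OF g] unfolding T_def by (simp add: convergent_LIMSEQ_iff)
  interpret T: pos_contraction T
    by (rule pos_contraction_strong_limit[OF pos_contraction_layers_op[OF g(1)] T])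
  have op_layers: "layers_op g n (c *\<^sub>C x) = c *\<^sub>C layers_op g n x" "proj M (layers_op g n x) = layers_op g n x"
    "x \<in> orth_compl M \<Longrightarrow> layers_op g n x = 0" for n c x
    using operator_on_layers_op[OF g(1), of n] proj_id[OF operator_on_mem[OF operator_on_layers_op[OF g(1), of n]]]
    by (simp_all add: operator_on_def)
  have op: "operator_on M T"
    unfolding operator_on_def
  proof (intro conjI allI ballI)
    show "bounded_linear T" by (rule T.bounded_linear)
    show "T (c *\<^sub>C x) = c *\<^sub>C T x" for c x
    proof (rule LIMSEQ_unique[OF T])
      show "(\<lambda>n. layers_op g n (c *\<^sub>C x)) \<longlonglongrightarrow> c *\<^sub>C T x"
        unfolding op_layers by (rule bounded_linear.tendsto[OF bounded_linear_scaleC T])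
    qed
    have "proj M (T x) = T x" for x
    proof (rule LIMSEQ_unique[OF _ T])
      show "(\<lambda>n. layers_op g n x) \<longlonglongrightarrow> proj M (T x)"
        using bounded_linear.tendsto[OF bounded_linear_proj T[of x]] by (simp add: op_layers)
    qed
    then show "range T \<subseteq> M" by (auto simp: mem_iff_proj)
    show "T x = 0" if "x \<in> orth_compl M" for x
      using LIMSEQ_unique[OF T[of x]] op_layers(3)[OF that] by simp
  qed
  have step: "inner (E U (T (Y x))) x = integral\<^sup>L (scalar_measure E x) (\<lambda>z. indicator U z * (g z * h z))"
    if h [measurable]: "h \<in> borel_measurable borel" "\<And>z. \<bar>h z\<bar> \<le> c"
      and Y: "\<And>U x. U \<in> sets borel \<Longrightarrow>
        inner (E U (Y x)) x = integral\<^sup>L (scalar_measure E x) (\<lambda>z. indicator U z * h z)"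
      and U [measurable]: "U \<in> sets borel" for h c Y U x
  proof (rule LIMSEQ_unique)
    show "(\<lambda>n. inner (E U (layers_op g n (Y x))) x) \<longlonglongrightarrow> inner (E U (T (Y x))) x"
      by (intro tendsto_intros bounded_linear.tendsto[OF E_bounded_linear[OF U]] T)
    have eq: "inner (E U (layers_op g n (Y x))) x
        = integral\<^sup>L (scalar_measure E x) (\<lambda>z. indicator U z * (layers g n z * h z))" for n
      by (rule layers_op_form[OF g(1) h Y U])
    show "(\<lambda>n. inner (E U (layers_op g n (Y x))) x)
        \<longlonglongrightarrow> integral\<^sup>L (scalar_measure E x) (\<lambda>z. indicator U z * (g z * h z))"
      unfolding eq
    proof (rule integral_dominated_convergence[where w = "\<lambda>_. c"])
      note [measurable] = borel_measurable_layers[OF g(1)]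
      show "(\<lambda>z. indicator U z * (g z * h z)) \<in> borel_measurable (scalar_measure E x)"
        by simp
      show "(\<lambda>z. indicator U z * (layers g n z * h z)) \<in> borel_measurable (scalar_measure E x)" for n
        by simp
      have lim: "(\<lambda>n. layers g n z) \<longlonglongrightarrow> g z" for z
      proof (rule LIMSEQ_if_norm_le_mult[where K = 1])
        fix d :: real assume "0 < d"
        then obtain N where N: "1 / real (Suc N) < d" using nat_approx_posE by blast
        have "norm (layers g n z - g z) \<le> d * 1" if "Suc N \<le> n" for n
        proof -
          have "1 / real n \<le> 1 / real (Suc N)" using that by (intro divide_left_mono) auto
          then show ?thesis
            using layers_approx[of g z n] g(2,3)[of z] that N by simp
        qed
        then show "\<exists>N. \<forall>n\<ge>N. norm (layers g n z - g z) \<le> d * 1" by blast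
      qed simp
      show "AE z in scalar_measure E x. (\<lambda>n. indicator U z * (layers g n z * h z)) \<longlonglongrightarrow> indicator U z * (g z * h z)"
        by (intro AE_I2 tendsto_intros lim)
      have "norm (indicator U z * (layers g n z * h z)) \<le> c" for n z
      proof -
        have "\<bar>layers g n z\<bar> * \<bar>h z\<bar> \<le> 1 * c"
          using layers_bounds[of g n z] h(2)[of z] by (intro mult_mono) auto
        then show ?thesis
          using abs_ge_zero[THEN order_trans, OF h(2)] by (simp add: indicator_def abs_mult)
      qed
      then show "AE z in scalar_measure E x. norm (indicator U z * (layers g n z * h z)) \<le> c" for n by simp
    qed simp
  qed
  have poly: "inner (E U (poly_op T p x)) x = integral\<^sup>L (scalar_measure E x) (\<lambda>z. indicator U z * poly p (g z))"
    if U: "U \<in> sets borel" for U p x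
    using U
  proof (induction p arbitrary: U x)
    case 0
    then show ?case by (simp add: linear_0[OF E_linear])
  next
    case (pCons a p)
    note [measurable] = pCons.prems
    obtain c where c: "\<And>t. t \<in> {0..1} \<Longrightarrow> \<bar>poly p t\<bar> \<le> c"
      by (rule bounded_on_unit_interval[of "poly p"]) (auto intro: continuous_intros)
    have h: "(\<lambda>z. poly p (g z)) \<in> borel_measurable borel" "\<bar>poly p (g z)\<bar> \<le> c" for z
    proof -
      show "(\<lambda>z. poly p (g z)) \<in> borel_measurable borel"
        using measurable_compose[OF g(1) borel_measurable_continuous_onI[of "poly p"]]
        by (simp add: continuous_on_poly)
      show "\<bar>poly p (g z)\<bar> \<le> c" using c g(2,3) by simp
    qed
    note [measurable] = h(1)
    have c0: "0 \<le> c" using h(2)[of 0] by linarith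
    have bound: "\<bar>g z * poly p (g z)\<bar> \<le> c" for z
      using mult_mono[of "\<bar>g z\<bar>" 1 "\<bar>poly p (g z)\<bar>" c] g(2,3)[of z] h(2)[of z] by (simp add: abs_mult)
    have "inner (E U (poly_op T (pCons a p) x)) x = a * inner (E U x) x + inner (E U (T (poly_op T p x))) x"
      by (simp add: T.op_simps(7) linear_add[OF E_linear] linear_scale[OF E_linear] pCons.prems inner_add_left)
    also have "\<dots> = integral\<^sup>L (scalar_measure E x) (\<lambda>z. indicator U z * a)
        + integral\<^sup>L (scalar_measure E x) (\<lambda>z. indicator U z * (g z * poly p (g z)))"
      using step[OF h, of "poly_op T p" U x] pCons by (simp add: measure_scalar_measure mult.commute)
    also have "\<dots> = integral\<^sup>L (scalar_measure E x) (\<lambda>z. indicator U z * a + indicator U z * (g z * poly p (g z)))"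
      by (intro Bochner_Integration.integral_add[symmetric] D.integrable_const_bound[of _ "\<bar>a\<bar>"]
          D.integrable_const_bound[of _ "c"]) (use bound c0 in \<open>auto simp: indicator_def\<close>)
    finally show ?case by (simp add: distrib_left)
  qed
  have "inner (cont_calculus T F x) x = integral\<^sup>L (scalar_measure E x) (\<lambda>z. F (g z))"
    if F: "continuous_on {0..1} F" and x: "x \<in> M" for F x
  proof (rule LIMSEQ_unique)
    show "(\<lambda>n. inner (poly_op T (bernstein_poly n F) x) x) \<longlonglongrightarrow> inner (cont_calculus T F x) x"
      by (intro tendsto_intros T.tendsto_cont_calculus F)
    have "inner (poly_op T (bernstein_poly n F) x) x
        = integral\<^sup>L (scalar_measure E x) (\<lambda>z. poly (bernstein_poly n F) (g z))" for n
      using poly[of UNIV "bernstein_poly n F" x] by (simp add: E_UNIV inner_proj_symmetric proj_id[OF x])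
    moreover obtain c where c: "\<And>t. t \<in> {0..1} \<Longrightarrow> \<bar>F t\<bar> \<le> c"
      using bounded_on_unit_interval[OF F] by blast
    have lim: "(\<lambda>n. poly (bernstein_poly n F) (g z)) \<longlonglongrightarrow> F (g z)" for z
    proof (rule LIMSEQ_if_norm_le_mult[where K = 1])
      fix d :: real assume "0 < d"
      from bernstein_poly_uniform[OF F this] obtain N where N: "\<And>n t. N \<le> n \<Longrightarrow> 0 \<le> t \<Longrightarrow> t \<le> 1 \<Longrightarrow>
          \<bar>F t - poly (bernstein_poly n F) t\<bar> < d" by blast
      have "norm (poly (bernstein_poly n F) (g z) - F (g z)) \<le> d * 1" if "N \<le> n" for n
        using N[OF that g(2,3), of z] by simp
      then show "\<exists>N. \<forall>n\<ge>N. norm (poly (bernstein_poly n F) (g z) - F (g z)) \<le> d * 1" by blast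
    qed simp
    have meas: "(\<lambda>z. poly (bernstein_poly n F) (g z)) \<in> borel_measurable borel" for n
      using measurable_compose[OF g(1) borel_measurable_continuous_onI[of "poly (bernstein_poly n F)"]]
      by (simp add: continuous_on_poly)
    have "(\<lambda>n. integral\<^sup>L (scalar_measure E x) (\<lambda>z. poly (bernstein_poly n F) (g z)))
        \<longlonglongrightarrow> integral\<^sup>L (scalar_measure E x) (\<lambda>z. F (g z))"
    proof (rule integral_dominated_convergence[where w = "\<lambda>_. c"])
      show "(\<lambda>z. F (g z)) \<in> borel_measurable (scalar_measure E x)"
        using borel_measurable_LIMSEQ_real[OF lim meas] by simp
      show "AE z in scalar_measure E x. (\<lambda>n. poly (bernstein_poly n F) (g z)) \<longlonglongrightarrow> F (g z)"
        by (intro AE_I2 lim)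
      show "AE z in scalar_measure E x. norm (poly (bernstein_poly n F) (g z)) \<le> c" for n
        using abs_bernstein_poly_le[of F c _ n] c g(2,3) by (intro AE_I2) simp
    qed (use meas in simp_all)
    ultimately show "(\<lambda>n. inner (poly_op T (bernstein_poly n F) x) x)
        \<longlonglongrightarrow> integral\<^sup>L (scalar_measure E x) (\<lambda>z. F (g z))"
      by simp
  qed
  then show ?thesis using that[OF T.pos_contraction_axioms op] by blast
qed

end

section \<open>Complex-valued functions of a positive contraction\<close>

definition unit_clamp :: "real \<Rightarrow> real" where
  "unit_clamp t = max 0 (min 1 t)"

lemma unit_clamp_mem: "unit_clamp t \<in> {0..1}"
  by (simp add: unit_clamp_def)

lemma unit_clamp_id: "0 \<le> t \<Longrightarrow> t \<le> 1 \<Longrightarrow> unit_clamp t = t"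
  by (simp add: unit_clamp_def)

lemma continuous_on_unit_clamp:
  assumes "continuous_on {0..1} g"
  shows "continuous_on UNIV (\<lambda>t. g (unit_clamp t))"
proof (rule continuous_on_compose2[OF assms])
  show "continuous_on UNIV unit_clamp"
    unfolding unit_clamp_def[abs_def] by (intro continuous_intros)
qed (use unit_clamp_mem in auto)

lemma bounded_unit_clamp:
  fixes g :: "real \<Rightarrow> 'b::real_normed_vector"
  assumes "continuous_on {0..1} g"
  shows "bounded (range (\<lambda>t. g (unit_clamp t)))"
proof (rule bounded_subset)
  show "bounded (g ` {0..1})"
    using assms by (intro compact_imp_bounded compact_continuous_image) auto
qed (use unit_clamp_mem in auto)

context pos_contraction
begin

lemma integral_unit_clamp:
  assumes "continuous_on {0..1} g"
  shows "integral\<^sup>L (spectral_dist R x) (\<lambda>t. g (unit_clamp t)) = inner (cont_calculus R g x) x"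
proof -
  have "cont_calculus R (\<lambda>t. g (unit_clamp t)) = cont_calculus R g"
    by (rule cont_calculus_cong) (simp add: unit_clamp_id)
  then show ?thesis
    by (simp add: integral_spectral_dist continuous_on_unit_clamp bounded_unit_clamp assms)
qed

lemma norm_cont_calculus_unit_clamp:
  assumes "continuous_on {0..1} g"
  shows "(norm (cont_calculus R g x))\<^sup>2 = integral\<^sup>L (spectral_dist R x) (\<lambda>t. (g (unit_clamp t))\<^sup>2)"
proof -
  have "cont_calculus R (\<lambda>t. g (unit_clamp t)) = cont_calculus R g"
    by (rule cont_calculus_cong) (simp add: unit_clamp_id)
  then show ?thesis
    using norm_cont_calculus_eq_integral[OF continuous_on_unit_clamp bounded_unit_clamp, OF assms assms, of x]
    by simp
qed

end

definition complex_calculus :: "('a::complex_inner \<Rightarrow> 'a) \<Rightarrow> (real \<Rightarrow> complex) \<Rightarrow> 'a \<Rightarrow> 'a" where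
  "complex_calculus R h x =
     cont_calculus R (\<lambda>t. Re (h t)) x + \<i> *\<^sub>C cont_calculus R (\<lambda>t. Im (h t)) x"

lemma ball_diff_dist_subset: "ball w (r - dist z w) \<subseteq> ball z r"
proof
  fix x assume "x \<in> ball w (r - dist z w)"
  then show "x \<in> ball z r" using dist_triangle[of z x w] by simp
qed

lemma integral_complex_eq:
  assumes "integrable M f"
  shows "integral\<^sup>L M f = Complex (integral\<^sup>L M (\<lambda>x. Re (f x))) (integral\<^sup>L M (\<lambda>x. Im (f x)))"
  using assms by (simp add: complex_eq_iff)

locale complex_contraction = pos_contraction R for R :: "'a::chilbert_space \<Rightarrow> 'a" +
  assumes complex_linear: "complex_linear R"
begin

lemma cont_calculus_i:
  "continuous_on {0..1} g \<Longrightarrow> cont_calculus R g (\<i> *\<^sub>C x) = \<i> *\<^sub>C cont_calculus R g x"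
  using cont_calculus_commute[of g "\<lambda>x. \<i> *\<^sub>C x" x] complex_linear
  by (simp add: bounded_linear_scaleC complex_linear_def)

lemma complex_linear_cont_calculus:
  assumes "continuous_on {0..1} g"
  shows "complex_linear (cont_calculus R g)"
  by (rule complex_linearI[OF linear_cont_calculus cont_calculus_i]) (fact assms)+

lemma continuous_Re_Im:
  assumes "continuous_on {0..1::real} h"
  shows "continuous_on {0..1} (\<lambda>t. Re (h t))" "continuous_on {0..1} (\<lambda>t. Im (h t))"
  by (intro continuous_intros assms)+

lemma complex_calculus_form:
  assumes h: "continuous_on {0..1} h"
  shows "cinner (complex_calculus R h x) x =
    Complex (inner (cont_calculus R (\<lambda>t. Re (h t)) x) x) (inner (cont_calculus R (\<lambda>t. Im (h t)) x) x)"
proof -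
  note h' = continuous_Re_Im[OF h]
  have "cinner (cont_calculus R g x) x = complex_of_real (inner (cont_calculus R g x) x)"
    if "continuous_on {0..1} g" for g
    using that by (intro cinner_symmetric_form complex_linear_cont_calculus cont_calculus_symmetric)
  then show ?thesis
    using h' by (simp add: complex_calculus_def cinner_add_left cinner_scaleC_left complex_eq_iff)
qed

lemma complex_calculus_form_integral:
  assumes h: "continuous_on {0..1} h"
  shows "cinner (complex_calculus R h x) x = integral\<^sup>L (spectral_dist R x) (\<lambda>t. h (unit_clamp t))"
proof -
  interpret finite_measure "spectral_dist R x" by (rule finite_measure_spectral_dist)
  obtain B where B: "\<And>t. norm (h (unit_clamp t)) \<le> B"
    using bounded_unit_clamp[OF h] by (auto simp: bounded_iff)
  have "integrable (spectral_dist R x) (\<lambda>t. h (unit_clamp t))"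
    by (rule integrable_const_bound[of _ B])
       (use B borel_measurable_continuous_onI[OF continuous_on_unit_clamp[OF h]] in simp_all)
  then show ?thesis
    unfolding complex_calculus_form[OF h] integral_unit_clamp[OF continuous_Re_Im(1)[OF h], symmetric]
      integral_unit_clamp[OF continuous_Re_Im(2)[OF h], symmetric]
    by (rule integral_complex_eq[symmetric])
qed

lemma bounded_linear_complex_calculus:
  assumes "continuous_on {0..1} h"
  shows "bounded_linear (complex_calculus R h)"
  unfolding complex_calculus_def[abs_def]
  by (intro bounded_linear_add bounded_linear_compose[OF bounded_linear_scaleC]
      bounded_linear_cont_calculus continuous_Re_Im assms)

lemma complex_linear_complex_calculus:
  assumes "continuous_on {0..1} h"
  shows "complex_calculus R h (c *\<^sub>C x) = c *\<^sub>C complex_calculus R h x"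
  using complex_linear_cont_calculus[OF continuous_Re_Im(1)[OF assms]]
    complex_linear_cont_calculus[OF continuous_Re_Im(2)[OF assms]]
  by (simp add: complex_calculus_def complex_linear_def scaleC_add_right scaleC_scaleC mult.commute)

lemma complex_calculus_mult:
  assumes h: "continuous_on {0..1} h" and k: "continuous_on {0..1} k"
  shows "complex_calculus R (\<lambda>t. h t * k t) x = complex_calculus R h (complex_calculus R k x)"
proof -
  note c = continuous_Re_Im[OF h] continuous_Re_Im[OF k]
  note m = continuous_on_mult[OF c(1) c(3)] continuous_on_mult[OF c(2) c(4)]
    continuous_on_mult[OF c(1) c(4)] continuous_on_mult[OF c(2) c(3)]
  have "\<i> *\<^sub>C \<i> *\<^sub>C y = - y" for y :: 'a
    using scaleC_of_real[of "-1" y] by (simp add: scaleC_scaleC)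
  then show ?thesis
    by (simp add: complex_calculus_def cont_calculus_diff[OF m(1,2)] cont_calculus_add[OF m(3,4)]
        cont_calculus_mult[OF c(1) c(3)] cont_calculus_mult[OF c(2) c(4)]
        cont_calculus_mult[OF c(1) c(4)] cont_calculus_mult[OF c(2) c(3)]
        linear_add[OF linear_cont_calculus[OF c(1)]] linear_add[OF linear_cont_calculus[OF c(2)]]
        cont_calculus_i[OF c(1)] cont_calculus_i[OF c(2)] scaleC_add_right)
qed

text \<open>The real and the imaginary part contribute orthogonal vectors: a symmetric complex-linear \<open>S\<close>
  satisfies \<open>\<langle>x, \<i> S x\<rangle> = 0\<close> for the real inner product.\<close>

lemma norm_complex_calculus:
  assumes h: "continuous_on {0..1} h"
  shows "(norm (complex_calculus R h x))\<^sup>2 =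
    (norm (cont_calculus R (\<lambda>t. Re (h t)) x))\<^sup>2 + (norm (cont_calculus R (\<lambda>t. Im (h t)) x))\<^sup>2"
proof -
  note c = continuous_Re_Im[OF h]
  define a b where "a = cont_calculus R (\<lambda>t. Re (h t)) x" and "b = cont_calculus R (\<lambda>t. Im (h t)) x"
  define s where "s = cont_calculus R (\<lambda>t. Re (h t) * Im (h t)) x"
  have cs: "continuous_on {0..1} (\<lambda>t. Re (h t) * Im (h t))" by (intro continuous_on_mult c)
  have "inner a (\<i> *\<^sub>C b) = inner x (cont_calculus R (\<lambda>t. Re (h t)) (\<i> *\<^sub>C b))"
    unfolding a_def by (rule cont_calculus_symmetric[OF c(1)])
  also have "cont_calculus R (\<lambda>t. Re (h t)) (\<i> *\<^sub>C b) = \<i> *\<^sub>C s"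
    by (simp add: b_def s_def cont_calculus_i[OF c(1)] cont_calculus_mult[OF c])
  finally have 1: "inner a (\<i> *\<^sub>C b) = inner x (\<i> *\<^sub>C s)" .
  have "inner x (\<i> *\<^sub>C s) = - inner (\<i> *\<^sub>C x) s" by (simp add: inner_i_left)
  also have "inner (\<i> *\<^sub>C x) s = inner (cont_calculus R (\<lambda>t. Re (h t) * Im (h t)) (\<i> *\<^sub>C x)) x"
    unfolding s_def by (rule cont_calculus_symmetric[OF cs, symmetric])
  also have "\<dots> = inner x (\<i> *\<^sub>C s)"
    by (simp add: s_def cont_calculus_i[OF cs] inner_commute)
  finally have "inner x (\<i> *\<^sub>C s) = 0" by simp
  then have "inner a (\<i> *\<^sub>C b) = 0" by (simp add: 1)
  then have "inner (a + \<i> *\<^sub>C b) (a + \<i> *\<^sub>C b) = inner a a + inner b b"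
    by (simp add: inner_add_left inner_add_right inner_i_i inner_commute[of "\<i> *\<^sub>C b" a])
  then show ?thesis
    by (simp only: power2_norm_eq_inner complex_calculus_def a_def b_def)
qed

end

section \<open>Spectral measures of the normal operator \<open>R + \<i> (1 - R)\<close>\<close>

text \<open>On \<open>M\<close> the normal operator \<open>R + \<i> (1 - R)\<close> is the image of \<open>R\<close> under this parametrization of the
  segment from \<open>\<i>\<close> to \<open>1\<close>, so its spectral measure is the image of that of \<open>R\<close>.\<close>

definition segment_point :: "real \<Rightarrow> complex" where
  "segment_point t = Complex t (1 - t)"

lemma continuous_on_segment_point: "continuous_on S segment_point"
  unfolding segment_point_def[abs_def] by (intro continuous_intros continuous_on_Complex)

lemma measurable_segment_point [measurable]: "segment_point \<in> borel_measurable borel"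
  by (rule borel_measurable_continuous_onI[OF continuous_on_segment_point])

locale reduced_contraction = proj_subspace M + pos_contraction R
  for M :: "'a::chilbert_space set" and R :: "'a \<Rightarrow> 'a" +
  assumes op: "operator_on M R"
begin

sublocale complex_contraction R
  by unfold_locales (use op in \<open>simp add: operator_on_def complex_linear_def\<close>)

definition normal_op :: "'a \<Rightarrow> 'a" where
  "normal_op x = R x + \<i> *\<^sub>C (proj M x - R x)"

lemma R_proj: "R (proj M x) = R x" and proj_R: "proj M (R x) = R x"
  using operator_on_apply_proj[OF op] proj_id[OF operator_on_mem[OF op]] by simp_all

lemma cont_calculus_proj:
  "continuous_on {0..1} g \<Longrightarrow> proj M (cont_calculus R g x) = cont_calculus R g (proj M x)"
  by (rule cont_calculus_commute) (simp_all add: bounded_linear_proj R_proj proj_R)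

lemma complex_calculus_proj:
  "continuous_on {0..1} h \<Longrightarrow> proj M (complex_calculus R h x) = complex_calculus R h (proj M x)"
  by (simp add: complex_calculus_def proj_add proj_scaleC cont_calculus_proj continuous_Re_Im)

lemma operator_on_complex_calculus:
  assumes h: "continuous_on {0..1} h"
  shows "operator_on M (\<lambda>x. complex_calculus R h (proj M x))"
  unfolding operator_on_def
proof (intro conjI allI ballI)
  show "bounded_linear (\<lambda>x. complex_calculus R h (proj M x))"
    by (rule bounded_linear_compose[OF bounded_linear_complex_calculus[OF h] bounded_linear_proj])
  show "complex_calculus R h (proj M (c *\<^sub>C x)) = c *\<^sub>C complex_calculus R h (proj M x)" for c x
    by (simp add: proj_scaleC complex_linear_complex_calculus[OF h])
  show "range (\<lambda>x. complex_calculus R h (proj M x)) \<subseteq> M"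
    by (auto simp: proj_mem simp flip: complex_calculus_proj[OF h])
  show "complex_calculus R h (proj M x) = 0" if "x \<in> orth_compl M" for x
    by (simp add: proj_orth_compl[OF that]
        linear_0[OF bounded_linear.linear[OF bounded_linear_complex_calculus[OF h]]])
qed

lemma normal_op_eq_complex_calculus:
  assumes "x \<in> M"
  shows "normal_op x - z *\<^sub>C x = complex_calculus R (\<lambda>t. segment_point t - z) x"
proof -
  have "complex_calculus R (\<lambda>t. segment_point t - z) x
      = (R x - Re z *\<^sub>R x) + \<i> *\<^sub>C ((x - R x) - Im z *\<^sub>R x)"
    by (simp add: complex_calculus_def segment_point_def cont_calculus_diff cont_calculus_const cont_calculus_id
        continuous_intros)
  then show ?thesis
    by (simp add: normal_op_def proj_id[OF assms] scaleC_eq[of z] scaleC_diff_right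
        scaleC_add_right scaleC_scaleR_commute algebra_simps)
qed

lemma operator_on_normal_op: "operator_on M normal_op"
  unfolding normal_op_def[abs_def]
  by (intro operator_on_add operator_on_scaleC operator_on_diff op operator_on_proj)

definition segment_measure :: "complex set \<Rightarrow> 'a \<Rightarrow> 'a" where
  "segment_measure U x = proj M (spectral_proj R (segment_point -` U) x)"

lemma preimage_borel: "U \<in> sets borel \<Longrightarrow> segment_point -` U \<in> sets borel"
  using measurable_sets[OF measurable_segment_point, of U] by simp

lemma
  assumes U: "U \<in> sets borel"
  shows spectral_proj_proj: "proj M (spectral_proj R U x) = spectral_proj R U (proj M x)"
    and spectral_proj_i: "spectral_proj R U (\<i> *\<^sub>C x) = \<i> *\<^sub>C spectral_proj R U x"
  using double_commutant_spectral_proj[OF U] bounded_linear_proj bounded_linear_scaleC[of \<i>]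
    complex_linear unfolding double_commutant_def complex_linear_def
  by (auto simp: R_proj proj_R)

lemma pvm_segment_measure: "projection_valued_measure_on M segment_measure"
  unfolding projection_valued_measure_on_def
proof (intro conjI ballI allI impI)
  fix U :: "complex set" assume "U \<in> sets borel"
  then have U: "segment_point -` U \<in> sets borel" by (rule preimage_borel)
  interpret U: pos_contraction "spectral_proj R (segment_point -` U)"
    by (rule pos_contraction_spectral_proj[OF U])
  have clin: "complex_linear (spectral_proj R (segment_point -` U))"
    by (rule complex_linearI[OF U.linear spectral_proj_i[OF U]])
  show "operator_on M (segment_measure U)"
    unfolding operator_on_def segment_measure_def[abs_def]
  proof (intro conjI allI ballI)
    show "bounded_linear (\<lambda>x. proj M (spectral_proj R (segment_point -` U) x))"
      by (rule bounded_linear_compose[OF bounded_linear_proj U.bounded_linear])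
    show "proj M (spectral_proj R (segment_point -` U) (c *\<^sub>C x))
        = c *\<^sub>C proj M (spectral_proj R (segment_point -` U) x)" for c x
      using clin by (simp add: complex_linear_def proj_scaleC)
    show "range (\<lambda>x. proj M (spectral_proj R (segment_point -` U) x)) \<subseteq> M"
      using proj_mem by auto
    show "proj M (spectral_proj R (segment_point -` U) x) = 0" if "x \<in> orth_compl M" for x
      by (simp add: spectral_proj_proj[OF U] proj_orth_compl[OF that] linear_0[OF U.linear])
  qed
  show "segment_measure U \<circ> segment_measure U = segment_measure U"
    by (simp add: fun_eq_iff segment_measure_def spectral_proj_proj[OF U] proj_idem spectral_proj_idem[OF U])
  show "cinner (segment_measure U x) y = cinner x (segment_measure U y)" for x y
    unfolding segment_measure_def cinner_proj_symmetric cinner_symmetric[OF clin U.symmetric]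
      spectral_proj_proj[OF U] ..
next
  fix U V :: "complex set" assume "U \<in> sets borel" "V \<in> sets borel"
  then have UV: "segment_point -` U \<in> sets borel" "segment_point -` V \<in> sets borel"
    by (simp_all add: preimage_borel)
  show "segment_measure (U \<inter> V) = segment_measure U \<circ> segment_measure V"
    by (simp add: fun_eq_iff segment_measure_def spectral_proj_proj[OF UV(1)] spectral_proj_proj[OF UV(2)]
        proj_idem spectral_proj_Int[OF UV])
next
  show "segment_measure UNIV = proj M"
    by (simp add: fun_eq_iff segment_measure_def spectral_proj_UNIV)
next
  fix F :: "nat \<Rightarrow> complex set" and x
  assume F: "range F \<subseteq> sets borel" "disjoint_family F"
  have "(\<lambda>n. spectral_proj R (segment_point -` F n) x) sums spectral_proj R (\<Union>n. segment_point -` F n) x"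
    by (rule spectral_proj_sums) (use F in \<open>auto simp: preimage_borel disjoint_family_on_def\<close>)
  then show "(\<lambda>n. segment_measure (F n) x) sums segment_measure (\<Union>n. F n) x"
    unfolding segment_measure_def vimage_Union[symmetric]
    by (intro bounded_linear.sums[OF bounded_linear_proj]) (simp add: vimage_UN)
qed

sublocale segment: pvm M segment_measure
  by unfold_locales (rule pvm_segment_measure)

lemma scalar_segment_measure:
  assumes x: "x \<in> M"
  shows "scalar_measure segment_measure x = distr (spectral_dist R x) borel segment_point"
proof (rule measure_eqI)
  fix U :: "complex set" assume "U \<in> sets (scalar_measure segment_measure x)"
  then have U: "U \<in> sets borel" by simp
  interpret finite_measure "spectral_dist R x" by (rule finite_measure_spectral_dist)
  have "inner (segment_measure U x) x = measure (spectral_dist R x) (segment_point -` U)"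
    by (simp add: segment_measure_def inner_proj_symmetric proj_id[OF x] spectral_proj_form preimage_borel[OF U])
  then show "emeasure (scalar_measure segment_measure x) U
      = emeasure (distr (spectral_dist R x) borel segment_point) U"
    using U by (simp add: segment.emeasure_scalar_measure emeasure_distr emeasure_eq_measure)
qed simp

definition spectrally_null :: "complex set \<Rightarrow> bool" where
  "spectrally_null U \<longleftrightarrow> (\<forall>x. segment_measure U x = 0)"

lemma spectrally_nullD:
  assumes "spectrally_null U" "U \<in> sets borel" "x \<in> M"
  shows "AE t in spectral_dist R x. segment_point t \<notin> U"
proof -
  interpret finite_measure "spectral_dist R x" by (rule finite_measure_spectral_dist)
  have "inner (segment_measure U x) x = measure (spectral_dist R x) (segment_point -` U)"
    by (simp add: segment_measure_def inner_proj_symmetric proj_id[OF assms(3)] spectral_proj_form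
        preimage_borel[OF assms(2)])
  then have "emeasure (spectral_dist R x) (segment_point -` U) = 0"
    using assms(1) by (simp add: spectrally_null_def emeasure_eq_measure)
  then show ?thesis
    by (intro AE_I[where N = "segment_point -` U"]) (auto simp: preimage_borel[OF assms(2)])
qed

lemma spectrally_nullI:
  assumes U: "U \<in> sets borel" and "\<And>x. x \<in> M \<Longrightarrow> emeasure (scalar_measure segment_measure x) U = 0"
  shows "spectrally_null U"
  unfolding spectrally_null_def
proof
  fix x
  have "segment_measure U (proj M x) = segment_measure U x"
    by (rule operator_on_apply_proj[OF segment.E_op[OF U]])
  moreover have "inner (segment_measure U (proj M x)) (proj M x) = 0"
    using assms(2)[OF proj_mem[of x]] segment.E_form_nonneg[OF U, of "proj M x"]
    by (simp add: segment.emeasure_scalar_measure[OF U])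
  then have "inner (segment_measure U (proj M x)) (segment_measure U (proj M x)) = 0"
    using segment.E_sym_inner[OF U, of "segment_measure U (proj M x)" "proj M x"]
    by (simp add: segment.E_idem[OF U])
  ultimately show "segment_measure U x = 0" by simp
qed

lemma spectrally_null_subset:
  assumes "spectrally_null U" "V \<subseteq> U" "U \<in> sets borel" "V \<in> sets borel"
  shows "spectrally_null V"
proof -
  have "segment_measure V x = segment_measure V (segment_measure U x)" for x
    using segment.E_Int[OF assms(4,3), of x] assms(2) by (simp add: Int_absorb2)
  then show ?thesis
    using assms(1) linear_0[OF segment.E_linear[OF assms(4)]] by (simp add: spectrally_null_def)
qed

text \<open>If the spectral measure vanishes near \<open>z\<close>, then \<open>1 / (w - z)\<close> can be changed near \<open>z\<close> to a
  continuous function, which gives the inverse.\<close>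

lemma not_in_spectrum_if_null_ball:
  assumes r: "0 < r" and null: "spectrally_null (ball z r)"
  shows "z \<notin> spectrum_on M normal_op"
proof -
  define d where "d t = segment_point t - z" for t
  define m where "m t = max ((cmod (d t))\<^sup>2) (r\<^sup>2)" for t
  have m: "0 < m t" for t using r by (simp add: m_def less_max_iff_disj)
  define k where "k t = cnj (d t) / complex_of_real (m t)" for t
  have cd: "continuous_on S d" for S
    unfolding d_def[abs_def] by (intro continuous_intros continuous_on_segment_point)
  have cm: "continuous_on S m" for S
    unfolding m_def[abs_def] by (intro continuous_intros cd)
  have m0: "m t \<noteq> 0" for t using m[of t] by simp
  have ck: "continuous_on S k" for S
    unfolding k_def[abs_def]
    by (intro continuous_on_divide continuous_on_cnj continuous_on_of_real cd cm) (simp add: m0)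
  \<comment> \<open>The error of \<open>k\<close> as an inverse of \<open>d\<close>, supported in the null ball.\<close>
  define v where "v t = (cmod (d t))\<^sup>2 / m t - 1" for t
  have cv: "continuous_on S v" for S
    unfolding v_def[abs_def]
    by (intro continuous_on_diff continuous_on_divide continuous_on_power continuous_on_norm
        continuous_on_const cd cm) (simp add: m0)
  have kd: "k t * d t = complex_of_real (1 + v t)" for t
  proof -
    have "complex_of_real (1 + v t) = complex_of_real ((cmod (d t))\<^sup>2) / complex_of_real (m t)"
      unfolding v_def by simp
    then show ?thesis
      unfolding complex_norm_square by (simp add: k_def mult.commute)
  qed
  have v0: "v t = 0" if "segment_point t \<notin> ball z r" for t
  proof -
    have "r \<le> cmod (d t)" using that by (simp add: d_def dist_norm norm_minus_commute)
    then have "r\<^sup>2 \<le> (cmod (d t))\<^sup>2" using r by (intro power_mono) auto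
    then have "m t = (cmod (d t))\<^sup>2" by (simp add: m_def)
    then show ?thesis using m[of t] by (simp add: v_def)
  qed
  have vx: "cont_calculus R v x = 0" if x: "x \<in> M" for x
  proof -
    have "AE t in spectral_dist R x. segment_point t \<notin> ball z r"
      by (rule spectrally_nullD[OF null _ x]) simp
    with AE_spectral_dist have "AE t in spectral_dist R x. (v (unit_clamp t))\<^sup>2 = 0"
    proof eventually_elim
      case (elim t)
      then show ?case using v0[of t] by (simp add: unit_clamp_id)
    qed
    then have "integral\<^sup>L (spectral_dist R x) (\<lambda>t. (v (unit_clamp t))\<^sup>2) = 0"
      by (rule integral_eq_zero_AE)
    then show ?thesis
      using norm_cont_calculus_unit_clamp[OF cv, of x] by simp
  qed
  have id: "complex_calculus R (\<lambda>t. complex_of_real (1 + v t)) x = x" if x: "x \<in> M" for x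
    using vx[OF x] cv
    by (simp add: complex_calculus_def cont_calculus_const cont_calculus_add continuous_intros)
  have N: "normal_op x - z *\<^sub>C x = complex_calculus R d x" if "x \<in> M" for x
    using normal_op_eq_complex_calculus[OF that] by (simp add: d_def[abs_def])
  define Q where "Q x = complex_calculus R k (proj M x)" for x
  have Q: "operator_on M Q"
    unfolding Q_def[abs_def] by (rule operator_on_complex_calculus[OF ck])
  have "Q (normal_op x - z *\<^sub>C x) = x \<and> normal_op (Q x) - z *\<^sub>C Q x = x" if x: "x \<in> M" for x
  proof
    have "complex_calculus R d x \<in> M"
      using N[OF x] operator_on_mem[OF operator_on_normal_op] x by (metis diff_mem scaleC_mem)
    then have "Q (normal_op x - z *\<^sub>C x) = complex_calculus R (\<lambda>t. k t * d t) x"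
      by (simp add: Q_def N[OF x] proj_id complex_calculus_mult[OF ck cd])
    then show "Q (normal_op x - z *\<^sub>C x) = x"
      by (simp only: kd id[OF x])
    have "normal_op (Q x) - z *\<^sub>C Q x = complex_calculus R (\<lambda>t. d t * k t) x"
      using N[OF operator_on_mem[OF Q], of x] by (simp add: Q_def proj_id[OF x] complex_calculus_mult[OF cd ck])
    then show "normal_op (Q x) - z *\<^sub>C Q x = x"
      by (simp only: mult.commute[of "d _"] kd id[OF x])
  qed
  then show ?thesis unfolding spectrum_on_def using Q by blast
qed

text \<open>On the range of the projection for a ball of radius \<open>r\<close> the operator differs from \<open>z\<close> by at most \<open>r\<close>.
  For small \<open>r\<close> this contradicts a bounded inverse, unless the range is zero.\<close>

lemma null_ball_if_not_in_spectrum: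
  assumes "z \<notin> spectrum_on M normal_op"
  shows "\<exists>r>0. spectrally_null (ball z r)"
proof -
  obtain Q where Q: "operator_on M Q" "\<And>x. x \<in> M \<Longrightarrow> Q (normal_op x - z *\<^sub>C x) = x"
    using assms unfolding spectrum_on_def by blast
  have "bounded_linear Q" using Q(1) by (simp add: operator_on_def)
  from bounded_linear.pos_bounded[OF this] obtain C where C: "0 < C" "\<And>x. norm (Q x) \<le> norm x * C"
    by blast
  define r where "r = 1 / (2 * C)"
  have r: "0 < r" using C by (simp add: r_def)
  have "segment_measure (ball z r) x = 0" for x
  proof -
    define y where "y = segment_measure (ball z r) x"
    interpret finite_measure "spectral_dist R y" by (rule finite_measure_spectral_dist)
    have y: "y \<in> M" unfolding y_def segment_measure_def by (rule proj_mem)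
    define d where "d t = segment_point t - z" for t
    have cd: "continuous_on S d" for S
      unfolding d_def[abs_def] by (intro continuous_intros continuous_on_segment_point)
    note c = continuous_Re_Im[OF cd]
    have meas: "(\<lambda>t. g (unit_clamp t)) \<in> borel_measurable borel" if "continuous_on {0..1} g" for g :: "real \<Rightarrow> real"
      by (rule borel_measurable_continuous_onI[OF continuous_on_unit_clamp[OF that]])
    have bdd: "integrable (spectral_dist R y) (\<lambda>t. g (unit_clamp t))" if g: "continuous_on {0..1} g" for g :: "real \<Rightarrow> real"
    proof -
      obtain B where "\<And>t. norm (g (unit_clamp t)) \<le> B"
        using bounded_unit_clamp[OF g] by (auto simp: bounded_iff)
      then show ?thesis
        by (intro integrable_const_bound[of _ B]) (use meas[OF g] in simp_all)
    qed
    have i1: "integrable (spectral_dist R y) (\<lambda>t. (Re (d (unit_clamp t)))\<^sup>2)"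
      by (rule bdd[where g = "\<lambda>t. (Re (d t))\<^sup>2"]) (intro continuous_on_power c)
    have i2: "integrable (spectral_dist R y) (\<lambda>t. (Im (d (unit_clamp t)))\<^sup>2)"
      by (rule bdd[where g = "\<lambda>t. (Im (d t))\<^sup>2"]) (intro continuous_on_power c)
    have AE_ball: "AE t in spectral_dist R y. segment_point t \<in> ball z r"
    proof -
      have B: "segment_point -` ball z r \<in> sets borel" by (rule preimage_borel) simp
      then have nB: "- (segment_point -` ball z r) \<in> sets borel" by simp
      have "spectral_proj R (- (segment_point -` ball z r)) y = 0"
        using spectral_proj_disjoint[OF B nB]
        by (simp add: y_def segment_measure_def spectral_proj_proj[OF B] flip: spectral_proj_proj[OF nB])
      then have "emeasure (spectral_dist R y) (- (segment_point -` ball z r)) = 0"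
        using spectral_proj_form[OF nB, of y] by (simp add: emeasure_eq_measure)
      then show ?thesis
        by (intro AE_I[where N = "- (segment_point -` ball z r)"]) (use nB in auto)
    qed
    have "(norm (normal_op y - z *\<^sub>C y))\<^sup>2 = integral\<^sup>L (spectral_dist R y)
        (\<lambda>t. (Re (d (unit_clamp t)))\<^sup>2 + (Im (d (unit_clamp t)))\<^sup>2)"
    proof -
      have "normal_op y - z *\<^sub>C y = complex_calculus R d y"
        using normal_op_eq_complex_calculus[OF y] by (simp add: d_def[abs_def])
      then show ?thesis
        by (simp add: norm_complex_calculus[OF cd] norm_cont_calculus_unit_clamp[OF c(1)]
            norm_cont_calculus_unit_clamp[OF c(2)] Bochner_Integration.integral_add[OF i1 i2])
    qed
    also have "\<dots> \<le> integral\<^sup>L (spectral_dist R y) (\<lambda>_. r\<^sup>2)"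
    proof (rule integral_mono_AE)
      show "integrable (spectral_dist R y) (\<lambda>t. (Re (d (unit_clamp t)))\<^sup>2 + (Im (d (unit_clamp t)))\<^sup>2)"
        by (rule Bochner_Integration.integrable_add[OF i1 i2])
      show "AE t in spectral_dist R y. (Re (d (unit_clamp t)))\<^sup>2 + (Im (d (unit_clamp t)))\<^sup>2 \<le> r\<^sup>2"
        using AE_spectral_dist AE_ball
      proof eventually_elim
        case (elim t)
        then have "cmod (d t) \<le> r" by (simp add: d_def dist_norm norm_minus_commute)
        then have "(cmod (d t))\<^sup>2 \<le> r\<^sup>2" by (intro power_mono) auto
        with elim(1) show ?case by (simp add: unit_clamp_id cmod_power2)
      qed
    qed simp
    also have "\<dots> = (r * norm y)\<^sup>2"
      using measure_spectral_dist_UNIV[of y] by (simp add: power_mult_distrib dot_square_norm)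
    finally have "norm (normal_op y - z *\<^sub>C y) \<le> r * norm y"
      by (rule power2_le_imp_le) (use r in simp)
    then have "norm (normal_op y - z *\<^sub>C y) * C \<le> (r * norm y) * C"
      using C(1) by (intro mult_right_mono) auto
    moreover have "norm y \<le> norm (normal_op y - z *\<^sub>C y) * C"
      using C(2)[of "normal_op y - z *\<^sub>C y"] Q(2)[OF y] by simp
    moreover have "(r * norm y) * C = norm y / 2" using C(1) by (simp add: r_def)
    moreover have "0 \<le> norm y" by simp
    ultimately have "norm y = 0" by linarith
    then show ?thesis by (simp add: y_def)
  qed
  then show ?thesis using r unfolding spectrally_null_def by blast
qed

lemma closed_spectrum: "closed (spectrum_on M normal_op)"
proof -
  have "open (- spectrum_on M normal_op)"
    unfolding open_contains_ball
  proof
    fix z assume "z \<in> - spectrum_on M normal_op"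
    then obtain r where r: "0 < r" "spectrally_null (ball z r)"
      using null_ball_if_not_in_spectrum by blast
    have "w \<notin> spectrum_on M normal_op" if w: "w \<in> ball z r" for w
    proof (rule not_in_spectrum_if_null_ball)
      show "0 < r - dist z w" using w by simp
      have "ball w (r - dist z w) \<subseteq> ball z r"
        by (rule ball_diff_dist_subset)
      then show "spectrally_null (ball w (r - dist z w))"
        by (rule spectrally_null_subset[OF r(2)]) simp_all
    qed
    then show "\<exists>e>0. ball z e \<subseteq> - spectrum_on M normal_op" using r(1) by blast
  qed
  then show ?thesis by (simp add: closed_def)
qed

text \<open>By \<open>null_ball_if_not_in_spectrum\<close> and its converse the resolvent set is a union of null balls, and
  countably many of them suffice. The spectrum therefore carries the whole measure.\<close>

lemma spectrally_null_resolvent: "spectrally_null (- spectrum_on M normal_op)"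
proof (rule spectrally_nullI)
  let ?F = "{ball z r |z r. 0 < r \<and> spectrally_null (ball z r)}"
  have cover: "- spectrum_on M normal_op = \<Union>?F"
  proof (intro equalityI subsetI)
    fix z assume "z \<in> - spectrum_on M normal_op"
    then obtain r where "0 < r" "spectrally_null (ball z r)" using null_ball_if_not_in_spectrum by blast
    then show "z \<in> \<Union>?F" by (intro UnionI[of "ball z r"]) auto
  next
    fix w assume "w \<in> \<Union>?F"
    then obtain z r where r: "spectrally_null (ball z r)" and w: "w \<in> ball z r" by blast
    have "ball w (r - dist z w) \<subseteq> ball z r"
      by (rule ball_diff_dist_subset)
    then have "spectrally_null (ball w (r - dist z w))"
      by (rule spectrally_null_subset[OF r]) simp_all
    then show "w \<in> - spectrum_on M normal_op"
      using not_in_spectrum_if_null_ball[of "r - dist z w" w] w by simp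
  qed
  have "\<And>S. S \<in> ?F \<Longrightarrow> open S" by auto
  then obtain F' where F': "F' \<subseteq> ?F" "countable F'" "\<Union>F' = \<Union>?F" by (rule Lindelof)
  fix x assume "x \<in> M"
  have "S \<in> null_sets (scalar_measure segment_measure x)" if "S \<in> F'" for S
    using that F'(1) segment.emeasure_scalar_measure
    by (intro null_setsI) (auto simp: spectrally_null_def)
  then have "\<Union>F' \<in> null_sets (scalar_measure segment_measure x)"
    using null_sets_UN'[OF F'(2), of "\<lambda>S. S" "scalar_measure segment_measure x"] by simp
  then show "emeasure (scalar_measure segment_measure x) (- spectrum_on M normal_op) = 0"
    unfolding cover F'(3)[symmetric] by (rule null_setsD1)
qed (use closed_spectrum in \<open>simp add: borel_closed\<close>)

lemma spectrum_subset_segment: "spectrum_on M normal_op \<subseteq> segment_point ` {0..1}"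
proof
  fix z assume z: "z \<in> spectrum_on M normal_op"
  show "z \<in> segment_point ` {0..1}"
  proof (rule ccontr)
    assume "z \<notin> segment_point ` {0..1}"
    moreover have "closed (segment_point ` {0..1})"
      by (intro compact_imp_closed compact_continuous_image continuous_on_segment_point) simp
    ultimately obtain r where r: "0 < r" "ball z r \<inter> segment_point ` {0..1} = {}"
      unfolding closed_def open_contains_ball by (metis Compl_iff disjoint_eq_subset_Compl)
    have "spectrally_null (ball z r)"
    proof (rule spectrally_nullI)
      fix x assume x: "x \<in> M"
      have "emeasure (spectral_dist R x) (segment_point -` ball z r) = 0"
      proof -
        have "AE t in spectral_dist R x. t \<notin> segment_point -` ball z r"
          using AE_spectral_dist by eventually_elim (use r(2) in blast)
        moreover have "segment_point -` ball z r \<in> sets (spectral_dist R x)"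
          using preimage_borel[of "ball z r"] by simp
        ultimately show ?thesis
          using AE_iff_null_sets by blast
      qed
      then show "emeasure (scalar_measure segment_measure x) (ball z r) = 0"
        by (simp add: scalar_segment_measure[OF x] emeasure_distr)
    qed simp
    then show False using not_in_spectrum_if_null_ball[OF r(1)] z by blast
  qed
qed

theorem is_spectral_measure_segment_measure:
  "is_spectral_measure_on M normal_op segment_measure"
  unfolding is_spectral_measure_on_def
proof (intro conjI pvm_segment_measure)
  let ?K = "spectrum_on M normal_op"
  have K: "?K \<in> sets borel" using closed_spectrum by (rule borel_closed)
  have nK: "- ?K \<in> sets borel" using K by simp
  show "segment_measure ?K = proj M"
  proof
    fix x
    have "spectral_proj R (segment_point -` ?K \<union> segment_point -` (- ?K)) x
        = spectral_proj R (segment_point -` ?K) x + spectral_proj R (segment_point -` (- ?K)) x"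
      by (rule spectral_proj_disjoint_union[OF preimage_borel[OF K] preimage_borel[OF nK]]) auto
    moreover have "segment_point -` ?K \<union> segment_point -` (- ?K) = UNIV" by auto
    ultimately have "proj M x = segment_measure ?K x + segment_measure (- ?K) x"
      by (simp add: segment_measure_def spectral_proj_UNIV flip: proj_add)
    then show "segment_measure ?K x = proj M x"
      using spectrally_null_resolvent by (simp add: spectrally_null_def)
  qed
  show "normal_op = spectral_integral_on M segment_measure ?K (\<lambda>z. z)"
  proof (rule spectral_integral_onI[symmetric, OF operator_on_normal_op])
    fix x assume x: "x \<in> M"
    have meas: "(\<lambda>z. indicator ?K z *\<^sub>R z) \<in> borel_measurable borel"
      using K by measurable
    have "(LINT z:?K|scalar_measure segment_measure x. z)
        = integral\<^sup>L (spectral_dist R x) (\<lambda>t. indicator ?K (segment_point t) *\<^sub>R segment_point t)"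
      unfolding set_lebesgue_integral_def scalar_segment_measure[OF x]
      by (rule integral_distr) (use meas in simp_all)
    also have "\<dots> = integral\<^sup>L (spectral_dist R x) (\<lambda>t. segment_point (unit_clamp t))"
    proof (rule integral_cong_AE)
      show "AE t in spectral_dist R x. indicator ?K (segment_point t) *\<^sub>R segment_point t = segment_point (unit_clamp t)"
        using AE_spectral_dist spectrally_nullD[OF spectrally_null_resolvent nK x]
        by eventually_elim (simp add: unit_clamp_id)
      show "(\<lambda>t. indicator ?K (segment_point t) *\<^sub>R segment_point t) \<in> borel_measurable (spectral_dist R x)"
        using measurable_compose[OF measurable_segment_point meas] by simp
      show "(\<lambda>t. segment_point (unit_clamp t)) \<in> borel_measurable (spectral_dist R x)"
        using borel_measurable_continuous_onI[OF continuous_on_unit_clamp[OF continuous_on_segment_point]] by simp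
    qed
    also have "\<dots> = cinner (complex_calculus R segment_point x) x"
      by (rule complex_calculus_form_integral[symmetric, OF continuous_on_segment_point])
    also have "complex_calculus R segment_point x = normal_op x"
    proof -
      have "0 *\<^sub>C x = 0" using scaleC_of_real[of 0 x] by simp
      then show ?thesis using normal_op_eq_complex_calculus[OF x, of 0] by simp
    qed
    finally show "cinner (normal_op x) x = (LINT z:?K|scalar_measure segment_measure x. z)" ..
  qed
qed

text \<open>The functional calculus is defined by some spectral measure \<open>E\<close> of the normal operator, about which
  nothing is known but its defining properties. Integrating the real part against \<open>E\<close> gives an operator
  \<open>T\<close>, and integrating \<open>z\<close> gives \<open>T + \<i> (1 - T)\<close>, hence \<open>T = R\<close>. The integrals of continuous functions
  of the real part are then continuous functions of \<open>R\<close>.\<close>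

theorem joint_calculus_eq_complex_calculus:
  assumes f: "continuous_on {0..1} (\<lambda>t. f (t, 1 - t))"
  shows "joint_calculus_on M f R (\<lambda>x. proj M x - R x)
    = (\<lambda>x. complex_calculus R (\<lambda>t. f (t, 1 - t)) (proj M x))"
proof -
  let ?K = "spectrum_on M normal_op"
  define E where "E = spectral_measure_on M normal_op"
  have E: "is_spectral_measure_on M normal_op E"
    unfolding E_def spectral_measure_on_def
    by (rule someI[where P = "is_spectral_measure_on M normal_op", OF is_spectral_measure_segment_measure])
  interpret E: pvm M E
    by unfold_locales (use E in \<open>simp add: is_spectral_measure_on_def\<close>)
  interpret D: finite_measure "scalar_measure E y" for y by (rule E.finite_scalar_measure)
  have K [measurable]: "?K \<in> sets borel" using closed_spectrum by (rule borel_closed)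
  have AE_K: "AE z in scalar_measure E x. z \<in> ?K" if x: "x \<in> M" for x
  proof -
    have "measure (scalar_measure E x) ?K = measure (scalar_measure E x) (space (scalar_measure E x))"
      using E by (simp add: E.measure_scalar_measure[OF K] E.measure_scalar_measure_UNIV is_spectral_measure_on_def)
    then have "measure (scalar_measure E x) (space (scalar_measure E x) - ?K) = 0"
      using D.finite_measure_compl[of ?K x] K by simp
    then have "emeasure (scalar_measure E x) (- ?K) = 0"
      by (simp add: D.emeasure_eq_measure Compl_eq_Diff_UNIV)
    then show ?thesis
      by (intro AE_I[where N = "- ?K"]) (use K in auto)
  qed
  \<comment> \<open>The real part on the spectrum, changed elsewhere so that it takes values in the unit interval.\<close>
  define g where "g z = indicator ?K z * unit_clamp (Re z)" for z :: complex
  have g01: "0 \<le> g z" "g z \<le> 1" for z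
    using unit_clamp_mem[of "Re z"] by (auto simp: g_def indicator_def)
  have g_meas [measurable]: "g \<in> borel_measurable borel"
    unfolding g_def[abs_def] unit_clamp_def by measurable
  have g_seg: "segment_point (g z) = z" "g z = Re z" "Im z = 1 - g z" if z: "z \<in> ?K" for z
  proof -
    have "z \<in> segment_point ` {0..1}" using z spectrum_subset_segment by blast
    then obtain t where t: "0 \<le> t" "t \<le> 1" "z = segment_point t" by auto
    then have "g z = t" using z by (simp add: g_def unit_clamp_id segment_point_def)
    then show "segment_point (g z) = z" "g z = Re z" "Im z = 1 - g z"
      using t by (simp_all add: segment_point_def)
  qed
  obtain T where T: "pos_contraction T" "operator_on M T"
    and form: "\<And>F x. continuous_on {0..1} F \<Longrightarrow> x \<in> M \<Longrightarrow>
      inner (cont_calculus T F x) x = integral\<^sup>L (scalar_measure E x) (\<lambda>z. F (g z))"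
    using E.exists_integral_operator[OF g_meas g01] by blast
  interpret T: reduced_contraction M T
    using T(2) by (intro reduced_contraction.intro T(1) proj_subspace_axioms reduced_contraction_axioms.intro)
  have calc: "spectral_integral_on M E ?K G = (\<lambda>x. complex_calculus T h (proj M x))"
    if h: "continuous_on {0..1} h" and Gh: "\<And>z. z \<in> ?K \<Longrightarrow> G z = h (g z)" for G h
  proof (rule spectral_integral_onI[OF T.operator_on_complex_calculus[OF h]])
    fix x assume x: "x \<in> M"
    have unit_g: "unit_clamp (g z) = g z" for z by (rule unit_clamp_id[OF g01])
    have hg: "(\<lambda>z. h (g z)) \<in> borel_measurable borel"
      using measurable_compose[OF g_meas borel_measurable_continuous_onI[OF continuous_on_unit_clamp[OF h]]]
      by (simp add: unit_g)
    obtain B where B: "\<And>t. norm (h (unit_clamp t)) \<le> B"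
      using bounded_unit_clamp[OF h] by (auto simp: bounded_iff)
    have int: "integrable (scalar_measure E x) (\<lambda>z. h (g z))"
      by (rule D.integrable_const_bound[of _ B]) (use B[of "g _"] hg in \<open>simp_all add: unit_g\<close>)
    have ind: "indicator ?K z *\<^sub>R G z = indicator ?K z *\<^sub>R h (g z)" for z
      by (cases "z \<in> ?K") (simp_all add: Gh)
    have "(LINT z:?K|scalar_measure E x. G z) = integral\<^sup>L (scalar_measure E x) (\<lambda>z. h (g z))"
      unfolding set_lebesgue_integral_def ind
    proof (rule integral_cong_AE)
      show "AE z in scalar_measure E x. indicator ?K z *\<^sub>R h (g z) = h (g z)"
        using AE_K[OF x] by eventually_elim simp
    qed (use hg in simp_all)
    also have "\<dots> = Complex (integral\<^sup>L (scalar_measure E x) (\<lambda>z. Re (h (g z))))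
        (integral\<^sup>L (scalar_measure E x) (\<lambda>z. Im (h (g z))))"
      by (rule integral_complex_eq[OF int])
    also have "\<dots> = cinner (complex_calculus T h x) x"
      using form[OF continuous_Re_Im(1)[OF h] x] form[OF continuous_Re_Im(2)[OF h] x]
      by (simp add: T.complex_calculus_form[OF h])
    finally show "cinner (complex_calculus T h (proj M x)) x = (LINT z:?K|scalar_measure E x. G z)"
      by (simp add: proj_id[OF x])
  qed
  have "normal_op = spectral_integral_on M E ?K (\<lambda>z. z)"
    using E by (simp add: is_spectral_measure_on_def)
  also have "\<dots> = (\<lambda>x. complex_calculus T segment_point (proj M x))"
    by (rule calc[OF continuous_on_segment_point]) (simp add: g_seg(1))
  finally have N_T: "normal_op x = complex_calculus T segment_point (proj M x)" for x by simp
  have "R x = T x" for x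
  proof -
    have zero: "0 *\<^sub>C y = 0" for y :: 'a using scaleC_of_real[of 0 y] by simp
    have "normal_op (proj M x) = T.normal_op (proj M x)"
      using N_T[of "proj M x"] T.normal_op_eq_complex_calculus[OF proj_mem[of x], of 0]
      by (simp add: proj_idem zero)
    then have "(R x - T x) = \<i> *\<^sub>C (R x - T x)"
      by (simp add: normal_op_def T.normal_op_def R_proj T.R_proj proj_idem scaleC_diff_right algebra_simps)
    then have "inner (R x - T x) (R x - T x) = inner (\<i> *\<^sub>C (R x - T x)) (R x - T x)" by simp
    also have "\<dots> = 0"
      using inner_i_left[of "R x - T x" "R x - T x"] by (simp add: inner_commute)
    finally show ?thesis by simp
  qed
  then have RT: "T = R" by auto
  have S: "(\<lambda>x. R x + \<i> *\<^sub>C (proj M x - R x)) = normal_op"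
    by (simp add: normal_op_def[abs_def])
  have "spectral_integral_on M E ?K (\<lambda>z. f (Re z, Im z))
      = (\<lambda>x. complex_calculus T (\<lambda>t. f (t, 1 - t)) (proj M x))"
    by (rule calc[OF f]) (simp add: g_seg(2,3))
  then show ?thesis
    by (simp only: joint_calculus_on_def borel_calculus_on_def S E_def RT)
qed

end

section \<open>Positive operators and their square roots\<close>

locale positive_op =
  fixes T :: "'a::chilbert_space \<Rightarrow> 'a"
  assumes bounded_linear: "bounded_linear T"
    and complex_linear: "complex_linear T"
    and symmetric: "inner (T x) y = inner x (T y)"
    and nonneg: "0 \<le> inner (T x) x"
begin

lemma linear: "linear T"
  by (rule bounded_linear.linear[OF bounded_linear])

lemma cinner_symmetric: "cinner (T x) y = cinner x (T y)"
  by (rule cinner_symmetric[OF complex_linear symmetric])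

end

lemma (in proj_subspace) positive_on_imp_positive_op:
  fixes T :: "'a \<Rightarrow> 'a"
  assumes "positive_on M T"
  shows "bounded_linear T" "complex_linear T" "inner (T x) y = inner x (T y)" "0 \<le> inner (T x) x"
proof -
  have op: "operator_on M T" and form: "\<And>x. x \<in> M \<Longrightarrow> cinner (T x) x \<in> \<real> \<and> 0 \<le> Re (cinner (T x) x)"
    using assms by (auto simp: positive_on_def)
  show bl: "bounded_linear T" and cl: "complex_linear T"
    using op by (auto simp: operator_on_def complex_linear_def)
  have form_proj: "cinner (T x) x = cinner (T (proj M x)) (proj M x)" for x
    using operator_on_apply_proj[OF op] cinner_proj_right[OF operator_on_mem[OF op]] by metis
  have real: "Im (cinner (T x) x) = 0" for x
    using form[OF proj_mem[of x]] by (simp add: form_proj[of x] complex_is_Real_iff)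
  show "0 \<le> inner (T x) x"
    using form[OF proj_mem[of x]] unfolding inner_eq_Re_cinner form_proj[of x] by simp
  have lin: "T (x + y) = T x + T y" "T (c *\<^sub>C x) = c *\<^sub>C T x" for x y c
    using linear_add[OF bounded_linear.linear[OF bl]] cl by (auto simp: complex_linear_def)
  have "Re (cinner (T x) y) = Re (cinner (T y) x)"
    using real[of "x + \<i> *\<^sub>C y"] real[of x] real[of y]
    by (simp add: lin cinner_add_left cinner_add_right cinner_scaleC_left cinner_scaleC_right)
  then show "inner (T x) y = inner x (T y)"
    by (simp add: Re_cinner inner_commute)
qed

lemma proj_subspace_UNIV: "proj_subspace (UNIV :: 'a::complex_inner set)"
proof
  fix x :: 'a
  show "\<exists>p\<in>UNIV. x - p \<in> orth_compl UNIV"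
    by (rule bexI[of _ x]) (simp_all add: orth_compl_def)
qed simp_all

lemma positive_on_UNIV_imp_positive_op:
  "positive_on UNIV T \<Longrightarrow> positive_op T"
  using proj_subspace.positive_on_imp_positive_op[OF proj_subspace_UNIV]
  by (intro positive_op.intro) blast+

lemma (in proj_subspace) positive_op_imp_positive_on:
  fixes T :: "'a \<Rightarrow> 'a"
  assumes "complex_linear T" "\<And>x y. inner (T x) y = inner x (T y)" "\<And>x. 0 \<le> inner (T x) x" "operator_on M T"
  shows "positive_on M T"
  unfolding positive_on_def
  using assms(3,4) cinner_symmetric_form[OF assms(1,2)] by simp

text \<open>The added \<open>1\<close> makes the scaling factor positive also for the zero operator.\<close>

definition op_bound :: "('a::real_normed_vector \<Rightarrow> 'a) \<Rightarrow> real" where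
  "op_bound T = onorm T + 1"

definition op_scaled :: "('a::real_normed_vector \<Rightarrow> 'a) \<Rightarrow> 'a \<Rightarrow> 'a" where
  "op_scaled T x = (1 / op_bound T) *\<^sub>R T x"

definition op_fun :: "(real \<Rightarrow> real) \<Rightarrow> ('a::real_inner \<Rightarrow> 'a) \<Rightarrow> 'a \<Rightarrow> 'a" where
  "op_fun g T = cont_calculus (op_scaled T) (\<lambda>t. g (op_bound T * t))"

definition op_sqrt :: "('a::real_inner \<Rightarrow> 'a) \<Rightarrow> 'a \<Rightarrow> 'a" where
  "op_sqrt T = op_fun sqrt T"

context positive_op
begin

lemma op_bound_pos: "0 < op_bound T"
  using onorm_pos_le[OF bounded_linear] by (simp add: op_bound_def)

sublocale scaled: complex_contraction "op_scaled T"
proof (intro complex_contraction.intro pos_contraction.intro complex_contraction_axioms.intro)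
  show "bounded_linear (op_scaled T)"
    unfolding op_scaled_def[abs_def] by (rule bounded_linear_compose[OF bounded_linear_scaleR_right bounded_linear])
  fix x y
  show "inner (op_scaled T x) y = inner x (op_scaled T y)"
    by (simp add: op_scaled_def symmetric)
  show "0 \<le> inner (op_scaled T x) x"
    using op_bound_pos nonneg[of x] by (simp add: op_scaled_def)
  have "inner (T x) x \<le> norm (T x) * norm x" by (rule norm_cauchy_schwarz)
  also have "\<dots> \<le> (onorm T * norm x) * norm x"
    by (intro mult_right_mono onorm bounded_linear) simp
  also have "\<dots> \<le> (op_bound T * norm x) * norm x"
    by (intro mult_right_mono) (simp_all add: op_bound_def)
  also have "\<dots> = op_bound T * inner x x" by (simp add: dot_square_norm power2_eq_square)
  finally show "inner (op_scaled T x) x \<le> inner x x"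
    using op_bound_pos by (simp add: op_scaled_def pos_divide_le_eq mult.commute)
  show "complex_linear (op_scaled T)"
    using complex_linear by (simp add: op_scaled_def complex_linear_def scaleC_scaleR_commute)
qed

lemma continuous_op_fun:
  assumes "continuous_on {0..} g"
  shows "continuous_on {0..1} (\<lambda>t. g (op_bound T * t))"
  by (rule continuous_on_compose2[OF assms]) (use op_bound_pos in \<open>auto intro!: continuous_intros\<close>)

lemma op_fun_id: "op_fun (\<lambda>t. t) T x = T x"
  using op_bound_pos scaled.cont_calculus_scale[of "\<lambda>t. t" "op_bound T" x]
  by (simp add: op_fun_def scaled.cont_calculus_id op_scaled_def continuous_intros)

lemma op_fun_const: "op_fun (\<lambda>t. c) T x = c *\<^sub>R x"
  by (simp add: op_fun_def scaled.cont_calculus_const)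

lemma op_fun_cong: "(\<And>t. 0 \<le> t \<Longrightarrow> g t = h t) \<Longrightarrow> op_fun g T = op_fun h T"
  unfolding op_fun_def using op_bound_pos by (intro cont_calculus_cong) simp

lemma
  assumes g: "continuous_on {0..} g"
  shows op_fun_symmetric: "inner (op_fun g T x) y = inner x (op_fun g T y)"
    and bounded_linear_op_fun: "bounded_linear (op_fun g T)"
    and complex_linear_op_fun: "complex_linear (op_fun g T)"
    and op_fun_nonneg: "(\<And>t. 0 \<le> t \<Longrightarrow> 0 \<le> g t) \<Longrightarrow> 0 \<le> inner (op_fun g T x) x"
    and norm_op_fun_le: "(\<And>t. 0 \<le> t \<Longrightarrow> \<bar>g t\<bar> \<le> c) \<Longrightarrow> norm (op_fun g T x) \<le> c * norm x"
  unfolding op_fun_def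
  using scaled.cont_calculus_symmetric scaled.bounded_linear_cont_calculus
    scaled.complex_linear_cont_calculus scaled.cont_calculus_nonneg scaled.norm_cont_calculus_le
    continuous_op_fun[OF g] op_bound_pos
  by auto

lemma
  assumes g: "continuous_on {0..} g" and h: "continuous_on {0..} h"
  shows op_fun_mult: "op_fun (\<lambda>t. g t * h t) T x = op_fun g T (op_fun h T x)"
    and op_fun_diff: "op_fun (\<lambda>t. g t - h t) T x = op_fun g T x - op_fun h T x"
    and op_fun_add: "op_fun (\<lambda>t. g t + h t) T x = op_fun g T x + op_fun h T x"
  unfolding op_fun_def
  using scaled.cont_calculus_mult scaled.cont_calculus_diff scaled.cont_calculus_add
    continuous_op_fun[OF g] continuous_op_fun[OF h]
  by auto

lemma op_fun_commute:
  assumes g: "continuous_on {0..} g" and C: "bounded_linear C" "\<And>x. C (T x) = T (C x)"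
  shows "C (op_fun g T x) = op_fun g T (C x)"
  unfolding op_fun_def
  by (rule scaled.cont_calculus_commute[OF continuous_op_fun[OF g] C(1)])
     (simp add: op_scaled_def linear_scale[OF bounded_linear.linear[OF C(1)]] C(2))

lemma norm_op_fun_square:
  assumes g: "continuous_on {0..} g"
  shows "(norm (op_fun g T x))\<^sup>2 = inner (op_fun (\<lambda>t. (g t)\<^sup>2) T x) x"
  unfolding op_fun_def by (rule scaled.norm_cont_calculus_square[OF continuous_op_fun[OF g]])

lemma op_fun_form_mono:
  assumes g: "continuous_on {0..} g" and h: "continuous_on {0..} h" and le: "\<And>t. 0 \<le> t \<Longrightarrow> g t \<le> h t"
  shows "inner (op_fun g T x) x \<le> inner (op_fun h T x) x"
proof -
  have "0 \<le> inner (op_fun (\<lambda>t. h t - g t) T x) x"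
    by (rule op_fun_nonneg) (use le in \<open>auto intro!: continuous_on_diff g h\<close>)
  then show ?thesis by (simp add: op_fun_diff[OF h g] inner_diff_left)
qed

lemma continuous_sqrt: "continuous_on S sqrt"
  by (intro continuous_intros)

lemma positive_op_op_sqrt: "positive_op (op_sqrt T)"
  unfolding op_sqrt_def
  by (rule positive_op.intro)
     (use bounded_linear_op_fun complex_linear_op_fun op_fun_symmetric op_fun_nonneg continuous_sqrt in auto)

lemma op_sqrt_op_sqrt: "op_sqrt T (op_sqrt T x) = T x"
proof -
  have "op_fun (\<lambda>t. sqrt t * sqrt t) T = op_fun (\<lambda>t. t) T" by (rule op_fun_cong) simp
  then show ?thesis
    using op_fun_mult[OF continuous_sqrt continuous_sqrt, of x] by (simp add: op_sqrt_def op_fun_id)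
qed

lemma norm_op_sqrt: "(norm (op_sqrt T x))\<^sup>2 = inner (T x) x"
  by (simp only: power2_norm_eq_inner positive_op.symmetric[OF positive_op_op_sqrt, symmetric] op_sqrt_op_sqrt)

lemma op_sqrt_commute:
  assumes "bounded_linear C" "\<And>x. C (T x) = T (C x)"
  shows "C (op_sqrt T x) = op_sqrt T (C x)"
  unfolding op_sqrt_def by (rule op_fun_commute[OF continuous_sqrt assms])

lemma apply_zero_if_form_zero:
  assumes "inner (T x) x = 0"
  shows "T x = 0"
proof -
  have "(norm (op_sqrt T x))\<^sup>2 = 0" by (simp only: norm_op_sqrt assms)
  then have "op_sqrt T x = 0" by simp
  then have "T x = op_sqrt T 0" using op_sqrt_op_sqrt[of x] by simp
  then show ?thesis using linear_0[OF positive_op.linear[OF positive_op_op_sqrt]] by simp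
qed

text \<open>With \<open>y = (P - Q) x\<close>, commutation gives \<open>\<langle>(P + Q) y, y\<rangle> = \<langle>(P\<^sup>2 - Q\<^sup>2) x, y\<rangle> = 0\<close>, so both
  positive operators vanish at \<open>y\<close>.\<close>

lemma op_sqrt_unique:
  assumes P: "positive_op P" "\<And>x. P (P x) = T x"
  shows "op_sqrt T = P"
proof
  fix x
  interpret P: positive_op P by (rule P(1))
  interpret Q: positive_op "op_sqrt T" by (rule positive_op_op_sqrt)
  have comm: "P (op_sqrt T y) = op_sqrt T (P y)" for y
    by (rule op_sqrt_commute[OF P.bounded_linear]) (metis P(2))
  define y where "y = P x - op_sqrt T x"
  have "P y + op_sqrt T y = 0"
    by (simp add: y_def linear_diff[OF P.linear] linear_diff[OF Q.linear] P(2) op_sqrt_op_sqrt comm)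
  then have "inner (P y) y + inner (op_sqrt T y) y = 0"
    by (metis inner_add_left inner_zero_left)
  then have "inner (P y) y = 0" "inner (op_sqrt T y) y = 0"
    using P.nonneg[of y] Q.nonneg[of y] by linarith+
  then have "P y = 0" "op_sqrt T y = 0"
    using P.apply_zero_if_form_zero Q.apply_zero_if_form_zero by auto
  then have "inner y y = 0"
    using P.symmetric[of x y] Q.symmetric[of x y]
    by (subst (1) y_def) (simp add: inner_diff_left)
  then show "op_sqrt T x = P x" by (simp add: y_def)
qed

end

section \<open>The orthogonal complement of the kernel\<close>

lemma Cauchy_minus_incseq:
  fixes a :: "nat \<Rightarrow> real"
  assumes "incseq a" "\<forall>n. a n \<le> B"
  shows "Cauchy (\<lambda>n. - a n)"
proof -
  obtain L where "a \<longlonglongrightarrow> L" using incseq_convergent[OF assms] .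
  then have "(\<lambda>n. - a n) \<longlonglongrightarrow> - L" by (rule tendsto_minus)
  then show ?thesis by (rule LIMSEQ_imp_Cauchy)
qed

text \<open>A continuous substitute for \<open>1 / sqrt t\<close>. As \<open>n\<close> grows, \<open>sqrt t * inv_sqrt_cut n t\<close> increases to the
  indicator of \<open>t > 0\<close>, which corresponds to the projection onto the complement of the kernel.\<close>

definition inv_sqrt_cut :: "nat \<Rightarrow> real \<Rightarrow> real" where
  "inv_sqrt_cut n t = 1 / max (sqrt t) (1 / real (Suc n))"

lemma inv_sqrt_cut_denominator: "0 < max (sqrt t) (1 / real (Suc n))"
  by (simp add: less_max_iff_disj)

lemma inv_sqrt_cut_nonneg: "0 \<le> inv_sqrt_cut n t"
  using inv_sqrt_cut_denominator[of t n] by (simp add: inv_sqrt_cut_def)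

lemma inv_sqrt_cut_mono:
  assumes "n \<le> m"
  shows "inv_sqrt_cut n t \<le> inv_sqrt_cut m t"
proof -
  have "1 / real (Suc m) \<le> 1 / real (Suc n)" using assms by (intro divide_left_mono) auto
  then have "max (sqrt t) (1 / real (Suc m)) \<le> max (sqrt t) (1 / real (Suc n))" by (intro max.mono) simp_all
  then show ?thesis
    unfolding inv_sqrt_cut_def
    by (intro divide_left_mono mult_pos_pos inv_sqrt_cut_denominator) simp_all
qed

lemma continuous_inv_sqrt_cut: "continuous_on S (inv_sqrt_cut n)"
proof -
  have "max (sqrt t) (1 / real (Suc n)) \<noteq> 0" for t
    using inv_sqrt_cut_denominator[of t n] by simp
  then show ?thesis
    unfolding inv_sqrt_cut_def[abs_def]
    by (intro continuous_on_divide continuous_on_max continuous_on_const continuous_on_real_sqrt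
        continuous_on_id) blast
qed

lemma sqrt_inv_sqrt_cut_bounds:
  assumes "0 \<le> t"
  shows "0 \<le> sqrt t * inv_sqrt_cut n t" "sqrt t * inv_sqrt_cut n t \<le> 1"
  using assms inv_sqrt_cut_denominator[of t n] inv_sqrt_cut_nonneg[of n t]
  by (simp_all add: inv_sqrt_cut_def divide_le_eq_1)

lemma sqrt_inv_sqrt_cut_approx:
  assumes "0 \<le> t"
  shows "\<bar>sqrt t - sqrt t * inv_sqrt_cut n t * sqrt t\<bar> \<le> 1 / real (Suc n)"
proof (cases "1 / real (Suc n) \<le> sqrt t")
  case True
  moreover have "0 < 1 / real (Suc n)" by simp
  ultimately have "0 < sqrt t" by linarith
  with True have "inv_sqrt_cut n t * sqrt t = 1" by (simp add: inv_sqrt_cut_def max_def)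
  then show ?thesis by (simp add: mult.assoc)
next
  case False
  have "sqrt t - sqrt t * inv_sqrt_cut n t * sqrt t = sqrt t * (1 - sqrt t * inv_sqrt_cut n t)"
    by (simp add: algebra_simps)
  moreover have "0 \<le> sqrt t * (1 - sqrt t * inv_sqrt_cut n t)"
    "sqrt t * (1 - sqrt t * inv_sqrt_cut n t) \<le> sqrt t"
    using sqrt_inv_sqrt_cut_bounds[OF assms, of n] assms by (auto intro!: mult_left_le)
  ultimately show ?thesis using False by simp
qed

context positive_op
begin

definition inv_sqrt_op :: "nat \<Rightarrow> 'a \<Rightarrow> 'a" where
  "inv_sqrt_op n = op_fun (inv_sqrt_cut n) T"

lemma bounded_linear_inv_sqrt_op: "bounded_linear (inv_sqrt_op n)"
  unfolding inv_sqrt_op_def by (rule bounded_linear_op_fun[OF continuous_inv_sqrt_cut])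

lemma linear_inv_sqrt_op: "linear (inv_sqrt_op n)"
  by (rule bounded_linear.linear[OF bounded_linear_inv_sqrt_op])

lemma inv_sqrt_op_symmetric: "inner (inv_sqrt_op n x) y = inner x (inv_sqrt_op n y)"
  unfolding inv_sqrt_op_def by (rule op_fun_symmetric[OF continuous_inv_sqrt_cut])

lemma complex_linear_inv_sqrt_op: "complex_linear (inv_sqrt_op n)"
  unfolding inv_sqrt_op_def by (rule complex_linear_op_fun[OF continuous_inv_sqrt_cut])

lemma op_sqrt_inv_sqrt_op:
  "op_sqrt T (inv_sqrt_op n x) = op_fun (\<lambda>t. sqrt t * inv_sqrt_cut n t) T x"
  unfolding op_sqrt_def inv_sqrt_op_def
  by (rule op_fun_mult[symmetric, OF continuous_sqrt continuous_inv_sqrt_cut])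

lemma continuous_sqrt_inv_sqrt_cut: "continuous_on S (\<lambda>t. sqrt t * inv_sqrt_cut n t)"
  by (intro continuous_on_mult continuous_sqrt continuous_inv_sqrt_cut)

lemma inv_sqrt_op_commute: "inv_sqrt_op n (op_sqrt T x) = op_sqrt T (inv_sqrt_op n x)"
  unfolding op_sqrt_def inv_sqrt_op_def
  using op_fun_mult[OF continuous_sqrt continuous_inv_sqrt_cut, of n x]
    op_fun_mult[OF continuous_inv_sqrt_cut continuous_sqrt, of n x]
  by (simp add: mult.commute)

lemma norm_op_sqrt_inv_sqrt_op_le: "norm (op_sqrt T (inv_sqrt_op n x)) \<le> norm x"
proof -
  have "norm (op_fun (\<lambda>t. sqrt t * inv_sqrt_cut n t) T x) \<le> 1 * norm x"
    by (rule norm_op_fun_le[OF continuous_sqrt_inv_sqrt_cut])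
       (use sqrt_inv_sqrt_cut_bounds in \<open>simp add: abs_le_iff add_increasing\<close>)
  then show ?thesis by (simp add: op_sqrt_inv_sqrt_op)
qed

lemma norm_op_sqrt_approx:
  "norm (op_sqrt T (inv_sqrt_op n (op_sqrt T x)) - op_sqrt T x) \<le> norm x / real (Suc n)"
proof -
  let ?w = "\<lambda>t. sqrt t * inv_sqrt_cut n t * sqrt t"
  have cw: "continuous_on S ?w" for S
    by (intro continuous_on_mult continuous_sqrt continuous_sqrt_inv_sqrt_cut)
  have "op_sqrt T x - op_sqrt T (inv_sqrt_op n (op_sqrt T x)) = op_fun (\<lambda>t. sqrt t - ?w t) T x"
    unfolding op_sqrt_inv_sqrt_op
    by (simp add: op_sqrt_def op_fun_diff[OF continuous_sqrt cw]
        op_fun_mult[OF continuous_sqrt_inv_sqrt_cut continuous_sqrt])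
  also have "norm \<dots> \<le> 1 / real (Suc n) * norm x"
    by (rule norm_op_fun_le[OF continuous_on_diff[OF continuous_sqrt cw] sqrt_inv_sqrt_cut_approx])
  finally show ?thesis by (simp add: norm_minus_commute)
qed

lemma op_sqrt_approx_tendsto:
  "(\<lambda>n. op_sqrt T (inv_sqrt_op n (op_sqrt T x))) \<longlonglongrightarrow> op_sqrt T x"
proof (rule Lim_null_comparison[THEN Lim_null[THEN iffD2]])
  show "\<forall>\<^sub>F n in sequentially. norm (op_sqrt T (inv_sqrt_op n (op_sqrt T x)) - op_sqrt T x) \<le> norm x / real (Suc n)"
    using norm_op_sqrt_approx by simp
  show "(\<lambda>n. norm x / real (Suc n)) \<longlonglongrightarrow> 0"
    using LIMSEQ_Suc[OF lim_const_over_n[of "norm x"]] by simp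
qed

text \<open>The operators \<open>sqrt T * inv_sqrt_op n\<close> are increasing contractions, so they converge strongly.\<close>

lemma Cauchy_op_sqrt_inv_sqrt_op: "Cauchy (\<lambda>n. op_sqrt T (inv_sqrt_op n x))"
proof -
  let ?w = "\<lambda>n t. sqrt t * inv_sqrt_cut n t"
  define a where "a n = inner (op_fun (?w n) T x) x" for n
  note c = continuous_sqrt_inv_sqrt_cut
  have mono: "?w n t \<le> ?w m t" if "n \<le> m" "0 \<le> t" for n m t
    using that by (intro mult_left_mono inv_sqrt_cut_mono) auto
  have "incseq a"
    unfolding a_def by (intro incseq_SucI op_fun_form_mono c mono) auto
  moreover have "\<forall>n. a n \<le> inner x x"
  proof
    fix n
    have "a n \<le> inner (op_fun (\<lambda>_. 1) T x) x"
      unfolding a_def by (rule op_fun_form_mono[OF c continuous_on_const sqrt_inv_sqrt_cut_bounds(2)])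
    then show "a n \<le> inner x x" by (simp add: op_fun_const)
  qed
  ultimately have "Cauchy (\<lambda>n. - a n)" by (rule Cauchy_minus_incseq)
  then show ?thesis
  proof (rule Cauchy_if_square_dist_le)
    fix m n :: nat assume nm: "n \<le> m"
    let ?d = "\<lambda>t. ?w m t - ?w n t"
    have cd: "continuous_on S ?d" for S by (intro continuous_on_diff c)
    have "(norm (op_sqrt T (inv_sqrt_op n x) - op_sqrt T (inv_sqrt_op m x)))\<^sup>2 = (norm (op_fun ?d T x))\<^sup>2"
      by (simp add: op_sqrt_inv_sqrt_op op_fun_diff[OF c c] norm_minus_commute)
    also have "\<dots> = inner (op_fun (\<lambda>t. (?d t)\<^sup>2) T x) x" by (rule norm_op_fun_square[OF cd])
    also have "\<dots> \<le> inner (op_fun ?d T x) x"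
    proof (rule op_fun_form_mono[OF continuous_on_power[OF cd] cd])
      fix t :: real assume t: "0 \<le> t"
      have "0 \<le> ?d t" "?d t \<le> 1"
        using mono[OF nm t] sqrt_inv_sqrt_cut_bounds[OF t, of n] sqrt_inv_sqrt_cut_bounds[OF t, of m]
        by linarith+
      then show "(?d t)\<^sup>2 \<le> ?d t" unfolding power2_eq_square by (intro mult_left_le)
    qed
    also have "\<dots> = - a n - - a m"
      by (simp add: a_def op_fun_diff[OF c c] inner_diff_left)
    finally show "(norm (op_sqrt T (inv_sqrt_op n x) - op_sqrt T (inv_sqrt_op m x)))\<^sup>2 \<le> - a n - - a m" .
  qed
qed

definition kernel :: "'a set" where
  "kernel = {x. T x = 0}"

lemma mem_kernel_iff: "x \<in> kernel \<longleftrightarrow> op_sqrt T x = 0"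
proof
  assume "x \<in> kernel"
  then have "(norm (op_sqrt T x))\<^sup>2 = 0" by (simp add: norm_op_sqrt kernel_def)
  then show "op_sqrt T x = 0" by simp
next
  assume "op_sqrt T x = 0"
  then show "x \<in> kernel"
    using op_sqrt_op_sqrt[of x] linear_0[OF positive_op.linear[OF positive_op_op_sqrt]]
    by (simp add: kernel_def)
qed

lemma op_sqrt_mem: "op_sqrt T x \<in> orth_compl kernel"
  using positive_op.cinner_symmetric[OF positive_op_op_sqrt]
  by (auto simp: orth_compl_def mem_kernel_iff)

lemma orth_compl_limit:
  assumes "\<And>n. y n \<in> orth_compl S" "y \<longlonglongrightarrow> l"
  shows "l \<in> orth_compl (S :: 'a set)"
  unfolding orth_compl_def
proof (intro CollectI ballI)
  fix z assume z: "z \<in> S"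
  have "(\<lambda>n. inner (y n) z) \<longlonglongrightarrow> inner l z" "(\<lambda>n. inner (\<i> *\<^sub>C y n) z) \<longlonglongrightarrow> inner (\<i> *\<^sub>C l) z"
    by (intro tendsto_intros assms bounded_linear.tendsto[OF bounded_linear_scaleC])+
  moreover have "cinner (y n) z = 0" for n
    using assms(1) z by (auto simp: orth_compl_def)
  then have "inner (y n) z = 0" "inner (\<i> *\<^sub>C y n) z = 0" for n
    by (simp_all add: inner_eq_Re_cinner cinner_scaleC_left)
  ultimately have "inner l z = 0" "inner (\<i> *\<^sub>C l) z = 0"
    by (simp_all add: LIMSEQ_const_iff)
  then show "cinner l z = 0" by (simp add: complex_eq_iff Re_cinner Im_cinner)
qed

text \<open>The limit \<open>p\<close> is orthogonal to the kernel as a limit of vectors in the range of \<open>sqrt T\<close>, and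
  \<open>sqrt T\<close> maps \<open>p\<close> and \<open>x\<close> to the same vector.\<close>

lemma support_decomposition:
  "\<exists>p\<in>orth_compl kernel. x - p \<in> kernel \<and> (\<lambda>n. op_sqrt T (inv_sqrt_op n x)) \<longlonglongrightarrow> p"
proof -
  interpret Q: positive_op "op_sqrt T" by (rule positive_op_op_sqrt)
  obtain p where p: "(\<lambda>n. op_sqrt T (inv_sqrt_op n x)) \<longlonglongrightarrow> p"
    using Cauchy_op_sqrt_inv_sqrt_op[of x] by (auto simp: Cauchy_convergent_iff convergent_def)
  have "p \<in> orth_compl kernel" by (rule orth_compl_limit[OF op_sqrt_mem p])
  moreover have "op_sqrt T p = op_sqrt T x"
  proof (rule LIMSEQ_unique)
    show "(\<lambda>n. op_sqrt T (op_sqrt T (inv_sqrt_op n x))) \<longlonglongrightarrow> op_sqrt T p"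
      by (rule bounded_linear.tendsto[OF Q.bounded_linear p])
    show "(\<lambda>n. op_sqrt T (op_sqrt T (inv_sqrt_op n x))) \<longlonglongrightarrow> op_sqrt T x"
      using op_sqrt_approx_tendsto[of x] by (simp add: inv_sqrt_op_commute)
  qed
  then have "x - p \<in> kernel" by (simp add: mem_kernel_iff linear_diff[OF Q.linear])
  ultimately show ?thesis using p by blast
qed

lemma kernel_subset: "kernel \<subseteq> orth_compl (orth_compl kernel)"
proof
  fix x assume x: "x \<in> kernel"
  have "cinner x y = 0" if "y \<in> orth_compl kernel" for y
    using that x cinner_commute[of x y] by (simp add: orth_compl_def)
  then show "x \<in> orth_compl (orth_compl kernel)" by (simp add: orth_compl_def)
qed

sublocale support: proj_subspace "orth_compl kernel"
proof
  fix x y :: 'a and c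
  show "x \<in> orth_compl kernel \<Longrightarrow> y \<in> orth_compl kernel \<Longrightarrow> x + y \<in> orth_compl kernel"
    by (simp add: orth_compl_def cinner_add_left)
  show "x \<in> orth_compl kernel \<Longrightarrow> c *\<^sub>C x \<in> orth_compl kernel"
    by (simp add: orth_compl_def cinner_scaleC_left)
  show "\<exists>p\<in>orth_compl kernel. x - p \<in> orth_compl (orth_compl kernel)"
    using support_decomposition[of x] kernel_subset by blast
qed

text \<open>In particular the range of \<open>sqrt T\<close> is dense in the complement of the kernel.\<close>

lemma support_dense:
  assumes "x \<in> orth_compl kernel"
  shows "(\<lambda>n. op_sqrt T (inv_sqrt_op n x)) \<longlonglongrightarrow> x"
proof -
  obtain p where p: "p \<in> orth_compl kernel" "x - p \<in> kernel"
    "(\<lambda>n. op_sqrt T (inv_sqrt_op n x)) \<longlonglongrightarrow> p"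
    using support_decomposition by blast
  have "proj (orth_compl kernel) x = p"
    by (rule support.proj_eqI) (use p kernel_subset in auto)
  then show ?thesis using p(3) support.proj_id[OF assms] by simp
qed

lemma orth_compl_support: "orth_compl (orth_compl kernel) = kernel"
proof
  show "orth_compl (orth_compl kernel) \<subseteq> kernel"
  proof
    fix x assume x: "x \<in> orth_compl (orth_compl kernel)"
    obtain p where p: "p \<in> orth_compl kernel" "x - p \<in> kernel" using support_decomposition by blast
    have "proj (orth_compl kernel) x = p"
      by (rule support.proj_eqI) (use p kernel_subset in auto)
    then have "p = 0" using support.proj_orth_compl[OF x] by simp
    then show "x \<in> kernel" using p(2) by simp
  qed
qed (rule kernel_subset)

lemma operator_on_support_if_kernel:
  assumes G: "positive_op G" and le: "\<And>x. norm (G x) \<le> norm (op_sqrt T x)"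
  shows "operator_on (orth_compl kernel) G"
  unfolding operator_on_def
proof (intro conjI allI ballI)
  interpret G: positive_op G by (rule G)
  have zero: "G x = 0" if "x \<in> kernel" for x
    using le[of x] that by (simp add: mem_kernel_iff)
  show "bounded_linear G" by (rule G.bounded_linear)
  show "G (c *\<^sub>C x) = c *\<^sub>C G x" for c x
    using G.complex_linear by (simp add: complex_linear_def)
  show "range G \<subseteq> orth_compl kernel"
    using zero by (auto simp: orth_compl_def G.cinner_symmetric)
  show "G x = 0" if "x \<in> orth_compl (orth_compl kernel)" for x
    using zero that by (simp add: orth_compl_support)
qed

text \<open>The factor \<open>X\<close> with \<open>X sqrt T = G\<close> is the strong limit of \<open>G * inv_sqrt_op n\<close>, and its adjoint
  is the strong limit of \<open>inv_sqrt_op n * G\<close>.\<close>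

lemma contraction_factor:
  assumes G: "positive_op G" and le: "\<And>x. norm (G x) \<le> norm (op_sqrt T x)"
  obtains X X' where "contraction_on (orth_compl kernel) X" "operator_on (orth_compl kernel) X'"
    "\<And>x. norm (X x) \<le> norm x" "\<And>x y. cinner (X x) y = cinner x (X' y)" "\<And>x. X (op_sqrt T x) = G x"
proof -
  interpret G: positive_op G by (rule G)
  interpret Q: positive_op "op_sqrt T" by (rule positive_op_op_sqrt)
  have GM: "operator_on (orth_compl kernel) G" by (rule operator_on_support_if_kernel[OF G le])
  define F where "F n x = G (inv_sqrt_op n x)" for n x
  define F' where "F' n x = inv_sqrt_op n (G x)" for n x
  have lin: "linear (F n)" "linear (F' n)" for n
    unfolding F_def[abs_def] F'_def[abs_def]
    using linear_compose[OF linear_inv_sqrt_op G.linear] linear_compose[OF G.linear linear_inv_sqrt_op]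
    by (simp_all add: o_def)
  have adj: "inner (F n x) y = inner x (F' n y)" for n x y
    by (simp add: F_def F'_def G.symmetric inv_sqrt_op_symmetric)
  have scale: "F n (c *\<^sub>C x) = c *\<^sub>C F n x" "F' n (c *\<^sub>C x) = c *\<^sub>C F' n x" for n c x
    using complex_linear_inv_sqrt_op[of n] G.complex_linear
    by (simp_all add: F_def F'_def complex_linear_def)
  have F_le: "norm (F n x) \<le> norm x" for n x
    unfolding F_def by (rule order_trans[OF le norm_op_sqrt_inv_sqrt_op_le])
  have F'_le: "norm (F' n x) \<le> norm x" for n x
  proof -
    have "norm (F' n x) * norm (F' n x) = inner (F n (F' n x)) x"
      by (simp only: adj power2_norm_eq_inner flip: power2_eq_square)
    also have "\<dots> \<le> norm (F n (F' n x)) * norm x" by (rule norm_cauchy_schwarz)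
    also have "\<dots> \<le> norm (F' n x) * norm x" by (intro mult_right_mono F_le) simp
    finally show ?thesis by (cases "norm (F' n x) = 0") auto
  qed
  have "Cauchy (\<lambda>n. F n x)" for x
  proof (rule metric_CauchyI)
    fix e :: real assume "0 < e"
    from metric_CauchyD[OF Cauchy_op_sqrt_inv_sqrt_op[of x] this] obtain N where
      N: "\<forall>m\<ge>N. \<forall>n\<ge>N. dist (op_sqrt T (inv_sqrt_op m x)) (op_sqrt T (inv_sqrt_op n x)) < e" by blast
    have "dist (F m x) (F n x) \<le> dist (op_sqrt T (inv_sqrt_op m x)) (op_sqrt T (inv_sqrt_op n x))" for m n
      using le[of "inv_sqrt_op m x - inv_sqrt_op n x"]
      by (simp add: F_def dist_norm linear_diff[OF G.linear] linear_diff[OF Q.linear])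
    then show "\<exists>N. \<forall>m\<ge>N. \<forall>n\<ge>N. dist (F m x) (F n x) < e"
      using N by (meson le_less_trans)
  qed
  then have lim_X: "(\<lambda>n. F n x) \<longlonglongrightarrow> lim (\<lambda>n. F n x)" for x
    by (simp add: Cauchy_convergent_iff convergent_LIMSEQ_iff)
  define X where "X x = lim (\<lambda>n. F n x)" for x
  have X: "(\<lambda>n. F n x) \<longlonglongrightarrow> X x" for x
    unfolding X_def by (rule lim_X)
  have "Cauchy (\<lambda>n. F' n x)" for x
  proof -
    define a where "a n = (norm (F' n x))\<^sup>2" for n
    note c = continuous_inv_sqrt_cut
    \<comment> \<open>For \<open>0 \<le> a \<le> b\<close> one has \<open>(b - a)\<^sup>2 \<le> b\<^sup>2 - a\<^sup>2\<close>.\<close>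
    have diff_le: "(norm (F' n x - F' m x))\<^sup>2 \<le> a m - a n" if nm: "n \<le> m" for n m
    proof -
      let ?d = "\<lambda>t. inv_sqrt_cut n t - inv_sqrt_cut m t"
      have sq: "continuous_on S (\<lambda>t. (inv_sqrt_cut n t)\<^sup>2)" for S n
        by (intro continuous_on_power c)
      have "(norm (F' n x - F' m x))\<^sup>2 = inner (op_fun (\<lambda>t. (?d t)\<^sup>2) T (G x)) (G x)"
        by (simp add: F'_def inv_sqrt_op_def norm_op_fun_square[OF continuous_on_diff[OF c c]]
            flip: op_fun_diff[OF c c])
      also have "\<dots> \<le> inner (op_fun (\<lambda>t. (inv_sqrt_cut m t)\<^sup>2 - (inv_sqrt_cut n t)\<^sup>2) T (G x)) (G x)"
      proof (rule op_fun_form_mono)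
        fix t :: real assume "0 \<le> t"
        have "0 \<le> 2 * inv_sqrt_cut n t * (inv_sqrt_cut m t - inv_sqrt_cut n t)"
          using inv_sqrt_cut_nonneg[of n t] inv_sqrt_cut_mono[OF nm, of t] by simp
        then show "(?d t)\<^sup>2 \<le> (inv_sqrt_cut m t)\<^sup>2 - (inv_sqrt_cut n t)\<^sup>2"
          by (simp add: power2_eq_square algebra_simps)
      qed (intro continuous_on_power continuous_on_diff c)+
      also have "\<dots> = a m - a n"
        by (simp add: a_def F'_def inv_sqrt_op_def norm_op_fun_square[OF c] op_fun_diff[OF sq sq] inner_diff_left)
      finally show ?thesis .
    qed
    have "incseq a"
    proof (rule incseq_SucI)
      fix n
      have "0 \<le> (norm (F' n x - F' (Suc n) x))\<^sup>2" by simp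
      then show "a n \<le> a (Suc n)" using diff_le[of n "Suc n"] by linarith
    qed
    moreover have "\<forall>n. a n \<le> (norm x)\<^sup>2"
      unfolding a_def using F'_le by (auto intro!: power_mono)
    ultimately have "Cauchy (\<lambda>n. - a n)" by (rule Cauchy_minus_incseq)
    then show ?thesis
      by (rule Cauchy_if_square_dist_le) (use diff_le in simp)
  qed
  then have lim_X': "(\<lambda>n. F' n x) \<longlonglongrightarrow> lim (\<lambda>n. F' n x)" for x
    by (simp add: Cauchy_convergent_iff convergent_LIMSEQ_iff)
  define X' where "X' x = lim (\<lambda>n. F' n x)" for x
  have X': "(\<lambda>n. F' n x) \<longlonglongrightarrow> X' x" for x
    unfolding X'_def by (rule lim_X')
  have X_le: "norm (X x) \<le> norm x" for x
    by (rule bounded_linear_strong_limit(2)[OF lin(1) F_le X])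
  have adj_X: "inner (X x) y = inner x (X' y)" for x y
  proof (rule LIMSEQ_unique)
    show "(\<lambda>n. inner (F n x) y) \<longlonglongrightarrow> inner (X x) y" by (intro tendsto_intros X)
    show "(\<lambda>n. inner (F n x) y) \<longlonglongrightarrow> inner x (X' y)" unfolding adj by (intro tendsto_intros X')
  qed
  have scale_X: "X (c *\<^sub>C x) = c *\<^sub>C X x" "X' (c *\<^sub>C x) = c *\<^sub>C X' x" for c x
    using LIMSEQ_unique[OF X[of "c *\<^sub>C x"]] LIMSEQ_unique[OF X'[of "c *\<^sub>C x"]]
      bounded_linear.tendsto[OF bounded_linear_scaleC X[of x], of c]
      bounded_linear.tendsto[OF bounded_linear_scaleC X'[of x], of c]
    by (simp_all add: scale)
  have cadj: "cinner (X x) y = cinner x (X' y)" for x y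
  proof -
    have "inner (\<i> *\<^sub>C X x) y = inner (\<i> *\<^sub>C x) (X' y)"
      using adj_X[of "\<i> *\<^sub>C x" y] by (simp add: scale_X)
    then show ?thesis by (simp add: complex_eq_iff Re_cinner Im_cinner adj_X)
  qed
  have ker: "F n x = 0" "F' n x = 0" "G x = 0" if "x \<in> kernel" for n x
  proof -
    show Gx: "G x = 0" using le[of x] that by (simp add: mem_kernel_iff)
    then show "F' n x = 0" by (simp add: F'_def linear_0[OF linear_inv_sqrt_op])
    have "op_sqrt T (inv_sqrt_op n x) = 0"
      using that by (simp add: mem_kernel_iff linear_0[OF linear_inv_sqrt_op] flip: inv_sqrt_op_commute)
    then show "F n x = 0" using le[of "inv_sqrt_op n x"] by (simp add: F_def)
  qed
  have X_op: "operator_on (orth_compl kernel) X"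
    unfolding operator_on_def
  proof (intro conjI allI ballI)
    show "bounded_linear X" by (rule bounded_linear_strong_limit(1)[OF lin(1) F_le X])
    show "X (c *\<^sub>C x) = c *\<^sub>C X x" for c x by (rule scale_X)
    have "F n x \<in> orth_compl kernel" for n x
      unfolding F_def by (rule support.operator_on_mem[OF GM])
    then show "range X \<subseteq> orth_compl kernel" using orth_compl_limit[OF _ X] by blast
    show "X x = 0" if "x \<in> orth_compl (orth_compl kernel)" for x
      using LIMSEQ_unique[OF X[of x], of 0] ker(1)[of x] that by (simp add: orth_compl_support)
  qed
  have X'_op: "operator_on (orth_compl kernel) X'"
    unfolding operator_on_def
  proof (intro conjI allI ballI)
    show "bounded_linear X'" by (rule bounded_linear_strong_limit(1)[OF lin(2) F'_le X'])
    show "X' (c *\<^sub>C x) = c *\<^sub>C X' x" for c x by (rule scale_X)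
    have zero: "X z = 0" if "z \<in> kernel" for z
      using LIMSEQ_unique[OF X[of z], of 0] ker(1)[OF that] by simp
    have "cinner (X' x) z = 0" if "z \<in> kernel" for x z
      using cinner_commute[of "X' x" z] cadj[of z x] zero[OF that] by simp
    then show "range X' \<subseteq> orth_compl kernel" by (auto simp: orth_compl_def)
    show "X' x = 0" if "x \<in> orth_compl (orth_compl kernel)" for x
      using LIMSEQ_unique[OF X'[of x], of 0] ker(2)[of x] that by (simp add: orth_compl_support)
  qed
  have factor: "X (op_sqrt T x) = G x" for x
  proof (rule LIMSEQ_unique[OF X])
    show "(\<lambda>n. F n (op_sqrt T x)) \<longlonglongrightarrow> G x"
    proof (rule Lim_null_comparison[THEN Lim_null[THEN iffD2]])
      have "norm (F n (op_sqrt T x) - G x) \<le> norm (op_sqrt T (inv_sqrt_op n (op_sqrt T x)) - op_sqrt T x)" for n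
        using le[of "inv_sqrt_op n (op_sqrt T x) - x"]
        by (simp add: F_def linear_diff[OF G.linear] linear_diff[OF Q.linear])
      then show "\<forall>\<^sub>F n in sequentially. norm (F n (op_sqrt T x) - G x)
          \<le> norm (op_sqrt T (inv_sqrt_op n (op_sqrt T x)) - op_sqrt T x)" by simp
      show "(\<lambda>n. norm (op_sqrt T (inv_sqrt_op n (op_sqrt T x)) - op_sqrt T x)) \<longlonglongrightarrow> 0"
        using op_sqrt_approx_tendsto[of x] by (simp add: tendsto_norm_zero_iff flip: Lim_null)
    qed
  qed
  show ?thesis
    using that[of X X'] X_op X'_op X_le cadj factor by (simp add: contraction_on_def)
qed

lemma support_operator_unique:
  assumes "operator_on (orth_compl kernel) X" "operator_on (orth_compl kernel) Y"
    and "\<And>x. X (op_sqrt T x) = Y (op_sqrt T x)"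
  shows "X = Y"
proof (rule support.operator_on_ext[OF assms(1,2)])
  fix x assume x: "x \<in> orth_compl kernel"
  have lim: "(\<lambda>n. Z (op_sqrt T (inv_sqrt_op n x))) \<longlonglongrightarrow> Z x" if "operator_on (orth_compl kernel) Z" for Z
    by (rule bounded_linear.tendsto[OF _ support_dense[OF x]]) (use that in \<open>simp add: operator_on_def\<close>)
  show "X x = Y x"
    using LIMSEQ_unique[OF lim[OF assms(1)]] lim[OF assms(2)] by (simp add: assms(3))
qed

text \<open>An operator \<open>S \<le> T\<close> vanishes on the kernel of \<open>T\<close>, so it lives on the complement together with its
  square root. This covers \<open>A\<close>, \<open>B\<close> and \<open>A + B\<close>.\<close>

lemma sqrt_on_support:
  assumes G: "positive_op S" and le: "\<And>x. inner (S x) x \<le> inner (T x) x"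
  shows "sqrt_on (orth_compl kernel) S = op_sqrt S"
    and "operator_on (orth_compl kernel) (op_sqrt S)"
    and "norm (op_sqrt S x) \<le> norm (op_sqrt T x)"
proof -
  interpret S: positive_op S by (rule G)
  interpret QS: positive_op "op_sqrt S" by (rule S.positive_op_op_sqrt)
  show norm: "norm (op_sqrt S x) \<le> norm (op_sqrt T x)" for x
  proof (rule power2_le_imp_le)
    show "(norm (op_sqrt S x))\<^sup>2 \<le> (norm (op_sqrt T x))\<^sup>2"
      unfolding norm_op_sqrt S.norm_op_sqrt by (rule le)
  qed simp
  show op: "operator_on (orth_compl kernel) (op_sqrt S)"
    by (rule operator_on_support_if_kernel[OF S.positive_op_op_sqrt norm])
  show "sqrt_on (orth_compl kernel) S = op_sqrt S"
    unfolding sqrt_on_def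
  proof (rule the_equality)
    show "positive_on (orth_compl kernel) (op_sqrt S) \<and> op_sqrt S \<circ> op_sqrt S = S"
      using support.positive_op_imp_positive_on[OF QS.complex_linear QS.symmetric QS.nonneg op]
      by (simp add: fun_eq_iff S.op_sqrt_op_sqrt)
    fix P assume P: "positive_on (orth_compl kernel) P \<and> P \<circ> P = S"
    have "positive_op P"
      using support.positive_on_imp_positive_op[of P] P by (intro positive_op.intro) auto
    then show "P = op_sqrt S"
      using S.op_sqrt_unique[of P] P by (auto simp: fun_eq_iff)
  qed
qed

lemma adjoint_on_support:
  assumes "operator_on (orth_compl kernel) X'" "\<And>x y. cinner (X x) y = cinner x (X' y)"
  shows "adjoint_on (orth_compl kernel) X = X'"
  unfolding adjoint_on_def
proof (rule the_equality)
  let ?M = "orth_compl kernel"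
  fix Y assume Y: "operator_on ?M Y \<and> (\<forall>x\<in>?M. \<forall>y\<in>?M. cinner (X x) y = cinner x (Y y))"
  show "Y = X'"
  proof (rule support.operator_on_ext)
    fix y assume y: "y \<in> ?M"
    have mem: "Y y - X' y \<in> ?M"
      using support.operator_on_mem assms(1) Y by (intro support.diff_mem) auto
    have "cinner (Y y - X' y) (Y y - X' y) = 0"
      using Y y mem assms(2)[of "Y y - X' y" y] by (simp add: cinner_diff_right)
    then have "inner (Y y - X' y) (Y y - X' y) = 0" by (simp add: cinner_self)
    then show "Y y = X' y" by simp
  qed (use Y assms in auto)
qed (use assms in auto)

end

section \<open>The calculus of Pusz and Woronowicz\<close>

lemma positive_op_add:
  assumes "positive_op A" "positive_op B"
  shows "positive_op (\<lambda>x. A x + B x)"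
proof -
  interpret A: positive_op A by (rule assms(1))
  interpret B: positive_op B by (rule assms(2))
  show ?thesis
  proof (rule positive_op.intro)
    fix x y
    show "bounded_linear (\<lambda>x. A x + B x)"
      by (intro bounded_linear_add A.bounded_linear B.bounded_linear)
    show "complex_linear (\<lambda>x. A x + B x)"
      using A.complex_linear B.complex_linear by (simp add: complex_linear_def scaleC_add_right)
    show "inner (A x + B x) y = inner x (A y + B y)"
      by (simp add: inner_add_left inner_add_right A.symmetric B.symmetric)
    show "0 \<le> inner (A x + B x) x"
      using A.nonneg[of x] B.nonneg[of x] by (simp add: inner_add_left)
  qed
qed

lemma positive_op_scaleR:
  assumes "0 \<le> r"
  shows "positive_op (\<lambda>x :: 'a::chilbert_space. r *\<^sub>R x)"
  using assms
  by (intro positive_op.intro)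
     (auto simp: bounded_linear_scaleR_right complex_linear_def scaleC_scaleR_commute)

text \<open>The operator \<open>R\<close> that the definition assembles from adjoints and factors is determined by
  \<open>sqrt (A + B) * R * sqrt (A + B) = A\<close>.\<close>

definition pw_ratio :: "('a::chilbert_space \<Rightarrow> 'a) \<Rightarrow> ('a \<Rightarrow> 'a) \<Rightarrow> ('a \<Rightarrow> 'a) \<Rightarrow> bool" where
  "pw_ratio A T R \<longleftrightarrow> reduced_contraction (orth_compl {x. T x = 0}) R \<and>
     (\<forall>v t. inner (R (op_sqrt T v)) (op_sqrt T t) = inner (A v) t)"

text \<open>The two square roots are dominated by that of \<open>T\<close>, so they factor through it by contractions \<open>X\<close>
  and \<open>Y\<close>. The forms of \<open>X\<^sup>* X\<close> and \<open>Y\<^sup>* Y\<close> add up to that of the projection on the dense range of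
  \<open>sqrt T\<close>, hence everywhere, and the joint calculus becomes the calculus of \<open>R = X\<^sup>* X\<close> alone.\<close>

theorem exists_pw_ratio:
  assumes A: "positive_op A" and B: "positive_op B"
  defines "T \<equiv> \<lambda>x. A x + B x"
  obtains R where "pw_ratio A T R"
    "\<And>f. continuous_on {0..1} (\<lambda>t. f (t, 1 - t)) \<Longrightarrow>
      pw_calculus f A B = (\<lambda>x. op_sqrt T (complex_calculus R (\<lambda>t. f (t, 1 - t)) (op_sqrt T x)))"
proof -
  interpret A: positive_op A by (rule A)
  interpret B: positive_op B by (rule B)
  interpret T: positive_op T unfolding T_def by (rule positive_op_add[OF A B])
  let ?Q = "op_sqrt T"
  interpret Q: positive_op ?Q by (rule T.positive_op_op_sqrt)
  define M where "M = orth_compl {x. A x + B x = 0}"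
  have M: "M = orth_compl T.kernel" by (simp only: M_def T.kernel_def) (simp add: T_def)
  interpret M: proj_subspace M unfolding M by (rule T.support.proj_subspace_axioms)
  have T_apply: "T x = A x + B x" for x by (simp add: T_def)
  have A_le: "inner (A x) x \<le> inner (T x) x" and B_le: "inner (B x) x \<le> inner (T x) x" for x
    using A.nonneg[of x] B.nonneg[of x] by (simp_all add: T_def inner_add_left)
  note sqrt_A = T.sqrt_on_support[OF A A_le, folded M]
  note sqrt_B = T.sqrt_on_support[OF B B_le, folded M]
  note sqrt_T = T.sqrt_on_support[OF T.positive_op_axioms order_refl, folded M]
  have parts: "part_on M A = A" "part_on M B = B"
    using M.operator_on_apply_proj[OF sqrt_A(2)] M.operator_on_apply_proj[OF sqrt_B(2)]
      A.op_sqrt_op_sqrt B.op_sqrt_op_sqrt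
    by (metis part_on_def ext)+
  obtain X X' where X: "contraction_on M X" "operator_on M X'" "\<And>x. norm (X x) \<le> norm x"
    "\<And>x y. cinner (X x) y = cinner x (X' y)" "\<And>x. X (?Q x) = op_sqrt A x"
    using T.contraction_factor[OF A.positive_op_op_sqrt sqrt_A(3), folded M] by metis
  obtain Y Y' where Y: "contraction_on M Y" "operator_on M Y'" "\<And>x. norm (Y x) \<le> norm x"
    "\<And>x y. cinner (Y x) y = cinner x (Y' y)" "\<And>x. Y (?Q x) = op_sqrt B x"
    using T.contraction_factor[OF B.positive_op_op_sqrt sqrt_B(3), folded M] by metis
  have the_factor: "(THE Z. contraction_on M Z \<and> Z \<circ> ?Q = G) = Z"
    if "contraction_on M Z" "\<And>x. Z (?Q x) = G x" for Z G
  proof (rule the_equality)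
    fix W assume "contraction_on M W \<and> W \<circ> ?Q = G"
    then show "W = Z"
      using that by (intro T.support_operator_unique) (auto simp: contraction_on_def M fun_eq_iff)
  qed (use that in auto)
  have the_X: "(THE Z. contraction_on M Z \<and> Z \<circ> ?Q = op_sqrt A) = X"
    and the_Y: "(THE Z. contraction_on M Z \<and> Z \<circ> ?Q = op_sqrt B) = Y"
    using the_factor X(1,5) Y(1,5) by blast+
  have adj: "adjoint_on M X = X'" "adjoint_on M Y = Y'"
    using T.adjoint_on_support X(2,4) Y(2,4) unfolding M by blast+
  define R where "R = X' \<circ> X"
  have X_op: "operator_on M X" and Y_op: "operator_on M Y"
    using X(1) Y(1) by (auto simp: contraction_on_def)
  have op_comp: "operator_on M (Z' \<circ> Z)" if "operator_on M Z'" "operator_on M Z" for Z Z'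
    using that linear_0[OF bounded_linear.linear]
    by (auto simp: operator_on_def o_def bounded_linear_compose)
  have XX: "cinner (X' (X x)) y = cinner (X x) (X y)" "cinner (Y' (Y x)) y = cinner (Y x) (Y y)" for x y
    using X(4)[of y "X x"] Y(4)[of y "Y x"] cinner_commute by metis+
  have R_form: "inner (R x) y = inner (X x) (X y)" for x y
    by (simp only: R_def o_apply inner_eq_Re_cinner XX)
  have "pos_contraction R"
  proof (rule pos_contraction.intro)
    fix x y
    show "bounded_linear R" using op_comp[OF X(2) X_op] by (simp add: R_def operator_on_def)
    show "inner (R x) y = inner x (R y)" by (metis R_form inner_commute)
    show "0 \<le> inner (R x) x" by (simp add: R_form)
    show "inner (R x) x \<le> inner x x"
      unfolding R_form dot_square_norm by (intro power_mono X(3)) simp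
  qed
  then have red: "reduced_contraction M R"
    using op_comp[OF X(2) X_op] M.proj_subspace_axioms
    by (intro reduced_contraction.intro reduced_contraction_axioms.intro) (simp_all add: R_def)
  \<comment> \<open>On the range of \<open>?Q\<close> the forms of \<open>X* X\<close> and \<open>Y* Y\<close> are those of \<open>A\<close> and \<open>B\<close>.\<close>
  have sum_form: "inner (X x) (X x) + inner (Y x) (Y x) = inner x x" if x: "x \<in> M" for x
  proof (rule LIMSEQ_unique)
    let ?q = "\<lambda>n. ?Q (T.inv_sqrt_op n x)"
    have q: "?q \<longlonglongrightarrow> x" using T.support_dense x by (simp add: M)
    have "bounded_linear X" "bounded_linear Y" using X_op Y_op by (auto simp: operator_on_def)
    then show "(\<lambda>n. inner (X (?q n)) (X (?q n)) + inner (Y (?q n)) (Y (?q n)))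
        \<longlonglongrightarrow> inner (X x) (X x) + inner (Y x) (Y x)"
      by (intro tendsto_intros bounded_linear.tendsto[where f = X] bounded_linear.tendsto[where f = Y] q)
    have "inner (X (?Q v)) (X (?Q v)) + inner (Y (?Q v)) (Y (?Q v)) = inner (?Q v) (?Q v)" for v
      using A.norm_op_sqrt[of v] B.norm_op_sqrt[of v] T.norm_op_sqrt[of v]
      by (simp add: X(5) Y(5) dot_square_norm T_apply inner_add_left)
    then show "(\<lambda>n. inner (X (?q n)) (X (?q n)) + inner (Y (?q n)) (Y (?q n))) \<longlonglongrightarrow> inner x x"
      using tendsto_inner[OF q q] by simp
  qed
  have "(\<lambda>x. R x + (Y' \<circ> Y) x) = proj M"
  proof (rule M.operator_on_eq_if_forms_eq)
    show "operator_on M (\<lambda>x. R x + (Y' \<circ> Y) x)"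
      unfolding R_def by (intro M.operator_on_add op_comp X(2) Y(2) X_op Y_op)
    fix x assume x: "x \<in> M"
    show "cinner (R x + (Y' \<circ> Y) x) x = cinner (proj M x) x"
      using sum_form[OF x]
      by (simp add: R_def cinner_add_left XX cinner_self M.proj_id[OF x] flip: of_real_add)
  qed (rule M.operator_on_proj)
  then have S: "Y' \<circ> Y = (\<lambda>x. proj M x - R x)"
    by (metis (no_types, lifting) add_diff_cancel_left' ext)
  have "pw_ratio A T R"
    unfolding pw_ratio_def
  proof (intro conjI allI)
    show "reduced_contraction (orth_compl {x. T x = 0}) R" using red by (simp add: M_def T_def)
    fix v t
    have "inner (R (?Q v)) (?Q t) = inner (op_sqrt A v) (op_sqrt A t)" by (simp add: R_form X(5))
    also have "\<dots> = inner (A v) t"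
      by (simp add: A.op_sqrt_op_sqrt flip: positive_op.symmetric[OF A.positive_op_op_sqrt])
    finally show "inner (R (?Q v)) (?Q t) = inner (A v) t" .
  qed
  moreover have "pw_calculus f A B = (\<lambda>x. ?Q (complex_calculus R (\<lambda>t. f (t, 1 - t)) (?Q x)))"
    if f: "continuous_on {0..1} (\<lambda>t. f (t, 1 - t))" for f
  proof -
    have Tdef: "(\<lambda>x. A x + B x) = T" by (simp add: T_def)
    have "pw_calculus f A B = ?Q \<circ> joint_calculus_on M f R (Y' \<circ> Y) \<circ> ?Q"
      unfolding pw_calculus_def Let_def M_def[symmetric] parts Tdef sqrt_T(1) sqrt_A(1) sqrt_B(1)
        the_X the_Y adj R_def ..
    also have "\<dots> = (\<lambda>x. ?Q (complex_calculus R (\<lambda>t. f (t, 1 - t)) (?Q x)))"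
      unfolding S reduced_contraction.joint_calculus_eq_complex_calculus[OF red f]
      by (simp add: fun_eq_iff M.proj_id[OF M.operator_on_mem[OF sqrt_T(2)]])
    finally show ?thesis .
  qed
  ultimately show ?thesis using that by blast
qed

section \<open>Continuity of the ingredients at zero\<close>

text \<open>Strong convergence of a uniformly bounded family allows the vector to vary as well.\<close>

lemma tendsto_apply_bounded_family:
  fixes S :: "'i \<Rightarrow> 'a::real_normed_vector \<Rightarrow> 'a"
  assumes S: "\<forall>\<^sub>F i in F. linear (S i) \<and> (\<forall>z. norm (S i z) \<le> K * norm z)"
    and y: "((\<lambda>i. S i y) \<longlongrightarrow> l) F" and z: "(z \<longlongrightarrow> y) F"
  shows "((\<lambda>i. S i (z i)) \<longlongrightarrow> l) F"
proof -
  have "((\<lambda>i. S i (z i) - S i y) \<longlongrightarrow> 0) F"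
  proof (rule Lim_null_comparison)
    show "\<forall>\<^sub>F i in F. norm (S i (z i) - S i y) \<le> K * norm (z i - y)"
      using S by eventually_elim (metis linear_diff)
    have "((\<lambda>i. K * norm (z i - y)) \<longlongrightarrow> K * norm (y - y)) F"
      by (intro tendsto_intros z)
    then show "((\<lambda>i. K * norm (z i - y)) \<longlongrightarrow> 0) F" by simp
  qed
  from tendsto_add[OF this y] show ?thesis by simp
qed

text \<open>\<open>T + e\<close> is a function of \<open>T\<close>, so its square root is too, and the two square roots can be compared
  as functions.\<close>

lemma norm_op_sqrt_shift_le:
  assumes "positive_op T" "0 \<le> e"
  shows "norm (op_sqrt (\<lambda>x. T x + e *\<^sub>R x) x - op_sqrt T x) \<le> sqrt e * norm x"
proof -
  interpret T: positive_op T by (rule assms(1))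
  have "positive_op (\<lambda>x. T x + e *\<^sub>R x)"
    by (intro positive_op_add assms(1) positive_op_scaleR assms(2))
  then interpret Te: positive_op "\<lambda>x. T x + e *\<^sub>R x" .
  let ?g = "\<lambda>t. sqrt (t + e)"
  have c: "continuous_on {0..} ?g" by (intro continuous_intros)
  have "op_sqrt (\<lambda>x. T x + e *\<^sub>R x) = op_fun ?g T"
  proof (rule Te.op_sqrt_unique)
    show "positive_op (op_fun ?g T)"
      by (rule positive_op.intro)
         (use T.bounded_linear_op_fun[OF c] T.complex_linear_op_fun[OF c] T.op_fun_symmetric[OF c]
           T.op_fun_nonneg[OF c] assms(2) in auto)
    fix x
    have "op_fun ?g T (op_fun ?g T x) = op_fun (\<lambda>t. ?g t * ?g t) T x"
      by (rule T.op_fun_mult[OF c c, symmetric])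
    also have "op_fun (\<lambda>t. ?g t * ?g t) T = op_fun (\<lambda>t. t + e) T"
      by (rule T.op_fun_cong) (use assms(2) in simp)
    also have "op_fun (\<lambda>t. t + e) T x = T x + e *\<^sub>R x"
      using T.op_fun_add[of "\<lambda>t. t" "\<lambda>t. e" x] by (simp add: T.op_fun_id T.op_fun_const continuous_intros)
    finally show "op_fun ?g T (op_fun ?g T x) = T x + e *\<^sub>R x" .
  qed
  then have "op_sqrt (\<lambda>x. T x + e *\<^sub>R x) x - op_sqrt T x = op_fun (\<lambda>t. ?g t - sqrt t) T x"
    by (simp add: op_sqrt_def T.op_fun_diff[OF c T.continuous_sqrt])
  also have "norm \<dots> \<le> sqrt e * norm x"
  proof (rule T.norm_op_fun_le)
    show "continuous_on {0..} (\<lambda>t. ?g t - sqrt t)" by (intro continuous_intros)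
    fix t :: real assume "0 \<le> t"
    then show "\<bar>?g t - sqrt t\<bar> \<le> sqrt e"
      using assms(2) sqrt_add_le_add_sqrt[of t e] by (simp add: abs_le_iff)
  qed
  finally show ?thesis .
qed

text \<open>Testing against the dense range of \<open>sqrt (T + e)\<close> replaces inverting it.\<close>

lemma norm_le_if_tested:
  assumes T: "positive_op T" and e: "0 < e" "\<And>x. e * inner x x \<le> inner (T x) x"
    and test: "\<And>t. inner y (op_sqrt T t) \<le> K * norm (op_sqrt T t)" and K: "0 \<le> K"
  shows "norm y \<le> K"
proof -
  interpret T: positive_op T by (rule T)
  have "T.kernel = {0}"
  proof
    show "T.kernel \<subseteq> {0}"
    proof
      fix x assume "x \<in> T.kernel"
      then have "e * inner x x \<le> 0" using e(2)[of x] by (simp add: T.kernel_def)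
      then have "inner x x \<le> 0" using e(1) by (simp add: mult_le_0_iff)
      then show "x \<in> {0}" using inner_ge_zero[of x] inner_eq_zero_iff[of x] by auto
    qed
  qed (simp add: T.kernel_def linear_0[OF T.linear])
  then have "y \<in> orth_compl T.kernel" by (simp add: orth_compl_def)
  then have q: "(\<lambda>n. op_sqrt T (T.inv_sqrt_op n y)) \<longlonglongrightarrow> y" by (rule T.support_dense)
  have "inner y y \<le> K * norm y"
  proof (rule LIMSEQ_le)
    show "(\<lambda>n. inner y (op_sqrt T (T.inv_sqrt_op n y))) \<longlonglongrightarrow> inner y y"
      by (intro tendsto_intros q)
    show "(\<lambda>n. K * norm (op_sqrt T (T.inv_sqrt_op n y))) \<longlonglongrightarrow> K * norm y"
      by (intro tendsto_intros q)
  qed (use test in blast)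
  then have "norm y * norm y \<le> K * norm y" by (simp add: dot_square_norm power2_eq_square)
  with K show ?thesis by (cases "y = 0") auto
qed

text \<open>With \<open>Q = sqrt T\<close> and \<open>Q' = sqrt (T + e)\<close>, the relations \<open>Q R Q = A\<close> and \<open>Q' R' Q' = A + e1\<close> give
  \<open>Q' (R' Q' v - Q' u) = Q (R Q v - Q u) + e1 v - e u\<close>. Here \<open>Q\<close> and \<open>sqrt e\<close> are dominated by \<open>Q'\<close>, so
  \<open>R' Q' v - Q' u\<close> is bounded by \<open>\<parallel>R Q v - Q u\<parallel> + sqrt e (\<parallel>v\<parallel> + \<parallel>u\<parallel>)\<close>, although the inverse of \<open>Q'\<close>
  may grow as \<open>e\<close> tends to \<open>0\<close>. The other terms compare \<open>Q'\<close> with \<open>Q\<close> and \<open>w\<close> with \<open>Q v\<close>.\<close>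

lemma norm_pw_ratio_shift_diff_le:
  assumes T: "positive_op T" and R: "pw_ratio A T R"
    and e: "0 < e" "0 \<le> e1" "e1 \<le> e"
    and R': "pw_ratio (\<lambda>x. A x + e1 *\<^sub>R x) (\<lambda>x. T x + e *\<^sub>R x) R'"
  shows "norm (R' w - R w) \<le> 2 * norm (w - op_sqrt T v) + 2 * norm (R (op_sqrt T v) - op_sqrt T u)
    + sqrt e * (2 * (norm v + norm u))"
proof -
  let ?T' = "\<lambda>x. T x + e *\<^sub>R x"
  let ?Q = "op_sqrt T" and ?Q' = "op_sqrt ?T'"
  have e0: "0 \<le> e" using e by simp
  interpret T: positive_op T by (rule T)
  interpret T': positive_op ?T' by (intro positive_op_add T positive_op_scaleR e0)
  interpret Q': positive_op ?Q' by (rule T'.positive_op_op_sqrt)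
  interpret R: reduced_contraction "orth_compl {x. T x = 0}" R using R by (simp add: pw_ratio_def)
  interpret R': reduced_contraction "orth_compl {x. ?T' x = 0}" R' using R' by (simp add: pw_ratio_def)
  have norm_Q': "(norm (?Q' t))\<^sup>2 = (norm (?Q t))\<^sup>2 + e * (norm t)\<^sup>2" for t
    by (simp only: T'.norm_op_sqrt T.norm_op_sqrt inner_add_left inner_scaleR_left dot_square_norm)
  have Q_le: "norm (?Q t) \<le> norm (?Q' t)" for t
    using e0 by (intro power2_le_imp_le[of "norm (?Q t)"]) (simp_all add: norm_Q')
  have t_le: "sqrt e * norm t \<le> norm (?Q' t)" for t
    using e0 by (intro power2_le_imp_le[of "sqrt e * norm t"]) (simp_all add: norm_Q' power_mult_distrib)
  define d where "d = norm (R (?Q v) - ?Q u)"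
  have key: "norm (R' (?Q' v) - ?Q' u) \<le> d + sqrt e * (norm v + norm u)"
  proof (rule norm_le_if_tested[OF T'.positive_op_axioms e(1)])
    show "e * inner x x \<le> inner (T x + e *\<^sub>R x) x" for x
      using T.nonneg[of x] by (simp add: inner_add_left)
    show "0 \<le> d + sqrt e * (norm v + norm u)" using e0 by (simp add: d_def)
    fix t
    have "inner (R' (?Q' v) - ?Q' u) (?Q' t) = inner (A v + e1 *\<^sub>R v) t - inner (T u + e *\<^sub>R u) t"
      using R' Q'.symmetric[of "?Q' u" t] by (simp add: pw_ratio_def inner_diff_left T'.op_sqrt_op_sqrt)
    also have "\<dots> = (inner (A v) t - inner (T u) t) + inner (e1 *\<^sub>R v - e *\<^sub>R u) t"
      by (simp add: inner_add_left inner_diff_left)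
    also have "inner (A v) t - inner (T u) t = inner (R (?Q v) - ?Q u) (?Q t)"
      using R positive_op.symmetric[OF T.positive_op_op_sqrt, of "?Q u" t]
      by (simp add: pw_ratio_def inner_diff_left T.op_sqrt_op_sqrt)
    also have "inner (R (?Q v) - ?Q u) (?Q t) \<le> d * norm (?Q' t)"
      unfolding d_def by (rule order_trans[OF norm_cauchy_schwarz mult_left_mono[OF Q_le]]) simp
    also have "inner (e1 *\<^sub>R v - e *\<^sub>R u) t \<le> (sqrt e * (norm v + norm u)) * norm (?Q' t)"
    proof -
      have "norm (e1 *\<^sub>R v - e *\<^sub>R u) \<le> e1 * norm v + e * norm u"
        using norm_triangle_ineq4[of "e1 *\<^sub>R v" "e *\<^sub>R u"] e by simp
      also have "\<dots> \<le> e * (norm v + norm u)"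
        using mult_right_mono[OF e(3), of "norm v"] by (simp add: distrib_left)
      finally have "norm (e1 *\<^sub>R v - e *\<^sub>R u) * norm t \<le> e * (norm v + norm u) * norm t"
        by (rule mult_right_mono) simp
      also have "\<dots> = sqrt e * (norm v + norm u) * (sqrt e * norm t)"
        using e0 real_sqrt_mult_self[of e] by (simp only: abs_of_nonneg mult_ac) (simp flip: mult.assoc)
      also have "\<dots> \<le> sqrt e * (norm v + norm u) * norm (?Q' t)"
        using e0 by (intro mult_left_mono t_le) simp
      finally show ?thesis using norm_cauchy_schwarz[of "e1 *\<^sub>R v - e *\<^sub>R u" t] by linarith
    qed
    finally show "inner (R' (?Q' v) - ?Q' u) (?Q' t) \<le> (d + sqrt e * (norm v + norm u)) * norm (?Q' t)"
      by (simp add: distrib_right)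
  qed
  have shift: "norm (?Q' x - ?Q x) \<le> sqrt e * norm x" for x
    by (rule norm_op_sqrt_shift_le[OF T e0])
  have eq: "R' w - R w = R' (w - ?Q v) - R' (?Q' v - ?Q v) + (R' (?Q' v) - ?Q' u) + (?Q' u - ?Q u)
      - (R (?Q v) - ?Q u) - R (w - ?Q v)"
    by (simp add: linear_diff[OF R.linear] linear_diff[OF R'.linear])
  have six: "norm (a - b + c + d - r - s) \<le> norm a + norm b + norm c + norm d + norm r + norm s"
    for a b c d r s :: 'a
    using norm_triangle_ineq4[of a b] norm_triangle_ineq[of "a - b" c] norm_triangle_ineq[of "a - b + c" d]
      norm_triangle_ineq4[of "a - b + c + d" r] norm_triangle_ineq4[of "a - b + c + d - r" s] by linarith
  have "norm (R' w - R w) \<le> norm (R' (w - ?Q v)) + norm (R' (?Q' v - ?Q v)) + norm (R' (?Q' v) - ?Q' u)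
      + norm (?Q' u - ?Q u) + norm (R (?Q v) - ?Q u) + norm (R (w - ?Q v))"
    unfolding eq by (rule six)
  also have "\<dots> \<le> norm (w - ?Q v) + sqrt e * norm v + (d + sqrt e * (norm v + norm u))
      + sqrt e * norm u + d + norm (w - ?Q v)"
    using R'.norm_le[of "w - ?Q v"] order_trans[OF R'.norm_le shift[of v]] key shift[of u] R.norm_le[of "w - ?Q v"]
    unfolding d_def by linarith
  finally show ?thesis by (simp add: d_def algebra_simps)
qed

text \<open>Choose \<open>v\<close> with \<open>sqrt T v\<close> close to \<open>w\<close>, and then \<open>u\<close> with \<open>sqrt T u\<close> close to \<open>R (sqrt T v)\<close>; both
  are fixed before \<open>e\<close> tends to \<open>0\<close>.\<close>

lemma pw_ratio_shift_tendsto: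
  assumes T: "positive_op T" and R: "pw_ratio A T R" and w: "w \<in> orth_compl {x. T x = 0}"
    and e: "(e \<longlongrightarrow> 0) F"
    and R': "\<forall>\<^sub>F i in F. 0 < e i \<and> 0 \<le> e1 i \<and> e1 i \<le> e i \<and>
      pw_ratio (\<lambda>x. A x + e1 i *\<^sub>R x) (\<lambda>x. T x + e i *\<^sub>R x) (R' i)"
  shows "((\<lambda>i. R' i w) \<longlongrightarrow> R w) F"
proof (rule tendstoI)
  fix d :: real assume d: "0 < d"
  interpret T: positive_op T by (rule T)
  interpret R: reduced_contraction "orth_compl {x. T x = 0}" R using R by (simp add: pw_ratio_def)
  have dense: "\<exists>v. norm (y - op_sqrt T v) < d / 8" if "y \<in> orth_compl {x. T x = 0}" for y
  proof -
    have "(\<lambda>n. op_sqrt T (T.inv_sqrt_op n y)) \<longlonglongrightarrow> y"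
      by (rule T.support_dense) (use that in \<open>simp add: T.kernel_def\<close>)
    then have "\<forall>\<^sub>F n in sequentially. dist (op_sqrt T (T.inv_sqrt_op n y)) y < d / 8"
      using d by (intro tendstoD) simp_all
    then show ?thesis
      by (metis (no_types, lifting) dist_commute dist_norm eventually_happens sequentially_bot)
  qed
  obtain v where v: "norm (w - op_sqrt T v) < d / 8" using dense[OF w] by blast
  obtain u where u: "norm (R (op_sqrt T v) - op_sqrt T u) < d / 8"
    using dense[OF R.operator_on_mem[OF R.op]] by blast
  have "((\<lambda>i. sqrt (e i) * (2 * (norm v + norm u))) \<longlongrightarrow> sqrt 0 * (2 * (norm v + norm u))) F"
    by (intro tendsto_intros e)
  then have "\<forall>\<^sub>F i in F. dist (sqrt (e i) * (2 * (norm v + norm u))) 0 < d / 2"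
    using d by (intro tendstoD) simp_all
  with R' show "\<forall>\<^sub>F i in F. dist (R' i w) (R w) < d"
  proof eventually_elim
    case (elim i)
    then have "norm (R' i w - R w) \<le> 2 * norm (w - op_sqrt T v) + 2 * norm (R (op_sqrt T v) - op_sqrt T u)
        + sqrt (e i) * (2 * (norm v + norm u))"
      using norm_pw_ratio_shift_diff_le[OF T R] by blast
    moreover have "sqrt (e i) * (2 * (norm v + norm u)) < d / 2"
      using elim(2) by (simp add: dist_real_def abs_less_iff)
    ultimately show ?case using v u by (simp add: dist_norm)
  qed
qed

section \<open>Passage to continuous functions and the limit\<close>

context reduced_contraction
begin

lemma poly_op_mem: "w \<in> M \<Longrightarrow> poly_op R p w \<in> M"
  by (induction p) (auto simp: zero_mem op_simps(7) intro!: add_mem scaleR_mem operator_on_mem[OF op])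

lemma poly_op_tendsto:
  assumes R': "\<forall>\<^sub>F i in F. pos_contraction (R' i)"
    and lim: "\<And>w. w \<in> M \<Longrightarrow> ((\<lambda>i. R' i w) \<longlongrightarrow> R w) F" and w: "w \<in> M"
  shows "((\<lambda>i. poly_op (R' i) p w) \<longlongrightarrow> poly_op R p w) F"
proof (induction p)
  case (pCons a p)
  have "\<forall>\<^sub>F i in F. linear (R' i) \<and> (\<forall>z. norm (R' i z) \<le> 1 * norm z)"
    using R' by eventually_elim (simp add: pos_contraction.linear pos_contraction.norm_le)
  from tendsto_apply_bounded_family[OF this lim[OF poly_op_mem[OF w, of p]] pCons(2)]
  have "((\<lambda>i. a *\<^sub>R w + R' i (poly_op (R' i) p w)) \<longlongrightarrow> a *\<^sub>R w + R (poly_op R p w)) F"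
    by (intro tendsto_intros)
  moreover have "\<forall>\<^sub>F i in F. a *\<^sub>R w + R' i (poly_op (R' i) p w) = poly_op (R' i) (pCons a p) w"
    using R' by eventually_elim (simp add: poly_op_pCons pos_contraction.linear)
  ultimately show ?case by (simp add: op_simps(7) Lim_transform_eventually)
qed simp

lemma cont_calculus_tendsto:
  assumes R': "\<forall>\<^sub>F i in F. pos_contraction (R' i)"
    and lim: "\<And>w. w \<in> M \<Longrightarrow> ((\<lambda>i. R' i w) \<longlongrightarrow> R w) F" and w: "w \<in> M"
    and g: "continuous_on {0..1} g"
  shows "((\<lambda>i. cont_calculus (R' i) g w) \<longlongrightarrow> cont_calculus R g w) F"
proof (rule tendstoI)
  fix d :: real assume d: "0 < d"
  then have "0 < d / 2" by simp
  then obtain c where c: "0 < c" "c * (2 * norm w) < d / 2"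
    using small_multiple[of "2 * norm w" "d / 2"] by auto
  from bernstein_poly_uniform[OF g c(1)] obtain N where
    N: "\<And>n t. N \<le> n \<Longrightarrow> 0 \<le> t \<Longrightarrow> t \<le> 1 \<Longrightarrow> \<bar>g t - poly (bernstein_poly n g) t\<bar> < c" by blast
  define p where "p = bernstein_poly N g"
  have p: "\<bar>g t - poly p t\<bar> \<le> c" if "0 \<le> t" "t \<le> 1" for t
    using N[OF order_refl that] by (simp add: p_def)
  have "\<forall>\<^sub>F i in F. dist (poly_op (R' i) p w) (poly_op R p w) < d / 2"
    using d by (intro tendstoD poly_op_tendsto R' lim w) simp_all
  with R' show "\<forall>\<^sub>F i in F. dist (cont_calculus (R' i) g w) (cont_calculus R g w) < d"
  proof eventually_elim
    case (elim i)
    have "norm (cont_calculus (R' i) g w - poly_op (R' i) p w) \<le> c * norm w"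
      by (rule pos_contraction.norm_cont_calculus_diff_poly_le[OF elim(1) g p])
    moreover have "norm (cont_calculus R g w - poly_op R p w) \<le> c * norm w"
      by (rule norm_cont_calculus_diff_poly_le[OF g p])
    moreover have "dist (cont_calculus (R' i) g w) (cont_calculus R g w)
        \<le> norm (cont_calculus (R' i) g w - poly_op (R' i) p w) + dist (poly_op (R' i) p w) (poly_op R p w)
          + norm (cont_calculus R g w - poly_op R p w)"
      using dist_triangle[of "cont_calculus (R' i) g w" "cont_calculus R g w" "poly_op (R' i) p w"]
        dist_triangle[of "poly_op (R' i) p w" "cont_calculus R g w" "poly_op R p w"]
      by (simp add: dist_norm norm_minus_commute)
    ultimately show ?case using elim(2) c(2) by (simp add: algebra_simps)
  qed
qed

end

theorem theorem6:
  fixes A B :: "'a::chilbert_space \<Rightarrow> 'a"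
    and f :: "real \<times> real \<Rightarrow> complex"
  assumes "positive_on UNIV A" and "positive_on UNIV B"
    and "continuous_on ({0..} \<times> {0..}) f" and "homogeneous f"
  shows "\<forall>x. ((\<lambda>(e1, e2). pw_calculus f (\<lambda>y. A y + e1 *\<^sub>R y) (\<lambda>y. B y + e2 *\<^sub>R y) x)
            \<longlongrightarrow> pw_calculus f A B x) (at (0, 0) within {0..} \<times> {0..})"
proof
  fix x
  let ?F = "at (0 :: real, 0 :: real) within {0..} \<times> {0..}"
  define h where "h t = f (t, 1 - t)" for t
  have h: "continuous_on {0..1} h"
    unfolding h_def by (rule continuous_on_compose2[OF assms(3)]) (auto intro!: continuous_intros)
  have A: "positive_op A" and B: "positive_op B"
    using assms(1,2) by (simp_all add: positive_on_UNIV_imp_positive_op)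
  define T where "T = (\<lambda>x. A x + B x)"
  have T: "positive_op T" unfolding T_def by (rule positive_op_add[OF A B])
  interpret T: positive_op T by (rule T)
  obtain R where R: "pw_ratio A T R"
    and pw_all: "\<And>f. continuous_on {0..1} (\<lambda>t. f (t, 1 - t)) \<Longrightarrow>
      pw_calculus f A B = (\<lambda>x. op_sqrt T (complex_calculus R (\<lambda>t. f (t, 1 - t)) (op_sqrt T x)))"
    using exists_pw_ratio[OF A B, folded T_def] by blast
  have pw: "pw_calculus f A B = (\<lambda>x. op_sqrt T (complex_calculus R h (op_sqrt T x)))"
    using pw_all[of f] h by (simp only: h_def[abs_def])
  interpret R: reduced_contraction "orth_compl {x. T x = 0}" R using R by (simp add: pw_ratio_def)
  let ?T = "\<lambda>e x. T x + (fst e + snd e) *\<^sub>R x"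
  have shifted: "\<exists>R. pw_ratio (\<lambda>y. A y + fst e *\<^sub>R y) (?T e) R \<and>
      pw_calculus f (\<lambda>y. A y + fst e *\<^sub>R y) (\<lambda>y. B y + snd e *\<^sub>R y)
        = (\<lambda>x. op_sqrt (?T e) (complex_calculus R h (op_sqrt (?T e) x)))"
    if e: "0 \<le> fst e" "0 \<le> snd e" for e
  proof -
    have sum: "(\<lambda>x. (A x + fst e *\<^sub>R x) + (B x + snd e *\<^sub>R x)) = ?T e"
      by (simp add: T_def fun_eq_iff algebra_simps)
    have "positive_op (\<lambda>y. A y + fst e *\<^sub>R y)" "positive_op (\<lambda>y. B y + snd e *\<^sub>R y)"
      by (intro positive_op_add A B positive_op_scaleR e)+
    from exists_pw_ratio[OF this, unfolded sum] obtain R where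
      "pw_ratio (\<lambda>y. A y + fst e *\<^sub>R y) (?T e) R"
      "\<And>f. continuous_on {0..1} (\<lambda>t. f (t, 1 - t)) \<Longrightarrow>
        pw_calculus f (\<lambda>y. A y + fst e *\<^sub>R y) (\<lambda>y. B y + snd e *\<^sub>R y)
          = (\<lambda>x. op_sqrt (?T e) (complex_calculus R (\<lambda>t. f (t, 1 - t)) (op_sqrt (?T e) x)))"
      by blast
    from this(1) this(2)[of f] h show ?thesis
      unfolding h_def[abs_def] by blast
  qed
  define R' where "R' e = (SOME R. pw_ratio (\<lambda>y. A y + fst e *\<^sub>R y) (?T e) R \<and>
      pw_calculus f (\<lambda>y. A y + fst e *\<^sub>R y) (\<lambda>y. B y + snd e *\<^sub>R y)
        = (\<lambda>x. op_sqrt (?T e) (complex_calculus R h (op_sqrt (?T e) x))))" for e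
  have R': "pw_ratio (\<lambda>y. A y + fst e *\<^sub>R y) (?T e) (R' e)"
    and pw': "pw_calculus f (\<lambda>y. A y + fst e *\<^sub>R y) (\<lambda>y. B y + snd e *\<^sub>R y)
        = (\<lambda>x. op_sqrt (?T e) (complex_calculus (R' e) h (op_sqrt (?T e) x)))"
    if "0 \<le> fst e" "0 \<le> snd e" for e
    using someI_ex[OF shifted[OF that]] unfolding R'_def by blast+
  \<comment> \<open>The filter excludes the origin, so \<open>A + B + e1 + e2\<close> is bounded below along it.\<close>
  have ev: "\<forall>\<^sub>F e in ?F. 0 \<le> fst e \<and> 0 \<le> snd e \<and> 0 < fst e + snd e"
    unfolding eventually_at_filter by (rule always_eventually) (auto simp: prod_eq_iff)
  have lim_e: "((\<lambda>e. fst e + snd e) \<longlongrightarrow> 0) ?F"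
    using tendsto_add[OF tendsto_fst[OF tendsto_ident_at] tendsto_snd[OF tendsto_ident_at], of "(0, 0)" "{0..} \<times> {0..}"]
    by simp
  have ev_ratio: "\<forall>\<^sub>F e in ?F. 0 < fst e + snd e \<and> 0 \<le> fst e \<and> fst e \<le> fst e + snd e \<and>
      pw_ratio (\<lambda>x. A x + fst e *\<^sub>R x) (?T e) (R' e)"
    using ev by eventually_elim (simp add: R')
  have lim_R: "((\<lambda>e. R' e w) \<longlongrightarrow> R w) ?F" if "w \<in> orth_compl {x. T x = 0}" for w
    by (rule pw_ratio_shift_tendsto[OF T R that lim_e ev_ratio])
  have pc: "\<forall>\<^sub>F e in ?F. complex_contraction (R' e)"
    using ev
  proof eventually_elim
    case (elim e)
    then have "reduced_contraction (orth_compl {x. ?T e x = 0}) (R' e)"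
      using R' by (simp add: pw_ratio_def)
    then interpret reduced_contraction "orth_compl {x. ?T e x = 0}" "R' e" .
    show ?case by (rule complex_contraction_axioms)
  qed
  then have pc': "\<forall>\<^sub>F e in ?F. pos_contraction (R' e)"
    by eventually_elim (simp add: complex_contraction_def)
  have op_sqrt_lim: "((\<lambda>e. op_sqrt (?T e) y) \<longlongrightarrow> op_sqrt T y) ?F" for y
  proof -
    have "((\<lambda>e. op_sqrt (?T e) y - op_sqrt T y) \<longlongrightarrow> 0) ?F"
    proof (rule Lim_null_comparison)
      show "\<forall>\<^sub>F e in ?F. norm (op_sqrt (?T e) y - op_sqrt T y) \<le> sqrt (fst e + snd e) * norm y"
        using ev by eventually_elim (intro norm_op_sqrt_shift_le T, simp)
      have "((\<lambda>e. sqrt (fst e + snd e) * norm y) \<longlongrightarrow> sqrt 0 * norm y) ?F"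
        by (intro tendsto_mult tendsto_real_sqrt lim_e tendsto_const)
      then show "((\<lambda>e. sqrt (fst e + snd e) * norm y) \<longlongrightarrow> 0) ?F" by simp
    qed
    from tendsto_add[OF this tendsto_const[of "op_sqrt T y"]] show ?thesis by simp
  qed
  have Q_mem: "op_sqrt T y \<in> orth_compl {x. T x = 0}" for y
    using T.op_sqrt_mem[of y] by (simp add: T.kernel_def)
  obtain c where c: "\<And>t. t \<in> {0..1} \<Longrightarrow> \<bar>Re (h t)\<bar> \<le> c" "\<And>t. t \<in> {0..1} \<Longrightarrow> \<bar>Im (h t)\<bar> \<le> c"
  proof -
    obtain a b where "\<And>t. t \<in> {0..1} \<Longrightarrow> \<bar>Re (h t)\<bar> \<le> a" "\<And>t. t \<in> {0..1} \<Longrightarrow> \<bar>Im (h t)\<bar> \<le> b"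
      using bounded_on_unit_interval[OF R.continuous_Re_Im(1)[OF h]]
        bounded_on_unit_interval[OF R.continuous_Re_Im(2)[OF h]] by metis
    then show thesis by (intro that[of "max a b"]) (auto simp: le_max_iff_disj)
  qed
  have inner_lim: "((\<lambda>e. complex_calculus (R' e) h (op_sqrt (?T e) x)) \<longlongrightarrow> complex_calculus R h (op_sqrt T x)) ?F"
  proof (rule tendsto_apply_bounded_family[OF _ _ op_sqrt_lim[of x]])
    show "((\<lambda>e. complex_calculus (R' e) h (op_sqrt T x)) \<longlongrightarrow> complex_calculus R h (op_sqrt T x)) ?F"
      unfolding complex_calculus_def
      by (intro tendsto_add bounded_linear.tendsto[OF bounded_linear_scaleC]
          R.cont_calculus_tendsto[OF pc' lim_R Q_mem] R.continuous_Re_Im h)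
    show "\<forall>\<^sub>F e in ?F. linear (complex_calculus (R' e) h) \<and>
        (\<forall>z. norm (complex_calculus (R' e) h z) \<le> (c + c) * norm z)"
      using pc
    proof eventually_elim
      case (elim e)
      interpret R': complex_contraction "R' e" by (rule elim)
      note c' = R'.continuous_Re_Im[OF h]
      have "norm (complex_calculus (R' e) h z) \<le> (c + c) * norm z" for z
      proof -
        have re: "norm (cont_calculus (R' e) (\<lambda>t. Re (h t)) z) \<le> c * norm z"
          using c(1) by (intro R'.norm_cont_calculus_le c') simp
        have im: "norm (cont_calculus (R' e) (\<lambda>t. Im (h t)) z) \<le> c * norm z"
          using c(2) by (intro R'.norm_cont_calculus_le c') simp
        have "norm (\<i> *\<^sub>C y) = norm y" for y :: 'a
          using inner_i_i[of y y] by (simp add: norm_eq_sqrt_inner)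
        then show ?thesis
          unfolding complex_calculus_def distrib_right
          by (intro norm_triangle_le add_mono) (use re im in simp_all)
      qed
      then show ?case
        using bounded_linear.linear[OF R'.bounded_linear_complex_calculus[OF h]] by blast
    qed
  qed
  obtain K where K: "\<And>y. norm (op_sqrt T y) \<le> norm y * K"
    using bounded_linear.bounded[OF positive_op.bounded_linear[OF T.positive_op_op_sqrt]] by blast
  have "((\<lambda>e. op_sqrt (?T e) (complex_calculus (R' e) h (op_sqrt (?T e) x)))
      \<longlongrightarrow> op_sqrt T (complex_calculus R h (op_sqrt T x))) ?F"
  proof (rule tendsto_apply_bounded_family[OF _ op_sqrt_lim inner_lim])
    have "((\<lambda>e. sqrt (fst e + snd e)) \<longlongrightarrow> sqrt 0) ?F" by (intro tendsto_real_sqrt lim_e)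
    then have "\<forall>\<^sub>F e in ?F. sqrt (fst e + snd e) < 1" by (rule order_tendstoD) simp
    with ev show "\<forall>\<^sub>F e in ?F. linear (op_sqrt (?T e)) \<and> (\<forall>z. norm (op_sqrt (?T e) z) \<le> (1 + K) * norm z)"
    proof eventually_elim
      case (elim e)
      have Te: "positive_op (?T e)" using elim by (intro positive_op_add T positive_op_scaleR) simp
      have "norm (op_sqrt (?T e) z) \<le> (1 + K) * norm z" for z
      proof -
        have "norm (op_sqrt (?T e) z - op_sqrt T z) \<le> sqrt (fst e + snd e) * norm z"
          using elim by (intro norm_op_sqrt_shift_le T) simp
        also have "\<dots> \<le> 1 * norm z" using elim(2) by (intro mult_right_mono) simp_all
        finally show ?thesis
          using norm_triangle_sub[of "op_sqrt (?T e) z" "op_sqrt T z"] K[of z] by (simp add: algebra_simps)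
      qed
      then show ?case
        using positive_op.linear[OF positive_op.positive_op_op_sqrt[OF Te]] by blast
    qed
  qed
  moreover have "\<forall>\<^sub>F e in ?F. op_sqrt (?T e) (complex_calculus (R' e) h (op_sqrt (?T e) x))
      = (\<lambda>(e1, e2). pw_calculus f (\<lambda>y. A y + e1 *\<^sub>R y) (\<lambda>y. B y + e2 *\<^sub>R y) x) e"
    using ev by eventually_elim (simp add: pw' case_prod_beta)
  ultimately show "((\<lambda>(e1, e2). pw_calculus f (\<lambda>y. A y + e1 *\<^sub>R y) (\<lambda>y. B y + e2 *\<^sub>R y) x)
      \<longlongrightarrow> pw_calculus f A B x) ?F"
    unfolding pw by (rule Lim_transform_eventually)
qed

end
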